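(* Let $G=A_5\simeq\mathrm{PSL}_2(\mathbb{F}_4)$ and $H\simeq A_4$. There is a flabby resolution $0\to J_{G/H}\to P\to F\to0$ with $\mathrm{rank}_{\mathbb{Z}}F=16$ such that there is an isomorphism of $A_5$-lattices $$\mathbb{Z}[A_5/C_5]\oplus\mathbb{Z}[A_5/S_3]\simeq\mathbb{Z}[A_5/D_5]\oplus F$$ (rank $22$). In particular $F$ is stably permutation.
   Context: A $G$-lattice is a finitely generated $\mathbb{Z}[G]$-module free over $\mathbb{Z}$. A permutation $G$-lattice is one isomorphic to $\bigoplus_i\mathbb{Z}[G/H_i]$. Stably permutation: $M\oplus P\simeq P'$ with $P,P'$ permutation. $F$ is flabby if $\widehat H^{-1}(H',F)=0$ for all subgroups $H'\le G$. A flabby resolution of $M$ is an exact sequence $0\to M\to P\to F\to0$ with $P$ permutation and $F$ flabby. The Chevalley module is $J_{G/H}=\mathrm{Hom}_{\mathbb{Z}}(I_{G/H},\mathbb{Z})$ where $I_{G/H}=\ker(\mathbb{Z}[G/H]\to\mathbb{Z})$. $D_5$ is dihedral of order $10$; the subgroups $C_5$, $S_3$, $D_5$ of $A_5$ are each unique up to conjugacy. *)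

theory Defs
  imports "HOL-Algebra.Algebra" "Jordan_Normal_Form.Matrix"
begin

text \<open>Dihedral group of order 2n: symmetries of the regular n-gon with vertices
 0,...,n-1, as permutations of nat fixing everything outside {0..<n}.\<close>
definition dihedral_perms :: "nat \<Rightarrow> (nat \<Rightarrow> nat) set" where
  "dihedral_perms n =
     {(\<lambda>x. if x < n then (b + x) mod n else x) | b. b < n}
     \<union> {(\<lambda>x. if x < n then (b + (n - x)) mod n else x) | b. b < n}"

definition dihedral_group :: "nat \<Rightarrow> (nat \<Rightarrow> nat) monoid" where
  "dihedral_group n = (sym_group n)\<lparr>carrier := dihedral_perms n\<rparr>"

definition glattice :: "('g, 'b) monoid_scheme \<Rightarrow> nat \<Rightarrow> ('g \<Rightarrow> int mat) \<Rightarrow> bool" where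
  "glattice G n \<rho> \<longleftrightarrow>
     (\<forall>g\<in>carrier G. \<rho> g \<in> carrier_mat n n) \<and> \<rho> \<one>\<^bsub>G\<^esub> = 1\<^sub>m n \<and>
     (\<forall>g\<in>carrier G. \<forall>h\<in>carrier G. \<rho> (g \<otimes>\<^bsub>G\<^esub> h) = \<rho> g * \<rho> h)"

definition ghom :: "('g, 'b) monoid_scheme \<Rightarrow> nat \<Rightarrow> ('g \<Rightarrow> int mat) \<Rightarrow> nat \<Rightarrow> ('g \<Rightarrow> int mat)
    \<Rightarrow> int mat \<Rightarrow> bool" where
  "ghom G m \<rho> n \<sigma> A \<longleftrightarrow> A \<in> carrier_mat n m \<and> (\<forall>g\<in>carrier G. A * \<rho> g = \<sigma> g * A)"

definition giso :: "('g, 'b) monoid_scheme \<Rightarrow> nat \<Rightarrow> ('g \<Rightarrow> int mat) \<Rightarrow> nat \<Rightarrow> ('g \<Rightarrow> int mat)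
    \<Rightarrow> bool" where
  "giso G m \<rho> n \<sigma> \<longleftrightarrow> (\<exists>A B. ghom G m \<rho> n \<sigma> A \<and> B \<in> carrier_mat m n \<and>
        B * A = 1\<^sub>m m \<and> A * B = 1\<^sub>m n)"

definition dsum :: "nat \<Rightarrow> ('g \<Rightarrow> int mat) \<Rightarrow> nat \<Rightarrow> ('g \<Rightarrow> int mat) \<Rightarrow> ('g \<Rightarrow> int mat)" where
  "dsum m \<rho> n \<sigma> = (\<lambda>g. four_block_mat (\<rho> g) (0\<^sub>m m n) (0\<^sub>m n m) (\<sigma> g))"

text \<open>(n, rho) is a realisation of Z[G/H]: its standard basis is identified (via e)
  with the left cosets gH, and G permutes it by left multiplication.\<close>
definition coset_lattice :: "('g, 'b) monoid_scheme \<Rightarrow> 'g set \<Rightarrow> nat \<Rightarrow> ('g \<Rightarrow> int mat) \<Rightarrow> bool" where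
  "coset_lattice G H n \<rho> \<longleftrightarrow> subgroup H G \<and>
     (\<exists>e. bij_betw e {..<n} {g <#\<^bsub>G\<^esub> H | g. g \<in> carrier G} \<and>
        (\<forall>g\<in>carrier G. \<rho> g = mat n n (\<lambda>(j, i). if e j = g <#\<^bsub>G\<^esub> e i then 1 else 0)))"

inductive perm_sum :: "('g, 'b) monoid_scheme \<Rightarrow> nat \<Rightarrow> ('g \<Rightarrow> int mat) \<Rightarrow> bool"
  for G where
  perm_sum_zero: "perm_sum G 0 (\<lambda>g. 1\<^sub>m 0)"
| perm_sum_step: "coset_lattice G H m \<rho> \<Longrightarrow> perm_sum G n \<sigma> \<Longrightarrow>
                  perm_sum G (m + n) (dsum m \<rho> n \<sigma>)"

definition permutation_lattice :: "('g, 'b) monoid_scheme \<Rightarrow> nat \<Rightarrow> ('g \<Rightarrow> int mat) \<Rightarrow> bool" where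
  "permutation_lattice G n \<rho> \<longleftrightarrow> glattice G n \<rho> \<and>
     (\<exists>m \<sigma>. perm_sum G m \<sigma> \<and> giso G n \<rho> m \<sigma>)"

definition stably_permutation :: "('g, 'b) monoid_scheme \<Rightarrow> nat \<Rightarrow> ('g \<Rightarrow> int mat) \<Rightarrow> bool" where
  "stably_permutation G n \<rho> \<longleftrightarrow> glattice G n \<rho> \<and>
     (\<exists>p \<pi> p' \<pi>'. permutation_lattice G p \<pi> \<and> permutation_lattice G p' \<pi>' \<and>
        giso G (n + p) (dsum n \<rho> p \<pi>) p' \<pi>')"

text \<open>Tate cohomology: \<open>Hhat^{-1}(H, M) = ker(N_H) / I_H M\<close> with \<open>N_H = \<Sum>_{h\<in>H} h\<close>
  and \<open>I_H M\<close> the Z-span of the \<open>(h - 1) y\<close>; vanishing means every x killed by N_H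
  is a sum of elements \<open>(h - 1) y_h\<close>.\<close>
definition tate_minus1_vanishes :: "('g, 'b) monoid_scheme \<Rightarrow> 'g set \<Rightarrow> nat \<Rightarrow> ('g \<Rightarrow> int mat) \<Rightarrow> bool" where
  "tate_minus1_vanishes G H n \<rho> \<longleftrightarrow>
     (\<forall>x\<in>carrier_vec n. (\<forall>i<n. (\<Sum>h\<in>H. (\<rho> h *\<^sub>v x) $ i) = 0) \<longrightarrow>
        (\<exists>y. (\<forall>h\<in>H. y h \<in> carrier_vec n) \<and>
             (\<forall>i<n. x $ i = (\<Sum>h\<in>H. (\<rho> h *\<^sub>v y h) $ i - y h $ i))))"

definition flabby :: "('g, 'b) monoid_scheme \<Rightarrow> nat \<Rightarrow> ('g \<Rightarrow> int mat) \<Rightarrow> bool" where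
  "flabby G n \<rho> \<longleftrightarrow> glattice G n \<rho> \<and> (\<forall>H. subgroup H G \<longrightarrow> tate_minus1_vanishes G H n \<rho>)"

definition short_exact :: "('g, 'b) monoid_scheme \<Rightarrow> nat \<Rightarrow> ('g \<Rightarrow> int mat) \<Rightarrow> nat \<Rightarrow> ('g \<Rightarrow> int mat)
    \<Rightarrow> nat \<Rightarrow> ('g \<Rightarrow> int mat) \<Rightarrow> int mat \<Rightarrow> int mat \<Rightarrow> bool" where
  "short_exact G m \<mu> p \<pi> f \<phi> A B \<longleftrightarrow>
     ghom G m \<mu> p \<pi> A \<and> ghom G p \<pi> f \<phi> B \<and>
     (\<forall>v\<in>carrier_vec m. A *\<^sub>v v = 0\<^sub>v p \<longrightarrow> v = 0\<^sub>v m) \<and>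
     {w \<in> carrier_vec p. B *\<^sub>v w = 0\<^sub>v f} = (\<lambda>v. A *\<^sub>v v) ` carrier_vec m \<and>
     (\<forall>u\<in>carrier_vec f. \<exists>w\<in>carrier_vec p. B *\<^sub>v w = u)"

definition flabby_resolution :: "('g, 'b) monoid_scheme \<Rightarrow> nat \<Rightarrow> ('g \<Rightarrow> int mat) \<Rightarrow> nat \<Rightarrow> ('g \<Rightarrow> int mat)
    \<Rightarrow> nat \<Rightarrow> ('g \<Rightarrow> int mat) \<Rightarrow> int mat \<Rightarrow> int mat \<Rightarrow> bool" where
  "flabby_resolution G m \<mu> p \<pi> f \<phi> A B \<longleftrightarrow>
     glattice G m \<mu> \<and> permutation_lattice G p \<pi> \<and> flabby G f \<phi> \<and> short_exact G m \<mu> p \<pi> f \<phi> A B"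

text \<open>Chevalley module \<open>J_{G/H} = Hom_Z(I_{G/H}, Z)\<close>: (n, rho) is the Z-dual (contragredient,
  \<open>(g f)(x) = f(g^{-1} x)\<close>, i.e. \<open>rho g = (iota (g^{-1}))^T\<close>) of a lattice (n, iota)
  embedded by C into a realisation of Z[G/H] with image exactly the augmentation kernel.\<close>
definition chevalley_module :: "('g, 'b) monoid_scheme \<Rightarrow> 'g set \<Rightarrow> nat \<Rightarrow> ('g \<Rightarrow> int mat) \<Rightarrow> bool" where
  "chevalley_module G H n \<rho> \<longleftrightarrow>
     (\<exists>m \<kappa> \<iota> C. coset_lattice G H m \<kappa> \<and> glattice G n \<iota> \<and> ghom G n \<iota> m \<kappa> C \<and>
        (\<forall>v\<in>carrier_vec n. C *\<^sub>v v = 0\<^sub>v m \<longrightarrow> v = 0\<^sub>v n) \<and>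
        (\<lambda>v. C *\<^sub>v v) ` carrier_vec n = {w \<in> carrier_vec m. (\<Sum>i<m. w $ i) = 0} \<and>
        (\<forall>g\<in>carrier G. \<rho> g = transpose_mat (\<iota> (inv\<^bsub>G\<^esub> g))))"

end

theory Submission
  imports Defs "Jordan_Normal_Form.Determinant"
begin

text \<open>Let \<open>A\<^sub>5\<close> act on relations on \<open>{1..5}\<close>. The transitive sets with stabilizers \<open>A\<^sub>4\<close>, \<open>C\<^sub>3\<close>, \<open>S\<^sub>3\<close>, \<open>C\<^sub>5\<close>, \<open>D\<^sub>5\<close>
  are the points, the ordered pairs, the unordered pairs, one of the two classes of 12 directed pentagons,
  and the 6 undirected pentagons underlying them. The Chevalley module is the quotient of the lattice on
  the points by the sum of all points, and sending a point to the sum of its outgoing minus its incoming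
  pairs embeds it as a direct summand (over the integers) into the lattice on the 20 ordered pairs;
  \<open>F\<close> is the cokernel, with basis the 16 pairs that do not end in 5.

  A map from the lattice on pairs to another permutation lattice is given by an invariant kernel, and it
  factors through \<open>F\<close> if in-degrees equal out-degrees. The kernels ``the pair is an edge of the pentagon'' and
  ``the pair orients the unordered pair'', together with \<open>1 + [c \<subseteq> x]\<close> (directed pentagon \<open>c\<close>, undirected
  pentagon \<open>x\<close>) and \<open>[s \<subseteq> x]\<close> (unordered pair \<open>s\<close>), form an equivariant unimodular 22 by 22 matrix from
  \<open>Z[A\<^sub>5/D\<^sub>5] \<oplus> F\<close> to \<open>Z[A\<^sub>5/C\<^sub>5] \<oplus> Z[A\<^sub>5/S\<^sub>3]\<close>. Flabbiness of \<open>F\<close> then follows, because Tate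
  cohomology in degree -1 vanishes for permutation lattices and hence for their direct summands.\<close>

section \<open>Homomorphisms and direct sums of lattices\<close>

text \<open>The statement ranges over all subgroups isomorphic to the given ones and over all bases,
  while an explicit matrix needs one fixed model. Each such subgroup is therefore shown to fix an
  element of the relevant orbit; then every realisation of its coset lattice equals the matrix
  representation of that orbit in some enumeration, and two enumerations give isomorphic lattices.
  Placing all orbits in one action on relations makes kernels written with inclusions and
  projections invariant at sight. The splitting of the embedding singles out the point 5 and is not
  equivariant. Hence the action on \<open>F\<close> is transported along it: a group element lifts
  with the section, acts on pairs, and projects back; that this is an action and a quotient has to
  be derived from the matrix identities of the splitting.\<close>

lemma glattice_carrier: "glattice G n \<rho> \<Longrightarrow> g \<in> carrier G \<Longrightarrow> \<rho> g \<in> carrier_mat n n"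
  by (simp add: glattice_def)

lemma ghom_carrier: "ghom G m \<rho> n \<sigma> A \<Longrightarrow> A \<in> carrier_mat n m"
  by (simp add: ghom_def)

lemma ghom_comp:
  assumes "glattice G m \<rho>" "glattice G n \<sigma>" "glattice G p \<tau>"
    and A: "ghom G m \<rho> n \<sigma> A" and B: "ghom G n \<sigma> p \<tau> B"
  shows "ghom G m \<rho> p \<tau> (B * A)"
  unfolding ghom_def
proof (intro conjI ballI)
  have cA: "A \<in> carrier_mat n m" and cB: "B \<in> carrier_mat p n"
    using A B by (auto dest: ghom_carrier)
  show "B * A \<in> carrier_mat p m" using cA cB by simp
  fix g assume g: "g \<in> carrier G"
  note c = assms(1-3)[THEN glattice_carrier, OF g]
  have "B * A * \<rho> g = B * (\<sigma> g * A)"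
    using A g c cA cB by (simp add: ghom_def)
  also have "\<dots> = \<tau> g * B * A"
    using B g c cA cB by (simp add: ghom_def flip: assoc_mult_mat[of B])
  also have "\<dots> = \<tau> g * (B * A)"
    using c cA cB by simp
  finally show "B * A * \<rho> g = \<tau> g * (B * A)" .
qed

text \<open>\<open>giso\<close> demands equivariance in one direction only. The inverse inherits it:
  multiply \<open>B * \<sigma> g\<close> by \<open>A * B = 1\<close> on the right and move
  \<open>A\<close> past the action.\<close>

lemma ghom_inverse:
  assumes \<rho>: "glattice G m \<rho>" and \<sigma>: "glattice G n \<sigma>" and A: "ghom G m \<rho> n \<sigma> A"
    and B: "B \<in> carrier_mat m n" and BA: "B * A = 1\<^sub>m m" and AB: "A * B = 1\<^sub>m n"
  shows "ghom G n \<sigma> m \<rho> B"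
  unfolding ghom_def
proof (intro conjI ballI B)
  have cA: "A \<in> carrier_mat n m" using A by (rule ghom_carrier)
  fix g assume g: "g \<in> carrier G"
  note c = glattice_carrier[OF \<rho> g] glattice_carrier[OF \<sigma> g]
  have "B * \<sigma> g = B * \<sigma> g * (A * B)" using c B by (simp add: AB)
  also have "\<dots> = B * (\<sigma> g * A) * B" using c B cA by (simp add: assoc_mult_mat[of _ m n _ n _ n] assoc_mult_mat[of _ m n _ m _ n] assoc_mult_mat[of _ n n _ m _ n])
  also have "\<dots> = B * (A * \<rho> g) * B" using A g by (simp add: ghom_def)
  also have "\<dots> = (B * A) * \<rho> g * B" using c B cA by (simp add: assoc_mult_mat[of _ m n _ m _ m])
  also have "\<dots> = \<rho> g * B" using c by (simp add: BA)
  finally show "B * \<sigma> g = \<rho> g * B" .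
qed

lemma giso_sym:
  assumes "glattice G m \<rho>" "glattice G n \<sigma>" "giso G m \<rho> n \<sigma>"
  shows "giso G n \<sigma> m \<rho>"
  using assms ghom_inverse ghom_carrier unfolding giso_def by metis

lemma giso_trans:
  assumes \<rho>: "glattice G m \<rho>" and \<sigma>: "glattice G n \<sigma>" and \<tau>: "glattice G p \<tau>"
    and "giso G m \<rho> n \<sigma>" "giso G n \<sigma> p \<tau>"
  shows "giso G m \<rho> p \<tau>"
proof -
  obtain A A' where A: "ghom G m \<rho> n \<sigma> A" "A' \<in> carrier_mat m n" "A' * A = 1\<^sub>m m" "A * A' = 1\<^sub>m n"
    using assms by (auto simp: giso_def)
  obtain B B' where B: "ghom G n \<sigma> p \<tau> B" "B' \<in> carrier_mat n p" "B' * B = 1\<^sub>m n" "B * B' = 1\<^sub>m p"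
    using assms by (auto simp: giso_def)
  have cA: "A \<in> carrier_mat n m" and cB: "B \<in> carrier_mat p n"
    using A B by (auto dest: ghom_carrier)
  have "(A' * B') * (B * A) = A' * (B' * B) * A"
    using A(2) B(2) cA cB by (simp add: assoc_mult_mat[of _ m n _ p _ m] assoc_mult_mat[of _ n p _ n _ m]
        assoc_mult_mat[of _ m n _ n _ m])
  moreover have "(B * A) * (A' * B') = B * (A * A') * B'"
    using A(2) B(2) cA cB by (simp add: assoc_mult_mat[of _ p n _ m _ p] assoc_mult_mat[of _ n m _ n _ p]
        assoc_mult_mat[of _ p n _ n _ p])
  ultimately have "(A' * B') * (B * A) = 1\<^sub>m m" "(B * A) * (A' * B') = 1\<^sub>m p"
    using A B cA cB by simp_all
  then show ?thesis
    unfolding giso_def using ghom_comp[OF \<rho> \<sigma> \<tau> A(1) B(1)] A(2) B(2)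
    by (intro exI[of _ "B * A"] exI[of _ "A' * B'"]) simp
qed

text \<open>A lattice is a function on the whole type of group elements, but only its values on the
  carrier are meaningful; this exchanges functions that agree there.\<close>

lemma giso_cong:
  assumes "\<And>g. g \<in> carrier G \<Longrightarrow> \<rho> g = \<rho>' g" "\<And>g. g \<in> carrier G \<Longrightarrow> \<sigma> g = \<sigma>' g"
  shows "giso G m \<rho> n \<sigma> \<longleftrightarrow> giso G m \<rho>' n \<sigma>'"
  using assms by (simp add: giso_def ghom_def)

lemma giso_refl: "glattice G n \<rho> \<Longrightarrow> giso G n \<rho> n \<rho>"
  unfolding giso_def ghom_def
  by (intro exI[of _ "1\<^sub>m n"]) (auto dest: glattice_carrier)

lemma glattice_dsum:
  assumes "glattice G m \<rho>" "glattice G n \<sigma>" "group G"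
  shows "glattice G (m + n) (dsum m \<rho> n \<sigma>)"
  unfolding glattice_def
proof (intro conjI ballI)
  interpret group G by fact
  show "dsum m \<rho> n \<sigma> g \<in> carrier_mat (m + n) (m + n)" if "g \<in> carrier G" for g
    using assms that by (auto simp: dsum_def glattice_def)
  show "dsum m \<rho> n \<sigma> \<one>\<^bsub>G\<^esub> = 1\<^sub>m (m + n)"
    using assms by (simp add: dsum_def glattice_def)
  fix g h assume gh: "g \<in> carrier G" "h \<in> carrier G"
  note c = assms(1,2)[THEN glattice_carrier, OF gh(1)] assms(1,2)[THEN glattice_carrier, OF gh(2)]
  have "\<rho> (g \<otimes>\<^bsub>G\<^esub> h) = \<rho> g * \<rho> h" "\<sigma> (g \<otimes>\<^bsub>G\<^esub> h) = \<sigma> g * \<sigma> h"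
    using assms(1,2) gh by (simp_all add: glattice_def)
  with c show "dsum m \<rho> n \<sigma> (g \<otimes>\<^bsub>G\<^esub> h) = dsum m \<rho> n \<sigma> g * dsum m \<rho> n \<sigma> h"
    unfolding dsum_def
    by (subst mult_four_block_mat[of _ m m _ n _ n _ _ m _ n])
      (simp_all add: left_add_zero_mat[of _ n n] right_add_zero_mat[of _ m m])
qed

lemma ghom_four_block:
  assumes \<rho>: "glattice G m1 \<rho>1" "glattice G m2 \<rho>2" and \<sigma>: "glattice G n1 \<sigma>1" "glattice G n2 \<sigma>2"
    and h: "ghom G m1 \<rho>1 n1 \<sigma>1 A" "ghom G m2 \<rho>2 n1 \<sigma>1 B"
      "ghom G m1 \<rho>1 n2 \<sigma>2 C" "ghom G m2 \<rho>2 n2 \<sigma>2 D"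
  shows "ghom G (m1 + m2) (dsum m1 \<rho>1 m2 \<rho>2) (n1 + n2) (dsum n1 \<sigma>1 n2 \<sigma>2) (four_block_mat A B C D)"
  unfolding ghom_def
proof (intro conjI ballI)
  note ch = h[THEN ghom_carrier]
  show "four_block_mat A B C D \<in> carrier_mat (n1 + n2) (m1 + m2)" using ch by simp
  fix g assume g: "g \<in> carrier G"
  note c = \<rho>[THEN glattice_carrier, OF g] \<sigma>[THEN glattice_carrier, OF g]
  have "four_block_mat A B C D * dsum m1 \<rho>1 m2 \<rho>2 g
      = four_block_mat (A * \<rho>1 g) (B * \<rho>2 g) (C * \<rho>1 g) (D * \<rho>2 g)"
    unfolding dsum_def using c ch
    by (subst mult_four_block_mat[of _ n1 m1 _ m2 _ n2 _ _ m1 _ m2]) simp_all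
  also have "\<dots> = dsum n1 \<sigma>1 n2 \<sigma>2 g * four_block_mat A B C D"
    unfolding dsum_def using c ch h g
    by (subst mult_four_block_mat[of _ n1 n1 _ n2 _ n2 _ _ m1 _ m2]) (simp_all add: ghom_def)
  finally show "four_block_mat A B C D * dsum m1 \<rho>1 m2 \<rho>2 g = dsum n1 \<sigma>1 n2 \<sigma>2 g * four_block_mat A B C D" .
qed

lemma ghom_zero:
  assumes "glattice G m \<rho>" "glattice G n \<sigma>"
  shows "ghom G m \<rho> n \<sigma> (0\<^sub>m n m)"
proof -
  have "0\<^sub>m n m * \<rho> g = \<sigma> g * 0\<^sub>m n m" if "g \<in> carrier G" for g
    using assms[THEN glattice_carrier, OF that] by simp
  then show ?thesis by (simp add: ghom_def)
qed

lemma giso_dsum: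
  assumes l: "glattice G m \<rho>" "glattice G n \<sigma>" "glattice G m' \<rho>'" "glattice G n' \<sigma>'"
    and "giso G m \<rho> m' \<rho>'" "giso G n \<sigma> n' \<sigma>'"
  shows "giso G (m + n) (dsum m \<rho> n \<sigma>) (m' + n') (dsum m' \<rho>' n' \<sigma>')"
proof -
  obtain A A' where A: "ghom G m \<rho> m' \<rho>' A" "A' \<in> carrier_mat m m'" "A' * A = 1\<^sub>m m" "A * A' = 1\<^sub>m m'"
    using assms by (auto simp: giso_def)
  obtain B B' where B: "ghom G n \<sigma> n' \<sigma>' B" "B' \<in> carrier_mat n n'" "B' * B = 1\<^sub>m n" "B * B' = 1\<^sub>m n'"
    using assms by (auto simp: giso_def)
  have c: "A \<in> carrier_mat m' m" "B \<in> carrier_mat n' n" using A B by (auto dest: ghom_carrier)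
  let ?A = "four_block_mat A (0\<^sub>m m' n) (0\<^sub>m n' m) B"
  let ?B = "four_block_mat A' (0\<^sub>m m n') (0\<^sub>m n m') B'"
  have "ghom G (m + n) (dsum m \<rho> n \<sigma>) (m' + n') (dsum m' \<rho>' n' \<sigma>') ?A"
    by (intro ghom_four_block ghom_zero l A B)
  moreover have "?B \<in> carrier_mat (m + n) (m' + n')" using A B by simp
  moreover have "?B * ?A = 1\<^sub>m (m + n)"
    using A B c by (subst mult_four_block_mat[of _ m m' _ n' _ n _ _ m _ n]) auto
  moreover have "?A * ?B = 1\<^sub>m (m' + n')"
    using A B c by (subst mult_four_block_mat[of _ m' m _ n _ n' _ _ m' _ n']) auto
  ultimately show ?thesis unfolding giso_def by blast
qed

lemma ghom_swap:
  assumes l: "glattice G m \<rho>" "glattice G n \<sigma>"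
  shows "ghom G (m + n) (dsum m \<rho> n \<sigma>) (n + m) (dsum n \<sigma> m \<rho>)
    (four_block_mat (0\<^sub>m n m) (1\<^sub>m n) (1\<^sub>m m) (0\<^sub>m m n))"
proof -
  have "ghom G n \<sigma> n \<sigma> (1\<^sub>m n)" "ghom G m \<rho> m \<rho> (1\<^sub>m m)"
    using l by (auto simp: ghom_def dest: glattice_carrier)
  then show ?thesis by (intro ghom_four_block ghom_zero l)
qed

text \<open>\<open>stably_permutation\<close> puts the given lattice first, whereas the isomorphism
  constructed below has \<open>F\<close> as the second summand.\<close>

lemma giso_dsum_swap:
  assumes l: "glattice G m \<rho>" "glattice G n \<sigma>"
  shows "giso G (m + n) (dsum m \<rho> n \<sigma>) (n + m) (dsum n \<sigma> m \<rho>)"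
  unfolding giso_def
proof (intro exI conjI)
  show "ghom G (m + n) (dsum m \<rho> n \<sigma>) (n + m) (dsum n \<sigma> m \<rho>)
    (four_block_mat (0\<^sub>m n m) (1\<^sub>m n) (1\<^sub>m m) (0\<^sub>m m n))"
    by (rule ghom_swap[OF l])
  let ?A = "\<lambda>m n. four_block_mat (0\<^sub>m n m :: int mat) (1\<^sub>m n) (1\<^sub>m m) (0\<^sub>m m n)"
  show "?A n m \<in> carrier_mat (m + n) (n + m)" by simp
  have "?A n m * ?A m n = 1\<^sub>m (m + n)" for m n
    by (subst mult_four_block_mat[of _ m n _ m _ n _ _ m _ n])
simp_all
  then show "?A n m * ?A m n = 1\<^sub>m (m + n)" "?A m n * ?A n m = 1\<^sub>m (n + m)" by blast+
qed

section \<open>Tate cohomology in degree -1\<close>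

lemma index_mult_mat_vec_sum:
  assumes "A \<in> carrier_mat n m" "v \<in> carrier_vec m" "i < n"
  shows "(A *\<^sub>v v) $ i = (\<Sum>j<m. A $$ (i, j) * v $ j)"
  using assms by (auto simp: scalar_prod_def atLeast0LessThan intro!: sum.cong)

text \<open>Naturality of the norm and of the elements (h - 1) y: \<open>A\<close> carries x to an
  element of norm zero, and \<open>B\<close> carries a decomposition of \<open>A *\<^sub>v x\<close>
  back to one of x.\<close>

lemma tate_minus1_vanishes_retract:
  assumes \<rho>: "glattice G m \<rho>" and \<sigma>: "glattice G n \<sigma>" and H: "H \<subseteq> carrier G"
    and A: "ghom G m \<rho> n \<sigma> A" and B: "ghom G n \<sigma> m \<rho> B" and BA: "B * A = 1\<^sub>m m"
    and van: "tate_minus1_vanishes G H n \<sigma>"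
  shows "tate_minus1_vanishes G H m \<rho>"
  unfolding tate_minus1_vanishes_def
proof (intro ballI impI)
  have cA: "A \<in> carrier_mat n m" and cB: "B \<in> carrier_mat m n"
    using A B by (auto dest: ghom_carrier)
  have c: "\<rho> h \<in> carrier_mat m m" "\<sigma> h \<in> carrier_mat n n" if "h \<in> H" for h
    using that H \<rho> \<sigma> by (auto dest: glattice_carrier)
  fix x :: "int vec" assume x: "x \<in> carrier_vec m" and N: "\<forall>i<m. (\<Sum>h\<in>H. (\<rho> h *\<^sub>v x) $ i) = 0"
  have "(\<Sum>h\<in>H. (\<sigma> h *\<^sub>v (A *\<^sub>v x)) $ i) = 0" if i: "i < n" for i
  proof -
    have "(\<Sum>h\<in>H. (\<sigma> h *\<^sub>v (A *\<^sub>v x)) $ i) = (\<Sum>h\<in>H. \<Sum>j<m. A $$ (i, j) * (\<rho> h *\<^sub>v x) $ j)"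
    proof (rule sum.cong[OF refl])
      fix h assume h: "h \<in> H"
      have "\<sigma> h *\<^sub>v (A *\<^sub>v x) = (\<sigma> h * A) *\<^sub>v x"
        using c[OF h] cA x by simp
      also have "\<dots> = (A * \<rho> h) *\<^sub>v x"
        using A h H by (auto simp: ghom_def)
      also have "\<dots> = A *\<^sub>v (\<rho> h *\<^sub>v x)"
        using c[OF h] cA x by simp
      finally show "(\<sigma> h *\<^sub>v (A *\<^sub>v x)) $ i = (\<Sum>j<m. A $$ (i, j) * (\<rho> h *\<^sub>v x) $ j)"
        using index_mult_mat_vec_sum[OF cA _ i] c[OF h] x by (simp only: mult_mat_vec_carrier)
    qed
    also have "\<dots> = (\<Sum>j<m. A $$ (i, j) * (\<Sum>h\<in>H. (\<rho> h *\<^sub>v x) $ j))"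
      by (subst sum.swap) (simp add: sum_distrib_left)
    finally show ?thesis using N by simp
  qed
  then obtain y where y: "\<forall>h\<in>H. y h \<in> carrier_vec n"
    and xy: "\<forall>i<n. (A *\<^sub>v x) $ i = (\<Sum>h\<in>H. (\<sigma> h *\<^sub>v y h) $ i - y h $ i)"
    using van[unfolded tate_minus1_vanishes_def, rule_format, OF mult_mat_vec_carrier[OF cA x]] by auto
  show "\<exists>y. (\<forall>h\<in>H. y h \<in> carrier_vec m) \<and> (\<forall>i<m. x $ i = (\<Sum>h\<in>H. (\<rho> h *\<^sub>v y h) $ i - y h $ i))"
  proof (intro exI[of _ "\<lambda>h. B *\<^sub>v y h"] conjI ballI allI impI)
    show "B *\<^sub>v y h \<in> carrier_vec m" if "h \<in> H" for h
      using y that cB by auto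
    fix i assume i: "i < m"
    have "x $ i = (B *\<^sub>v (A *\<^sub>v x)) $ i"
      using cA cB x by (simp add: BA flip: assoc_mult_mat_vec)
    also have "\<dots> = (\<Sum>j<n. B $$ (i, j) * (\<Sum>h\<in>H. (\<sigma> h *\<^sub>v y h) $ j - y h $ j))"
      using index_mult_mat_vec_sum[OF cB mult_mat_vec_carrier[OF cA x] i] xy
      by (simp del: index_mult_mat_vec)
    also have "\<dots> = (\<Sum>h\<in>H. \<Sum>j<n. B $$ (i, j) * ((\<sigma> h *\<^sub>v y h) $ j - y h $ j))"
      unfolding sum_distrib_left by (rule sum.swap)
    also have "\<dots> = (\<Sum>h\<in>H. (\<rho> h *\<^sub>v (B *\<^sub>v y h)) $ i - (B *\<^sub>v y h) $ i)"
    proof (rule sum.cong[OF refl])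
      fix h assume h: "h \<in> H"
      have "\<rho> h *\<^sub>v (B *\<^sub>v y h) = (\<rho> h * B) *\<^sub>v y h"
        using c[OF h] cB y h by (metis assoc_mult_mat_vec)
      also have "\<dots> = (B * \<sigma> h) *\<^sub>v y h"
        using B h H by (auto simp: ghom_def)
      also have "\<dots> = B *\<^sub>v (\<sigma> h *\<^sub>v y h)"
        using c[OF h] cB y h by (metis assoc_mult_mat_vec)
      finally show "(\<Sum>j<n. B $$ (i, j) * ((\<sigma> h *\<^sub>v y h) $ j - y h $ j))
          = (\<rho> h *\<^sub>v (B *\<^sub>v y h)) $ i - (B *\<^sub>v y h) $ i"
        using c(2)[OF h] cB y h i
        by (simp add: index_mult_mat_vec_sum[of _ m n] mult_mat_vec_carrier[of _ n n]
            right_diff_distrib sum_subtractf del: index_mult_mat_vec)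
    qed
    finally show "x $ i = (\<Sum>h\<in>H. (\<rho> h *\<^sub>v (B *\<^sub>v y h)) $ i - (B *\<^sub>v y h) $ i)" .
  qed
qed

lemma dsum_mult_vec:
  assumes "glattice G m \<rho>" "glattice G n \<sigma>" "g \<in> carrier G" "a \<in> carrier_vec m" "b \<in> carrier_vec n"
  shows "dsum m \<rho> n \<sigma> g *\<^sub>v (a @\<^sub>v b) = (\<rho> g *\<^sub>v a) @\<^sub>v (\<sigma> g *\<^sub>v b)"
  unfolding dsum_def using assms by (intro mult_mat_vec_split) (auto dest: glattice_carrier)

lemma tate_minus1_vanishes_dsum:
  assumes \<rho>: "glattice G m \<rho>" and \<sigma>: "glattice G n \<sigma>" and H: "H \<subseteq> carrier G"
    and van: "tate_minus1_vanishes G H m \<rho>" "tate_minus1_vanishes G H n \<sigma>"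
  shows "tate_minus1_vanishes G H (m + n) (dsum m \<rho> n \<sigma>)"
  unfolding tate_minus1_vanishes_def
proof (intro ballI impI)
  fix x :: "int vec" assume x: "x \<in> carrier_vec (m + n)"
    and N: "\<forall>i<m + n. (\<Sum>h\<in>H. (dsum m \<rho> n \<sigma> h *\<^sub>v x) $ i) = 0"
  define a where "a = vec_first x m"
  define b where "b = vec_last x n"
  have ab: "a \<in> carrier_vec m" "b \<in> carrier_vec n" "x = a @\<^sub>v b"
    using x by (auto simp: a_def b_def)
  have app: "dsum m \<rho> n \<sigma> h *\<^sub>v (u @\<^sub>v v) = (\<rho> h *\<^sub>v u) @\<^sub>v (\<sigma> h *\<^sub>v v)"
    if "h \<in> H" "u \<in> carrier_vec m" "v \<in> carrier_vec n" for h u v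
    using dsum_mult_vec[OF \<rho> \<sigma>] that H by auto
  have d: "\<rho> h \<in> carrier_mat m m" "\<sigma> h \<in> carrier_mat n n" if "h \<in> H" for h
    using that H \<rho> \<sigma> by (auto dest: glattice_carrier)
  have "\<forall>i<m. (\<Sum>h\<in>H. (\<rho> h *\<^sub>v a) $ i) = 0"
  proof (intro allI impI)
    fix i assume i: "i < m"
    have "(\<Sum>h\<in>H. (\<rho> h *\<^sub>v a) $ i) = (\<Sum>h\<in>H. (dsum m \<rho> n \<sigma> h *\<^sub>v x) $ i)"
      using i d[THEN carrier_matD(1)] by (intro sum.cong) (simp_all add: ab app)
    then show "(\<Sum>h\<in>H. (\<rho> h *\<^sub>v a) $ i) = 0" using N i by simp
  qed
  then obtain y where y: "\<forall>h\<in>H. y h \<in> carrier_vec m"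
    "\<forall>i<m. a $ i = (\<Sum>h\<in>H. (\<rho> h *\<^sub>v y h) $ i - y h $ i)"
    using van(1)[unfolded tate_minus1_vanishes_def, rule_format, OF ab(1)] by auto
  have "\<forall>i<n. (\<Sum>h\<in>H. (\<sigma> h *\<^sub>v b) $ i) = 0"
  proof (intro allI impI)
    fix i assume i: "i < n"
    have "(\<Sum>h\<in>H. (\<sigma> h *\<^sub>v b) $ i) = (\<Sum>h\<in>H. (dsum m \<rho> n \<sigma> h *\<^sub>v x) $ (m + i))"
      using i d[THEN carrier_matD(1)] by (intro sum.cong) (simp_all add: ab app)
    then show "(\<Sum>h\<in>H. (\<sigma> h *\<^sub>v b) $ i) = 0" using N i by simp
  qed
  then obtain z where z: "\<forall>h\<in>H. z h \<in> carrier_vec n"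
    "\<forall>i<n. b $ i = (\<Sum>h\<in>H. (\<sigma> h *\<^sub>v z h) $ i - z h $ i)"
    using van(2)[unfolded tate_minus1_vanishes_def, rule_format, OF ab(2)] by auto
  show "\<exists>y. (\<forall>h\<in>H. y h \<in> carrier_vec (m + n)) \<and>
      (\<forall>i<m + n. x $ i = (\<Sum>h\<in>H. (dsum m \<rho> n \<sigma> h *\<^sub>v y h) $ i - y h $ i))"
  proof (intro exI[of _ "\<lambda>h. y h @\<^sub>v z h"] conjI ballI allI impI)
    show "y h @\<^sub>v z h \<in> carrier_vec (m + n)" if "h \<in> H" for h using y z that by auto
    fix i assume i: "i < m + n"
    have "(dsum m \<rho> n \<sigma> h *\<^sub>v (y h @\<^sub>v z h)) $ i - (y h @\<^sub>v z h) $ i =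
       (if i < m then (\<rho> h *\<^sub>v y h) $ i - y h $ i else (\<sigma> h *\<^sub>v z h) $ (i - m) - z h $ (i - m))"
      if h: "h \<in> H" for h
      using y(1)[rule_format, OF h] z(1)[rule_format, OF h] d[OF h] i
      by (simp add: app[OF h])
    then have "(\<Sum>h\<in>H. (dsum m \<rho> n \<sigma> h *\<^sub>v (y h @\<^sub>v z h)) $ i - (y h @\<^sub>v z h) $ i) =
       (\<Sum>h\<in>H. if i < m then (\<rho> h *\<^sub>v y h) $ i - y h $ i
          else (\<sigma> h *\<^sub>v z h) $ (i - m) - z h $ (i - m))"
      by (intro sum.cong) auto
    also have "\<dots> = x $ i"
      using i y(2) z(2) ab by (cases "i < m") auto
    finally show "x $ i = (\<Sum>h\<in>H. (dsum m \<rho> n \<sigma> h *\<^sub>v (y h @\<^sub>v z h)) $ i - (y h @\<^sub>v z h) $ i)" by simp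
  qed
qed

text \<open>The second summand is a retract by inclusion and projection; on vectors these are
  padding with zeros in front and taking the last n coordinates.\<close>

lemma tate_minus1_vanishes_dsumD:
  assumes \<rho>: "glattice G m \<rho>" and \<sigma>: "glattice G n \<sigma>" and H: "H \<subseteq> carrier G"
    and van: "tate_minus1_vanishes G H (m + n) (dsum m \<rho> n \<sigma>)"
  shows "tate_minus1_vanishes G H n \<sigma>"
  unfolding tate_minus1_vanishes_def
proof (intro ballI impI)
  fix x :: "int vec" assume x: "x \<in> carrier_vec n" and N: "\<forall>i<n. (\<Sum>h\<in>H. (\<sigma> h *\<^sub>v x) $ i) = 0"
  have d: "\<rho> h \<in> carrier_mat m m" "\<sigma> h \<in> carrier_mat n n" if "h \<in> H" for h
    using that H \<rho> \<sigma> by (auto dest: glattice_carrier)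
  have app: "dsum m \<rho> n \<sigma> h *\<^sub>v (u @\<^sub>v v) = (\<rho> h *\<^sub>v u) @\<^sub>v (\<sigma> h *\<^sub>v v)"
    if "h \<in> H" "u \<in> carrier_vec m" "v \<in> carrier_vec n" for h u v
    using dsum_mult_vec[OF \<rho> \<sigma>] that H by auto
  have "(\<Sum>h\<in>H. (dsum m \<rho> n \<sigma> h *\<^sub>v (0\<^sub>v m @\<^sub>v x)) $ i) = 0" if i: "i < m + n" for i
  proof -
    have "(dsum m \<rho> n \<sigma> h *\<^sub>v (0\<^sub>v m @\<^sub>v x)) $ i = (if i < m then 0 else (\<sigma> h *\<^sub>v x) $ (i - m))"
      if h: "h \<in> H" for h
      using d[OF h] x i by (simp add: app[OF h])
    then have "(\<Sum>h\<in>H. (dsum m \<rho> n \<sigma> h *\<^sub>v (0\<^sub>v m @\<^sub>v x)) $ i) =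
       (\<Sum>h\<in>H. if i < m then 0 else (\<sigma> h *\<^sub>v x) $ (i - m))"
      by (intro sum.cong) auto
    then show ?thesis using N i by (cases "i < m") auto
  qed
  then obtain y where y: "\<forall>h\<in>H. y h \<in> carrier_vec (m + n)"
    "\<forall>i<m+n. (0\<^sub>v m @\<^sub>v x) $ i = (\<Sum>h\<in>H. (dsum m \<rho> n \<sigma> h *\<^sub>v y h) $ i - y h $ i)"
    using van[unfolded tate_minus1_vanishes_def, rule_format, of "0\<^sub>v m @\<^sub>v x"] x by auto
  show "\<exists>y. (\<forall>h\<in>H. y h \<in> carrier_vec n) \<and> (\<forall>i<n. x $ i = (\<Sum>h\<in>H. (\<sigma> h *\<^sub>v y h) $ i - y h $ i))"
  proof (intro exI[of _ "\<lambda>h. vec_last (y h) n"] conjI ballI allI impI)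
    show "vec_last (y h) n \<in> carrier_vec n" for h by simp
    fix i assume i: "i < n"
    have "(dsum m \<rho> n \<sigma> h *\<^sub>v y h) $ (m + i) - y h $ (m + i)
        = (\<sigma> h *\<^sub>v vec_last (y h) n) $ i - vec_last (y h) n $ i" if h: "h \<in> H" for h
    proof -
      have e: "y h = vec_first (y h) m @\<^sub>v vec_last (y h) n" using y(1) h by auto
      show ?thesis
        by (subst (1 2) e, subst app) (use h i d[OF h] in auto)
    qed
    then show "x $ i = (\<Sum>h\<in>H. (\<sigma> h *\<^sub>v vec_last (y h) n) $ i - vec_last (y h) n $ i)"
      using y(2)[rule_format, of "m + i"] i x by simp
  qed
qed

section \<open>Permutation modules\<close>

text \<open>Choose a representative \<open>r i\<close> of the orbit of each i, and
  \<open>t i\<close> in \<open>H\<close> moving \<open>r i\<close> to i. If the norm of x vanishes,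
  so does the sum of x over every orbit. Hence x is the sum over k of x_k times e_k - e_(r k), that
  is, of x_k (t k - 1) e_(r k); collecting the k with \<open>t k = h\<close> gives
  \<open>y h\<close>.\<close>

lemma tate_minus1_vanishes_perm_mat:
  fixes p :: "'g \<Rightarrow> nat \<Rightarrow> nat"
  assumes "group G" and H: "subgroup H G" and fin: "finite H"
    and \<rho>: "\<And>h. h \<in> H \<Longrightarrow> \<rho> h = mat n n (\<lambda>(j, i). if j = p h i then 1 else 0)"
    and p_less: "\<And>h i. h \<in> H \<Longrightarrow> i < n \<Longrightarrow> p h i < n"
    and p_one: "\<And>i. i < n \<Longrightarrow> p \<one>\<^bsub>G\<^esub> i = i"
    and p_mult: "\<And>h k i. h \<in> H \<Longrightarrow> k \<in> H \<Longrightarrow> i < n \<Longrightarrow> p (h \<otimes>\<^bsub>G\<^esub> k) i = p h (p k i)"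
  shows "tate_minus1_vanishes G H n \<rho>"
  unfolding tate_minus1_vanishes_def
proof (intro ballI impI)
  interpret group G by fact
  interpret H: subgroup H G by fact
  fix x :: "int vec" assume x: "x \<in> carrier_vec n" and N: "\<forall>i<n. (\<Sum>h\<in>H. (\<rho> h *\<^sub>v x) $ i) = 0"
  have p_inv: "p (inv\<^bsub>G\<^esub> h) (p h i) = i" if "h \<in> H" "i < n" for h i
    using p_mult[of "inv\<^bsub>G\<^esub> h" h i] that p_one by simp
  define rel where "rel i j \<longleftrightarrow> (\<exists>h\<in>H. j = p h i)" for i j
  \<comment> \<open>The choice depends on i only through the set of indices related to i, so all
    members of an orbit get the same representative.\<close>
  define r where "r i = (SOME j. j < n \<and> rel i j)" for i
  have rel_refl: "rel i i" if "i < n" for i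
    unfolding rel_def using p_one[OF that] by (intro bexI[of _ "\<one>\<^bsub>G\<^esub>"]) auto
  have rel_sym: "rel j i" if "rel i j" "i < n" for i j
    using that p_inv unfolding rel_def by (metis H.m_inv_closed)
  have rel_trans: "rel i k" if "rel i j" "rel j k" "i < n" for i j k
    using that p_mult unfolding rel_def by (metis H.m_closed)
  have rel_less: "j < n" if "rel i j" "i < n" for i j
    using that p_less unfolding rel_def by auto
  have r: "r i < n" "rel i (r i)" if "i < n" for i
    using someI[of "\<lambda>j. j < n \<and> rel i j" i] that rel_refl[OF that] unfolding r_def by auto
  have rel_iff: "rel i j \<longleftrightarrow> r i = r j" if "i < n" "j < n" for i j
  proof
    assume "rel i j"
    then have "rel i k \<longleftrightarrow> rel j k" for k
      using that rel_sym rel_trans by blast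
    then show "r i = r j" unfolding r_def by simp
  next
    assume "r i = r j"
    then show "rel i j"
      using r[OF that(1)] r[OF that(2)] rel_sym rel_trans that by metis
  qed
  define t where "t i = (SOME h. h \<in> H \<and> i = p h (r i))" for i
  have t: "t i \<in> H" "p (t i) (r i) = i" if "i < n" for i
  proof -
    have "\<exists>h. h \<in> H \<and> i = p h (r i)"
      using rel_sym[OF r(2)[OF that] that] by (auto simp: rel_def)
    from someI_ex[OF this] show "t i \<in> H" "p (t i) (r i) = i"
      unfolding t_def by auto
  qed
  have mv: "(\<rho> h *\<^sub>v v) $ j = (\<Sum>i<n. if j = p h i then v $ i else 0)"
    if "h \<in> H" "v \<in> carrier_vec n" "j < n" for h v j
    using that by (subst index_mult_mat_vec_sum[of _ n n]) (auto simp: \<rho> intro!: sum.cong)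
  have orbit_sum: "(\<Sum>i<n. if r i = j then x $ i else 0) = 0" for j
  proof (cases "\<exists>i<n. r i = j")
    case False
    then show ?thesis by (intro sum.neutral) auto
  next
    case True
    then obtain i0 where "i0 < n" "r i0 = j" by auto
    then have j: "j < n" "r j = j"
      using r[of i0] rel_iff[of i0 j] by auto
    \<comment> \<open>The norm of x at j contains x_i once for each h that moves i to j. If i lies
      in the orbit of j, right multiplication by \<open>t i\<close> maps these h bijectively onto
      the stabilizer of j. So the norm at j is the order of the stabilizer times the orbit
      sum.\<close>
    have card_eq: "card {h \<in> H. j = p h i} = (if r i = j then card {h \<in> H. j = p h j} else 0)"
      if i: "i < n" for i
    proof (cases "r i = j")
      case True
      have "bij_betw (\<lambda>h. h \<otimes>\<^bsub>G\<^esub> t i) {h \<in> H. j = p h i} {h \<in> H. j = p h j}"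
      proof (rule bij_betwI[of _ _ _ "\<lambda>h. h \<otimes>\<^bsub>G\<^esub> inv\<^bsub>G\<^esub> t i"])
        have ti: "t i \<in> H" "p (t i) j = i" using t[OF i] True by auto
        then have ti': "p (inv\<^bsub>G\<^esub> t i) i = j" using p_inv[of "t i" j] j by auto
        show "(\<lambda>h. h \<otimes>\<^bsub>G\<^esub> t i) \<in> {h \<in> H. j = p h i} \<rightarrow> {h \<in> H. j = p h j}"
          using ti j by (auto simp: p_mult)
        show "(\<lambda>h. h \<otimes>\<^bsub>G\<^esub> inv\<^bsub>G\<^esub> t i) \<in> {h \<in> H. j = p h j} \<rightarrow> {h \<in> H. j = p h i}"
          using ti ti' i by (auto simp: p_mult)
        show "h \<otimes>\<^bsub>G\<^esub> t i \<otimes>\<^bsub>G\<^esub> inv\<^bsub>G\<^esub> t i = h" if "h \<in> {h \<in> H. j = p h i}" for h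
          using that ti by (auto simp: m_assoc)
        show "h \<otimes>\<^bsub>G\<^esub> inv\<^bsub>G\<^esub> t i \<otimes>\<^bsub>G\<^esub> t i = h" if "h \<in> {h \<in> H. j = p h j}" for h
          using that ti by (auto simp: m_assoc)
      qed
      then show ?thesis using True by (simp add: bij_betw_same_card)
    next
      case False
      then have "\<not> rel i j" using rel_iff[OF i j(1)] j(2) by simp
      then have "{h \<in> H. j = p h i} = {}" by (auto simp: rel_def)
      then show ?thesis using False by (metis card.empty)
    qed
    have "0 = (\<Sum>h\<in>H. \<Sum>i<n. if j = p h i then x $ i else 0)"
      using N j x by (simp add: mv del: index_mult_mat_vec)
    also have "\<dots> = (\<Sum>i<n. \<Sum>h\<in>H. if j = p h i then x $ i else 0)" by (rule sum.swap)
    also have "\<dots> = (\<Sum>i<n. int (card {h \<in> H. j = p h i}) * x $ i)"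
      using fin by (simp add: sum.If_cases Int_def)
    also have "\<dots> = int (card {h \<in> H. j = p h j}) * (\<Sum>i<n. if r i = j then x $ i else 0)"
      unfolding sum_distrib_left by (intro sum.cong) (auto simp: card_eq)
    finally have "int (card {h \<in> H. j = p h j}) * (\<Sum>i<n. if r i = j then x $ i else 0) = 0" by simp
    moreover have "\<one>\<^bsub>G\<^esub> \<in> {h \<in> H. j = p h j}" using p_one[OF j(1)] by simp
    then have "card {h \<in> H. j = p h j} \<noteq> 0"
      using fin card_eq_0_iff[of "{h \<in> H. j = p h j}"] finite_subset[of "{h \<in> H. j = p h j}" H] by blast
    ultimately show ?thesis by simp
  qed
  define y where "y h = vec n (\<lambda>j. \<Sum>k<n. if t k = h \<and> r k = j then x $ k else 0)" for h
  show "\<exists>y. (\<forall>h\<in>H. y h \<in> carrier_vec n) \<and> (\<forall>i<n. x $ i = (\<Sum>h\<in>H. (\<rho> h *\<^sub>v y h) $ i - y h $ i))"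
  proof (intro exI[of _ y] conjI ballI allI impI)
    show "y h \<in> carrier_vec n" for h by (simp add: y_def)
    fix j assume j: "j < n"
    have "(\<rho> h *\<^sub>v y h) $ j = (\<Sum>k<n. if t k = h then (if k = j then x $ k else 0) else 0)"
      if h: "h \<in> H" for h
    proof -
      have "(\<rho> h *\<^sub>v y h) $ j = (\<Sum>i<n. \<Sum>k<n. if j = p h i \<and> t k = h \<and> r k = i then x $ k else 0)"
        using h j by (auto simp: mv y_def simp del: index_mult_mat_vec intro!: sum.cong)
      also have "\<dots> = (\<Sum>k<n. \<Sum>i<n. if j = p h i \<and> t k = h \<and> r k = i then x $ k else 0)"
        by (rule sum.swap)
      also have "\<dots> = (\<Sum>k<n. if t k = h then (if k = j then x $ k else 0) else 0)"
      proof (rule sum.cong[OF refl])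
        fix k assume k: "k \<in> {..<n}"
        have "(\<Sum>i<n. if j = p h i \<and> t k = h \<and> r k = i then x $ k else 0)
           = (\<Sum>i<n. if i = r k then (if j = p h i \<and> t k = h then x $ k else 0) else 0)"
          by (intro sum.cong) auto
        also have "\<dots> = (if j = p h (r k) \<and> t k = h then x $ k else 0)"
          using r(1)[of k] k by (subst sum.delta) auto
        also have "\<dots> = (if t k = h then (if k = j then x $ k else 0) else 0)"
          using t(2)[of k] k by auto
        finally show "(\<Sum>i<n. if j = p h i \<and> t k = h \<and> r k = i then x $ k else 0) = \<dots>" .
      qed
      finally show ?thesis .
    qed
    then have "(\<Sum>h\<in>H. (\<rho> h *\<^sub>v y h) $ j - y h $ j)
      = (\<Sum>h\<in>H. \<Sum>k<n. if t k = h then (if k = j then x $ k else 0) - (if r k = j then x $ k else 0) else 0)"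
      using j by (auto simp: y_def simp del: index_mult_mat_vec simp flip: sum_subtractf intro!: sum.cong)
    also have "\<dots> = (\<Sum>k<n. \<Sum>h\<in>H. if t k = h then (if k = j then x $ k else 0) - (if r k = j then x $ k else 0) else 0)"
      by (rule sum.swap)
    also have "\<dots> = (\<Sum>k<n. (if k = j then x $ k else 0) - (if r k = j then x $ k else 0))"
      using fin t(1) by (intro sum.cong) auto
    also have "\<dots> = x $ j"
      using j by (simp add: sum_subtractf orbit_sum)
    finally show "x $ j = (\<Sum>h\<in>H. (\<rho> h *\<^sub>v y h) $ j - y h $ j)" by simp
  qed
qed

section \<open>Kernels and permutation representations of finite invariant sets\<close>

definition kernel_mat :: "('y \<Rightarrow> 'x \<Rightarrow> int) \<Rightarrow> (nat \<Rightarrow> 'y) \<Rightarrow> nat \<Rightarrow> (nat \<Rightarrow> 'x) \<Rightarrow> nat \<Rightarrow> int mat" where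
  "kernel_mat k f n e m = mat n m (\<lambda>(j, i). k (f j) (e i))"

definition perm_rep :: "('g \<Rightarrow> 'x \<Rightarrow> 'x) \<Rightarrow> (nat \<Rightarrow> 'x) \<Rightarrow> nat \<Rightarrow> 'g \<Rightarrow> int mat" where
  "perm_rep \<phi> e n g = mat n n (\<lambda>(j, i). if e j = \<phi> g (e i) then 1 else 0)"

lemma kernel_mat_carrier [simp]: "kernel_mat k f n e m \<in> carrier_mat n m"
  by (simp add: kernel_mat_def)

lemma perm_rep_kernel: "perm_rep \<phi> e n g = kernel_mat (\<lambda>y x. if y = \<phi> g x then 1 else 0) e n e n"
  by (simp add: perm_rep_def kernel_mat_def)

lemma kernel_mat_cong:
  assumes "bij_betw f {..<n} Y" "bij_betw e {..<m} \<Omega>" "\<And>y x. y \<in> Y \<Longrightarrow> x \<in> \<Omega> \<Longrightarrow> k y x = k' y x"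
  shows "kernel_mat k f n e m = kernel_mat k' f n e m"
  using assms by (auto simp: kernel_mat_def bij_betw_def intro!: eq_matI)

text \<open>Composing kernels means summing over the middle set, so matrix identities become
  identities of functions on the sets, whatever the enumerations.\<close>

lemma kernel_mat_mult:
  assumes "bij_betw e {..<m} \<Omega>"
  shows "kernel_mat k f n e m * kernel_mat k' e m d p = kernel_mat (\<lambda>z x. \<Sum>y\<in>\<Omega>. k z y * k' y x) f n d p"
proof (rule eq_matI)
  fix i j assume ij: "i < dim_row (kernel_mat (\<lambda>z x. \<Sum>y\<in>\<Omega>. k z y * k' y x) f n d p)"
    "j < dim_col (kernel_mat (\<lambda>z x. \<Sum>y\<in>\<Omega>. k z y * k' y x) f n d p)"
  have "(\<Sum>y\<in>\<Omega>. k (f i) y * k' y (d j)) = (\<Sum>l<m. k (f i) (e l) * k' (e l) (d j))"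
    using sum.reindex_bij_betw[OF assms, of "\<lambda>y. k (f i) y * k' y (d j)"] by simp
  with ij show "(kernel_mat k f n e m * kernel_mat k' e m d p) $$ (i, j)
      = kernel_mat (\<lambda>z x. \<Sum>y\<in>\<Omega>. k z y * k' y x) f n d p $$ (i, j)"
    by (simp add: kernel_mat_def scalar_prod_def atLeast0LessThan)
qed (simp_all add: kernel_mat_def)

lemma kernel_mat_one:
  assumes "bij_betw e {..<n} \<Omega>"
  shows "kernel_mat (\<lambda>y x. if y = x then 1 else 0) e n e n = 1\<^sub>m n"
  using assms by (auto simp: kernel_mat_def bij_betw_def inj_on_def intro!: eq_matI)

text \<open>Several finite invariant sets share one ambient action, so that a kernel between two of
  them can be tested with the same \<open>\<phi>\<close> on both arguments.\<close>

locale invariant_subset = group_action G E \<phi> for G (structure) and E and \<phi> +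
  fixes \<Omega>
  assumes subset: "\<Omega> \<subseteq> E" and invariant: "\<And>g x. g \<in> carrier G \<Longrightarrow> x \<in> \<Omega> \<Longrightarrow> \<phi> g x \<in> \<Omega>"
    and finite_set: "finite \<Omega>"
begin

lemma act_one: "x \<in> \<Omega> \<Longrightarrow> \<phi> \<one> x = x"
  using id_eq_one subset by (metis restrict_apply' subsetD)

lemma act_mult: "x \<in> \<Omega> \<Longrightarrow> g \<in> carrier G \<Longrightarrow> h \<in> carrier G \<Longrightarrow> \<phi> (g \<otimes> h) x = \<phi> g (\<phi> h x)"
  using composition_rule subset by blast

lemma group_G: "group G"
  using group_hom group_hom.axioms(1) by blast

lemma act_inv: "x \<in> \<Omega> \<Longrightarrow> y \<in> \<Omega> \<Longrightarrow> g \<in> carrier G \<Longrightarrow> y = \<phi> g x \<longleftrightarrow> x = \<phi> (inv g) y"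
  using act_mult[of x "inv g" g] act_mult[of y g "inv g"] act_one group_G
  by (metis group.inv_closed group.l_inv group.r_inv)

lemma glattice_perm_rep:
  assumes e: "bij_betw e {..<n} \<Omega>"
  shows "glattice G n (perm_rep \<phi> e n)"
  unfolding glattice_def
proof (intro conjI ballI)
  interpret group G by (rule group_G)
  show "perm_rep \<phi> e n g \<in> carrier_mat n n" for g by (simp add: perm_rep_def)
  show "perm_rep \<phi> e n \<one> = 1\<^sub>m n"
    unfolding perm_rep_kernel kernel_mat_one[OF e, symmetric]
    by (intro kernel_mat_cong[OF e e]) (simp add: act_one)
  fix g h assume gh: "g \<in> carrier G" "h \<in> carrier G"
  show "perm_rep \<phi> e n (g \<otimes> h) = perm_rep \<phi> e n g * perm_rep \<phi> e n h"
    unfolding perm_rep_kernel kernel_mat_mult[OF e]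
  proof (intro kernel_mat_cong[OF e e])
    fix z x assume "z \<in> \<Omega>" "x \<in> \<Omega>"
    have "(\<Sum>y\<in>\<Omega>. (if z = \<phi> g y then 1 else 0) * (if y = \<phi> h x then 1 else 0))
        = (\<Sum>y\<in>\<Omega>. if y = \<phi> h x then (if z = \<phi> g y then 1 else 0 :: int) else 0)"
      by (intro sum.cong) auto
    also have "\<dots> = (if z = \<phi> (g \<otimes> h) x then 1 else 0)"
      using \<open>x \<in> \<Omega>\<close> gh invariant[OF gh(2)] finite_set by (simp add: act_mult)
    finally show "(if z = \<phi> (g \<otimes> h) x then 1 else 0)
        = (\<Sum>y\<in>\<Omega>. (if z = \<phi> g y then 1 else 0) * (if y = \<phi> h x then 1 else 0 :: int))" by simp
  qed
qed

lemma transpose_perm_rep: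
  assumes "bij_betw e {..<n} \<Omega>" "g \<in> carrier G"
  shows "transpose_mat (perm_rep \<phi> e n (inv g)) = perm_rep \<phi> e n g"
proof (rule eq_matI)
  fix i j assume "i < dim_row (perm_rep \<phi> e n g)" "j < dim_col (perm_rep \<phi> e n g)"
  then have "i < n" "j < n" "e i \<in> \<Omega>" "e j \<in> \<Omega>"
    using assms(1) by (auto simp: perm_rep_def bij_betw_def)
  then show "transpose_mat (perm_rep \<phi> e n (inv g)) $$ (i, j) = perm_rep \<phi> e n g $$ (i, j)"
    using act_inv[of "e j" "e i" g] assms(2) by (simp add: perm_rep_def)
qed (simp_all add: perm_rep_def)

lemma flabby_perm_rep:
  assumes e: "bij_betw e {..<n} \<Omega>" and fin: "finite (carrier G)"
  shows "flabby G n (perm_rep \<phi> e n)"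
  unfolding flabby_def
proof (intro conjI allI impI glattice_perm_rep[OF e])
  interpret group G by (rule group_G)
  fix H assume H: "subgroup H G"
  interpret H: subgroup H G by fact
  define d where "d = inv_into {..<n} e"
  \<comment> \<open>With \<open>d\<close> inverse to the enumeration, the action moves to indices: h
    sends i to \<open>d (\<phi> h (e i))\<close>.\<close>
  have d: "d x < n" "e (d x) = x" if "x \<in> \<Omega>" for x
    using e that by (auto simp: d_def bij_betw_def f_inv_into_f dest: inv_into_into)
  have de: "d (e i) = i" "e i \<in> \<Omega>" if "i < n" for i
    using e that by (auto simp: d_def bij_betw_def)
  have eq: "j = d x \<longleftrightarrow> e j = x" if "j < n" "x \<in> \<Omega>" for j x
    using d de that by auto
  show "tate_minus1_vanishes G H n (perm_rep \<phi> e n)"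
  proof (rule tate_minus1_vanishes_perm_mat[where p = "\<lambda>h i. d (\<phi> h (e i))"])
    show "finite H" using fin H.subset by (rule rev_finite_subset)
    fix h assume h: "h \<in> H"
    show "perm_rep \<phi> e n h = mat n n (\<lambda>(j, i). if j = d (\<phi> h (e i)) then 1 else 0)"
      using h by (auto simp: perm_rep_def eq de invariant intro!: eq_matI)
  qed (use H group_G in \<open>auto simp: d de act_one act_mult invariant\<close>)
qed

text \<open>The two products have the entries \<open>k y (\<phi> g x)\<close> and
  \<open>k (\<phi> (inv g) y) x\<close>, which invariance of the kernel identifies.\<close>

lemma ghom_kernel_mat:
  assumes Y: "invariant_subset G E \<phi> Y"
    and e: "bij_betw e {..<m} \<Omega>" and f: "bij_betw f {..<n} Y"
    and inv: "\<And>g y x. g \<in> carrier G \<Longrightarrow> y \<in> Y \<Longrightarrow> x \<in> \<Omega> \<Longrightarrow> k (\<phi> g y) (\<phi> g x) = k y x"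
  shows "ghom G m (perm_rep \<phi> e m) n (perm_rep \<phi> f n) (kernel_mat k f n e m)"
  unfolding ghom_def
proof (intro conjI ballI)
  interpret Y: invariant_subset G E \<phi> Y by fact
  interpret group G by (rule group_G)
  fix g assume g: "g \<in> carrier G"
  show "kernel_mat k f n e m * perm_rep \<phi> e m g = perm_rep \<phi> f n g * kernel_mat k f n e m"
    unfolding perm_rep_kernel kernel_mat_mult[OF e] kernel_mat_mult[OF f]
  proof (intro kernel_mat_cong[OF f e])
    fix y x assume yx: "y \<in> Y" "x \<in> \<Omega>"
    have gy: "\<phi> (inv g) y \<in> Y" using yx g Y.invariant by auto
    then have gy: "\<phi> (inv g) y \<in> Y" "\<phi> g (\<phi> (inv g) y) = y"
      using yx g Y.act_inv[of "\<phi> (inv g) y" y g] by auto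
    have "(\<Sum>z\<in>\<Omega>. k y z * (if z = \<phi> g x then 1 else 0)) = (\<Sum>z\<in>\<Omega>. if z = \<phi> g x then k y z else 0)"
      by (intro sum.cong) auto
    also have "\<dots> = k y (\<phi> g x)" using yx g finite_set invariant by simp
    also have "\<dots> = k (\<phi> (inv g) y) x"
      using inv[OF g gy(1) yx(2)] gy by simp
    also have "\<dots> = (\<Sum>z\<in>Y. if z = \<phi> (inv g) y then k z x else 0)"
      using gy Y.finite_set by simp
    also have "\<dots> = (\<Sum>z\<in>Y. (if y = \<phi> g z then 1 else 0) * k z x)"
      using Y.act_inv[OF _ yx(1) g] by (intro sum.cong) auto
    finally show "(\<Sum>z\<in>\<Omega>. k y z * (if z = \<phi> g x then 1 else 0))
        = (\<Sum>z\<in>Y. (if y = \<phi> g z then 1 else 0) * k z x)" .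
  qed
qed simp

text \<open>The identity of \<open>\<Omega>\<close> written in two enumerations is a permutation
  matrix; this absorbs every choice of an ordered basis.\<close>

lemma giso_perm_rep:
  assumes e: "bij_betw e {..<m} \<Omega>" and f: "bij_betw f {..<n} \<Omega>"
  shows "giso G m (perm_rep \<phi> e m) n (perm_rep \<phi> f n)"
  unfolding giso_def
proof (intro exI conjI)
  let ?\<delta> = "\<lambda>y x. if y = x then 1 else 0 :: int"
  have "(\<Sum>y\<in>\<Omega>. ?\<delta> z y * ?\<delta> y x) = ?\<delta> z x" if "z \<in> \<Omega>" for z x
    using that finite_set by (simp add: if_distrib[of "\<lambda>c. c * _"] cong: if_cong)
  then have \<delta>: "kernel_mat ?\<delta> e m f n * kernel_mat ?\<delta> f n e m = 1\<^sub>m m"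
    if "bij_betw e {..<m} \<Omega>" "bij_betw f {..<n} \<Omega>" for e f m n
    unfolding kernel_mat_mult[OF that(2)] kernel_mat_one[OF that(1), symmetric]
    by (intro kernel_mat_cong[OF that(1) that(1)]) simp
  show "kernel_mat ?\<delta> e m f n * kernel_mat ?\<delta> f n e m = 1\<^sub>m m"
    "kernel_mat ?\<delta> f n e m * kernel_mat ?\<delta> e m f n = 1\<^sub>m n"
    using \<delta> e f by auto
  show "kernel_mat ?\<delta> e m f n \<in> carrier_mat m n" by simp
  have "?\<delta> (\<phi> g y) (\<phi> g x) = ?\<delta> y x" if "g \<in> carrier G" "y \<in> \<Omega>" "x \<in> \<Omega>" for g y x
    using that inj_prop[OF that(1)] subset by (auto simp: inj_on_def)
  then show "ghom G m (perm_rep \<phi> e m) n (perm_rep \<phi> f n) (kernel_mat ?\<delta> f n e m)"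
    by (intro ghom_kernel_mat[OF invariant_subset_axioms e f]) auto
qed

end

section \<open>Orbits and coset lattices\<close>

context group_action
begin

lemma invariant_subset_orbit:
  assumes x: "x \<in> E" and fin: "finite (orbit G \<phi> x)"
  shows "invariant_subset G E \<phi> (orbit G \<phi> x)"
proof
  interpret group G using group_hom group_hom.axioms(1) by blast
  show "orbit G \<phi> x \<subseteq> E" using element_image[OF _ x] by (auto simp: orbit_def)
  show "\<phi> g y \<in> orbit G \<phi> x" if "g \<in> carrier G" "y \<in> orbit G \<phi> x" for g y
  proof -
    obtain h where "h \<in> carrier G" "y = \<phi> h x" using \<open>y \<in> _\<close> unfolding orbit_def by blast
    then have "g \<otimes> h \<in> carrier G" "\<phi> g y = \<phi> (g \<otimes> h) x"
      using that composition_rule[OF x] by simp_all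
    then show ?thesis by (auto simp: orbit_def)
  qed
qed (rule fin)

text \<open>A left coset of the stabilizer consists of all elements that move x to one given point
  of the orbit.\<close>

lemma lcoset_eq_iff_orbit:
  assumes x: "x \<in> E" and g: "g \<in> carrier G" "h \<in> carrier G"
  shows "g <# stabilizer G \<phi> x = h <# stabilizer G \<phi> x \<longleftrightarrow> \<phi> g x = \<phi> h x"
proof -
  interpret group G using group_hom group_hom.axioms(1) by blast
  have *: "g <# stabilizer G \<phi> x = {k \<in> carrier G. \<phi> k x = \<phi> g x}" if g: "g \<in> carrier G" for g
  proof (intro equalityI subsetI)
    fix k assume "k \<in> g <# stabilizer G \<phi> x"
    then obtain s where s: "s \<in> stabilizer G \<phi> x" and k: "k = g \<otimes> s"
      unfolding l_coset_def by blast
    have s: "s \<in> carrier G" "\<phi> s x = x" using s unfolding stabilizer_def by blast+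
    show "k \<in> {k \<in> carrier G. \<phi> k x = \<phi> g x}"
      using g s composition_rule[OF x g s(1)] by (simp add: k)
  next
    fix k assume k: "k \<in> {k \<in> carrier G. \<phi> k x = \<phi> g x}"
    have "\<phi> (inv g \<otimes> k) x = \<phi> (inv g) (\<phi> g x)"
      using k g composition_rule[OF x, of "inv g" k] by simp
    also have "\<dots> = \<phi> (inv g \<otimes> g) x"
      using g composition_rule[OF x, of "inv g" g] by (simp del: l_inv)
    also have "\<dots> = x" using g x by (simp flip: id_eq_one)
    finally have "inv g \<otimes> k \<in> stabilizer G \<phi> x" using k g by (simp add: stabilizer_def)
    moreover have "k = g \<otimes> (inv g \<otimes> k)" using k g m_assoc[of g "inv g" k] by simp
    ultimately show "k \<in> g <# stabilizer G \<phi> x" unfolding l_coset_def by blast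
  qed
  show ?thesis unfolding *[OF g(1)] *[OF g(2)]
  proof
    assume eq: "{k \<in> carrier G. \<phi> k x = \<phi> g x} = {k \<in> carrier G. \<phi> k x = \<phi> h x}"
    have "g \<in> {k \<in> carrier G. \<phi> k x = \<phi> h x}" unfolding eq[symmetric] using g(1) by blast
    then show "\<phi> g x = \<phi> h x" by blast
  qed (simp only:)
qed

text \<open>The orbit and the set of cosets are isomorphic as sets with an action: y corresponds to
  the coset of \<open>c y\<close>, where \<open>c y\<close> is some element carrying x to y.\<close>

lemma coset_lattice_perm_rep:
  assumes x: "x \<in> E" and e: "bij_betw e {..<n} (orbit G \<phi> x)"
  shows "coset_lattice G (stabilizer G \<phi> x) n (perm_rep \<phi> e n)"
  unfolding coset_lattice_def
proof (intro conjI stabilizer_subgroup[OF x])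
  interpret group G using group_hom group_hom.axioms(1) by blast
  let ?S = "stabilizer G \<phi> x"
  have S: "?S \<subseteq> carrier G" by (auto simp: stabilizer_def)
  define c where "c y = (SOME g. g \<in> carrier G \<and> \<phi> g x = y)" for y
  have c: "c y \<in> carrier G" "\<phi> (c y) x = y" if "y \<in> orbit G \<phi> x" for y
    using that someI_ex[of "\<lambda>g. g \<in> carrier G \<and> \<phi> g x = y"] by (auto simp: c_def orbit_def)
  have "bij_betw (\<lambda>y. c y <# ?S) (orbit G \<phi> x) {g <# ?S | g. g \<in> carrier G}"
    unfolding bij_betw_def
  proof
    show "inj_on (\<lambda>y. c y <# ?S) (orbit G \<phi> x)"
      using c lcoset_eq_iff_orbit[OF x] by (auto simp: inj_on_def)
    have "\<phi> g x \<in> orbit G \<phi> x" if "g \<in> carrier G" for g using that by (auto simp: orbit_def)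
    then have "g <# ?S = c (\<phi> g x) <# ?S \<and> \<phi> g x \<in> orbit G \<phi> x" if "g \<in> carrier G" for g
      using c[of "\<phi> g x"] lcoset_eq_iff_orbit[OF x that, of "c (\<phi> g x)"] that by simp
    then show "(\<lambda>y. c y <# ?S) ` orbit G \<phi> x = {g <# ?S | g. g \<in> carrier G}"
      using c(1) by blast
  qed
  from bij_betw_trans[OF e this]
  have b: "bij_betw (\<lambda>i. c (e i) <# ?S) {..<n} {g <# ?S | g. g \<in> carrier G}" by (simp add: comp_def)
  show "\<exists>e'. bij_betw e' {..<n} {g <# ?S | g. g \<in> carrier G} \<and>
     (\<forall>g\<in>carrier G. perm_rep \<phi> e n g = mat n n (\<lambda>(j, i). if e' j = g <# e' i then 1 else 0))"
  proof (intro exI[of _ "\<lambda>i. c (e i) <# ?S"] conjI ballI b)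
    fix g assume g: "g \<in> carrier G"
    show "perm_rep \<phi> e n g = mat n n (\<lambda>(j, i). if c (e j) <# ?S = g <# (c (e i) <# ?S) then 1 else 0)"
      unfolding perm_rep_def
    proof (rule cong_mat)
      fix j i assume "j < n" "i < n"
      then have ij: "e j \<in> orbit G \<phi> x" "e i \<in> orbit G \<phi> x" using e by (auto simp: bij_betw_def)
      have "g <# (c (e i) <# ?S) = (g \<otimes> c (e i)) <# ?S"
        using lcos_m_assoc S g c ij by blast
      then have "c (e j) <# ?S = g <# (c (e i) <# ?S) \<longleftrightarrow> \<phi> (c (e j)) x = \<phi> (g \<otimes> c (e i)) x"
        using lcoset_eq_iff_orbit[OF x] g c ij by auto
      also have "\<dots> \<longleftrightarrow> e j = \<phi> g (e i)"
        using composition_rule[OF x g, of "c (e i)"] c[OF ij(1)] c[OF ij(2)] by auto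
      finally show "(case (j, i) of (j, i) \<Rightarrow> if e j = \<phi> g (e i) then 1 else 0)
        = (case (j, i) of (j, i) \<Rightarrow> if c (e j) <# ?S = g <# (c (e i) <# ?S) then 1 else 0)" by auto
    qed auto
  qed
qed

text \<open>The enumeration of cosets hidden in \<open>coset_lattice\<close> is moved to the orbit,
  so the matrices come out equal and not merely conjugate. A statement about all realisations
  thereby becomes one about all enumerations of an orbit.\<close>

lemma coset_lattice_imp_perm_rep:
  assumes x: "x \<in> E" and \<rho>: "coset_lattice G S n \<rho>" and S: "S = stabilizer G \<phi> x"
  obtains e where "bij_betw e {..<n} (orbit G \<phi> x)"
    and "\<And>g. g \<in> carrier G \<Longrightarrow> \<rho> g = perm_rep \<phi> e n g"
proof -
  interpret group G using group_hom group_hom.axioms(1) by blast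
  let ?C = "{g <# S | g. g \<in> carrier G}"
  obtain f where f: "bij_betw f {..<n} ?C"
    and \<rho>_eq: "\<And>g. g \<in> carrier G \<Longrightarrow> \<rho> g = mat n n (\<lambda>(j, i). if f j = g <# f i then 1 else 0)"
    using \<rho> by (auto simp: coset_lattice_def)
  have Ssub: "S \<subseteq> carrier G" by (auto simp: S stabilizer_def)
  define c where "c C = (SOME g. g \<in> carrier G \<and> g <# S = C)" for C
  have c: "c C \<in> carrier G" "c C <# S = C" if "C \<in> ?C" for C
    using that someI_ex[of "\<lambda>g. g \<in> carrier G \<and> g <# S = C"] by (auto simp: c_def)
  have iff: "g <# S = h <# S \<longleftrightarrow> \<phi> g x = \<phi> h x" if "g \<in> carrier G" "h \<in> carrier G" for g h
    using lcoset_eq_iff_orbit[OF x that] by (simp add: S)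
  have "bij_betw (\<lambda>C. \<phi> (c C) x) ?C (orbit G \<phi> x)"
    unfolding bij_betw_def
  proof
    show "inj_on (\<lambda>C. \<phi> (c C) x) ?C"
    proof (rule inj_onI)
      fix C D assume CD: "C \<in> ?C" "D \<in> ?C" "\<phi> (c C) x = \<phi> (c D) x"
      then have "c C <# S = c D <# S" using c(1) iff by blast
      then show "C = D" using CD(1,2) c(2) by simp
    qed
    have "g <# S \<in> ?C" if "g \<in> carrier G" for g using that by blast
    then have "\<phi> g x = \<phi> (c (g <# S)) x \<and> g <# S \<in> ?C" if "g \<in> carrier G" for g
      using c[of "g <# S"] iff[OF that, of "c (g <# S)"] that by simp
    then show "(\<lambda>C. \<phi> (c C) x) ` ?C = orbit G \<phi> x"
      using c(1) unfolding orbit_def by blast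
  qed
  from bij_betw_trans[OF f this]
  have b: "bij_betw (\<lambda>i. \<phi> (c (f i)) x) {..<n} (orbit G \<phi> x)" by (simp add: comp_def)
  show thesis
  proof (rule that[OF b])
    fix g assume g: "g \<in> carrier G"
    show "\<rho> g = perm_rep \<phi> (\<lambda>i. \<phi> (c (f i)) x) n g"
      unfolding perm_rep_def \<rho>_eq[OF g]
    proof (rule cong_mat)
      fix j i assume "j < n" "i < n"
      then have ij: "f j \<in> ?C" "f i \<in> ?C" using f by (auto simp: bij_betw_def)
      have "g <# (c (f i) <# S) = (g \<otimes> c (f i)) <# S"
        using lcos_m_assoc Ssub g c ij by blast
      then have "f j = g <# f i \<longleftrightarrow> c (f j) <# S = (g \<otimes> c (f i)) <# S"
        using c[OF ij(1)] c[OF ij(2)] by simp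
      also have "\<dots> \<longleftrightarrow> \<phi> (c (f j)) x = \<phi> g (\<phi> (c (f i)) x)"
        using iff[of "c (f j)" "g \<otimes> c (f i)"] composition_rule[OF x g, of "c (f i)"] g c(1)[OF ij(1)] c(1)[OF ij(2)]
        by simp
      finally show "(case (j, i) of (j, i) \<Rightarrow> if f j = g <# f i then 1 else 0)
        = (case (j, i) of (j, i) \<Rightarrow> if \<phi> (c (f j)) x = \<phi> g (\<phi> (c (f i)) x) then 1 else 0)" by auto
    qed auto
  qed
qed

lemma stabilizer_eqI:
  assumes x: "x \<in> E" and fin: "finite (carrier G)" and S: "S \<subseteq> stabilizer G \<phi> x"
    and card: "card S * card (orbit G \<phi> x) = Coset.order G"
  shows "S = stabilizer G \<phi> x"
proof -
  interpret group G using group_hom group_hom.axioms(1) by blast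
  have "card S * card (orbit G \<phi> x) = card (stabilizer G \<phi> x) * card (orbit G \<phi> x)"
    using orbit_stabilizer_theorem[OF x] card by (simp add: mult.commute)
  moreover have "card (orbit G \<phi> x) \<noteq> 0"
    using card fin order_gt_0_iff_finite by (metis mult_is_0 neq0_conv)
  ultimately have "card S = card (stabilizer G \<phi> x)" by simp
  moreover have "finite (stabilizer G \<phi> x)"
    using fin by (auto simp: stabilizer_def)
  ultimately show ?thesis using S card_subset_eq by blast
qed

end

section \<open>Split quotients and the Chevalley module\<close>

text \<open>Multiplying \<open>A * T + S * B = 1\<close> by \<open>B\<close> on the left leaves B A
  T = 0, and a further \<open>A\<close> on the right removes \<open>T\<close>.\<close>

lemma split_projection_zero:
  fixes A B S T :: "int mat"
  assumes A: "A \<in> carrier_mat p m" and T: "T \<in> carrier_mat m p"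
    and B: "B \<in> carrier_mat f p" and S: "S \<in> carrier_mat p f"
    and TA: "T * A = 1\<^sub>m m" and BS: "B * S = 1\<^sub>m f" and id: "A * T + S * B = 1\<^sub>m p"
  shows "B * A = 0\<^sub>m f m"
proof -
  have AT: "A * T \<in> carrier_mat p p" and SB: "S * B \<in> carrier_mat p p" using A T B S by auto
  have "B * 1\<^sub>m p = B * (A * T) + B * (S * B)"
    unfolding id[symmetric] by (rule mult_add_distrib_mat[OF B AT SB])
  also have "B * (S * B) = B" using B unfolding assoc_mult_mat[OF B S B, symmetric] BS by simp
  finally have sum: "B = B * (A * T) + B" using B by simp
  have "B * (A * T) = 0\<^sub>m f p"
  proof (rule eq_matI)
    fix i j assume "i < dim_row (0\<^sub>m f p :: int mat)" "j < dim_col (0\<^sub>m f p :: int mat)"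
    then have ij: "i < f" "j < p" by simp_all
    have "B $$ (i, j) = (B * (A * T) + B) $$ (i, j)" using sum by simp
    also have "\<dots> = (B * (A * T)) $$ (i, j) + B $$ (i, j)" using ij B by (intro index_add_mat) auto
    finally show "(B * (A * T)) $$ (i, j) = 0\<^sub>m f p $$ (i, j)" using ij by simp
  qed (use A T B in auto)
  then have "B * A * T * A = 0\<^sub>m f m" using A unfolding assoc_mult_mat[OF B A T] by simp
  then show ?thesis using B A TA unfolding assoc_mult_mat[OF mult_carrier_mat[OF B A] T A] by simp
qed

text \<open>The section \<open>S\<close> need not be equivariant. Everything rests on the inner fact
  \<open>killed\<close>: if \<open>K\<close> vanishes on the image of \<open>A\<close>, then so does
  \<open>K * \<pi> g\<close>, because that image is stable, and therefore S B = 1 - A T may be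
  dropped after it. Taking \<open>K\<close> to be \<open>B\<close> makes \<open>\<phi>\<close>
  multiplicative and \<open>B\<close> equivariant; a general \<open>K\<close> yields the third
  claim, the universal property of the cokernel.\<close>

lemma split_quotient_lattice:
  fixes A B S T :: "int mat"
  assumes G: "group G" and \<mu>: "glattice G m \<mu>" and \<pi>: "glattice G p \<pi>"
    and A: "ghom G m \<mu> p \<pi> A" and T: "T \<in> carrier_mat m p"
    and B: "B \<in> carrier_mat f p" and S: "S \<in> carrier_mat p f"
    and TA: "T * A = 1\<^sub>m m" and BS: "B * S = 1\<^sub>m f"
    and id: "A * T + S * B = 1\<^sub>m p"
  defines "\<phi> \<equiv> \<lambda>g. B * \<pi> g * S"
  shows "glattice G f \<phi>" and "short_exact G m \<mu> p \<pi> f \<phi> A B"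
    and "glattice G n \<sigma> \<Longrightarrow> ghom G p \<pi> n \<sigma> K \<Longrightarrow> K * A = 0\<^sub>m n m \<Longrightarrow> ghom G f \<phi> n \<sigma> (K * S)"
proof -
  interpret group G by fact
  have cA: "A \<in> carrier_mat p m" using A by (rule ghom_carrier)
  have BA: "B * A = 0\<^sub>m f m" by (rule split_projection_zero[OF cA T B S TA BS id])
  have killed: "K * \<pi> g * S * B = K * \<pi> g"
    if K: "K \<in> carrier_mat n p" and g: "g \<in> carrier G" and KA: "K * A = 0\<^sub>m n m" for K :: "int mat" and n g
  proof -
    note c = glattice_carrier[OF \<pi> g] glattice_carrier[OF \<mu> g]
    have M: "K * \<pi> g \<in> carrier_mat n p" using K c by simp
    have "K * \<pi> g * A = K * (A * \<mu> g)"
      using K c cA A g by (simp add: ghom_def)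
    also have "\<dots> = (K * A) * \<mu> g"
      using K c cA by simp
    also have "\<dots> = 0\<^sub>m n m" using c by (simp add: KA)
    finally have *: "K * \<pi> g * A = 0\<^sub>m n m" .
    have "K * \<pi> g = K * \<pi> g * (A * T + S * B)" using right_mult_one_mat[OF M] by (simp add: id)
    also have "\<dots> = K * \<pi> g * (A * T) + K * \<pi> g * (S * B)"
      using cA T S B by (intro mult_add_distrib_mat[OF M]) auto
    also have "K * \<pi> g * (A * T) = K * \<pi> g * A * T"
      by (rule assoc_mult_mat[OF M cA T, symmetric])
    also have "K * \<pi> g * (S * B) = K * \<pi> g * S * B"
      by (rule assoc_mult_mat[OF M S B, symmetric])
    also have "K * \<pi> g * A * T = 0\<^sub>m n p" using T by (simp add: *)
    finally show ?thesis using M S B by simp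
  qed
  note B_killed = killed[OF B _ BA]
  have \<phi>B: "\<phi> g * B = B * \<pi> g" if "g \<in> carrier G" for g
    unfolding \<phi>_def by (rule B_killed[OF that])
  have c\<phi>: "\<phi> g \<in> carrier_mat f f" if "g \<in> carrier G" for g
    using B S glattice_carrier[OF \<pi> that] by (simp add: \<phi>_def)
  show "glattice G f \<phi>"
    unfolding glattice_def
  proof (intro conjI ballI c\<phi>)
    show "\<phi> \<one>\<^bsub>G\<^esub> = 1\<^sub>m f" using B S BS \<pi> by (simp add: \<phi>_def glattice_def)
    fix g h assume gh: "g \<in> carrier G" "h \<in> carrier G"
    note c = glattice_carrier[OF \<pi> gh(1)] glattice_carrier[OF \<pi> gh(2)]
    have "\<phi> g * \<phi> h = (\<phi> g * B) * \<pi> h * S"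
      unfolding fun_cong[OF \<phi>_def[THEN meta_eq_to_obj_eq], of h]
      using c\<phi>[OF gh(1)] B S c by (simp add: assoc_mult_mat[of _ f f _ p _ f] assoc_mult_mat[of _ f f _ p _ p])
    also have "\<dots> = B * \<pi> g * \<pi> h * S" by (simp add: \<phi>B[OF gh(1)])
    also have "\<dots> = B * (\<pi> g * \<pi> h) * S"
      using B c by (simp add: assoc_mult_mat[of _ f p _ p _ p])
    also have "\<dots> = \<phi> (g \<otimes>\<^bsub>G\<^esub> h)"
      using \<pi> gh by (simp add: \<phi>_def glattice_def)
    finally show "\<phi> (g \<otimes>\<^bsub>G\<^esub> h) = \<phi> g * \<phi> h" by simp
  qed
  have "ghom G p \<pi> f \<phi> B" using B \<phi>B by (simp add: ghom_def)
  moreover have "v = 0\<^sub>v m" if v: "v \<in> carrier_vec m" "A *\<^sub>v v = 0\<^sub>v p" for v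
  proof -
    have "v = (T * A) *\<^sub>v v" using v by (simp add: TA)
    also have "\<dots> = T *\<^sub>v (A *\<^sub>v v)" by (rule assoc_mult_mat_vec[OF T cA v(1)])
    also have "\<dots> = 0\<^sub>v m" unfolding v(2) using T by (auto intro!: eq_vecI)
    finally show ?thesis .
  qed
  moreover have "{w \<in> carrier_vec p. B *\<^sub>v w = 0\<^sub>v f} = (\<lambda>v. A *\<^sub>v v) ` carrier_vec m"
  proof (intro equalityI subsetI)
    fix w assume "w \<in> {w \<in> carrier_vec p. B *\<^sub>v w = 0\<^sub>v f}"
    then have w: "w \<in> carrier_vec p" "B *\<^sub>v w = 0\<^sub>v f" by auto
    have "w = (A * T + S * B) *\<^sub>v w" using w by (simp add: id)
    also have "\<dots> = (A * T) *\<^sub>v w + (S * B) *\<^sub>v w"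
      using cA T S B w by (intro add_mult_distrib_mat_vec) auto
    also have "(A * T) *\<^sub>v w = A *\<^sub>v (T *\<^sub>v w)" by (rule assoc_mult_mat_vec[OF cA T w(1)])
    also have "(S * B) *\<^sub>v w = S *\<^sub>v (B *\<^sub>v w)" by (rule assoc_mult_mat_vec[OF S B w(1)])
    also have "S *\<^sub>v (B *\<^sub>v w) = 0\<^sub>v p" using S by (auto simp: w(2) intro!: eq_vecI)
    finally have "w = A *\<^sub>v (T *\<^sub>v w)" using cA T w by simp
    moreover have "T *\<^sub>v w \<in> carrier_vec m" using T w by simp
    ultimately show "w \<in> (\<lambda>v. A *\<^sub>v v) ` carrier_vec m" by (rule image_eqI)
  next
    fix w assume "w \<in> (\<lambda>v. A *\<^sub>v v) ` carrier_vec m"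
    then obtain v where v: "v \<in> carrier_vec m" "w = A *\<^sub>v v" by auto
    have "B *\<^sub>v w = (B * A) *\<^sub>v v"
      unfolding v(2) by (rule assoc_mult_mat_vec[OF B cA v(1), symmetric])
    also have "\<dots> = 0\<^sub>v f" using v by (auto simp: BA intro!: eq_vecI)
    finally show "w \<in> {w \<in> carrier_vec p. B *\<^sub>v w = 0\<^sub>v f}" using v cA by simp
  qed
  moreover have "\<exists>w\<in>carrier_vec p. B *\<^sub>v w = u" if u: "u \<in> carrier_vec f" for u
  proof (intro bexI)
    have "B *\<^sub>v (S *\<^sub>v u) = (B * S) *\<^sub>v u" by (rule assoc_mult_mat_vec[OF B S u, symmetric])
    then show "B *\<^sub>v (S *\<^sub>v u) = u" using u by (simp add: BS)
    show "S *\<^sub>v u \<in> carrier_vec p" using S u by simp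
  qed
  ultimately show "short_exact G m \<mu> p \<pi> f \<phi> A B"
    using A by (simp add: short_exact_def)
  show "ghom G f \<phi> n \<sigma> (K * S)"
    if \<sigma>: "glattice G n \<sigma>" and K: "ghom G p \<pi> n \<sigma> K" and KA: "K * A = 0\<^sub>m n m"
    unfolding ghom_def
  proof (intro conjI ballI)
    have cK: "K \<in> carrier_mat n p" using K by (rule ghom_carrier)
    show "K * S \<in> carrier_mat n f" using cK S by simp
    have SB: "S * B \<in> carrier_mat p p" using S B by simp
    fix g assume g: "g \<in> carrier G"
    note c = glattice_carrier[OF \<pi> g] glattice_carrier[OF \<sigma> g]
    have "K * S * B = K"
      using killed[OF cK one_closed KA] \<pi> cK by (simp add: glattice_def)
    moreover have "K * S * \<phi> g = K * S * B * \<pi> g * S"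
    proof -
      have KS: "K * S \<in> carrier_mat n f" and B\<pi>: "B * \<pi> g \<in> carrier_mat f p"
        using cK S B c by auto
      show ?thesis
        unfolding \<phi>_def assoc_mult_mat[OF KS B\<pi> S, symmetric] assoc_mult_mat[OF KS B c(1), symmetric] ..
    qed
    ultimately have "K * S * \<phi> g = K * \<pi> g * S" by simp
    also have "\<dots> = \<sigma> g * (K * S)"
      using K g cK S c by (simp add: ghom_def)
    finally show "K * S * \<phi> g = \<sigma> g * (K * S)" .
  qed
qed

text \<open>Dualising the inclusion \<open>C\<close> of the augmentation kernel gives the projection
  \<open>D\<close>, the transpose of \<open>C\<close>; hypothesis \<open>tr\<close> says that the
  permutation lattice is self-dual. Preimages under \<open>C\<close> of the differences e_i - e_i0
  are the columns of \<open>V\<close>, and its transpose \<open>U\<close> is a section of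
  \<open>D\<close>. The base point \<open>i0\<close> stays free, to be matched later with the
  splitting of the embedding.\<close>

lemma chevalley_module_quotient:
  assumes G: "group G" and J: "chevalley_module G H n \<rho>"
    and tr: "\<And>m \<kappa> g. coset_lattice G H m \<kappa> \<Longrightarrow> g \<in> carrier G \<Longrightarrow> transpose_mat (\<kappa> (inv\<^bsub>G\<^esub> g)) = \<kappa> g"
  obtains m \<kappa> D where "coset_lattice G H m \<kappa>" "glattice G n \<rho>" "ghom G m \<kappa> n \<rho> D"
    and "\<And>i0. i0 < m \<Longrightarrow> \<exists>U\<in>carrier_mat m n. D * U = 1\<^sub>m n \<and>
      U * D = mat m m (\<lambda>(i, j). (if i = j then 1 else 0) - (if j = i0 then 1 else 0))"
proof -
  interpret group G by fact
  from J[unfolded chevalley_module_def] obtain m \<kappa> \<iota> C where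
    \<kappa>: "coset_lattice G H m \<kappa>" and \<iota>: "glattice G n \<iota>" and C: "ghom G n \<iota> m \<kappa> C"
    and inj: "\<forall>v\<in>carrier_vec n. C *\<^sub>v v = 0\<^sub>v m \<longrightarrow> v = 0\<^sub>v n"
    and im: "(\<lambda>v. C *\<^sub>v v) ` carrier_vec n = {w \<in> carrier_vec m. (\<Sum>i<m. w $ i) = 0}"
    and "\<forall>g\<in>carrier G. \<rho> g = transpose_mat (\<iota> (inv\<^bsub>G\<^esub> g))"
    by (elim exE conjE) (rule that)
  then have \<rho>: "\<And>g. g \<in> carrier G \<Longrightarrow> \<rho> g = transpose_mat (\<iota> (inv\<^bsub>G\<^esub> g))" by simp
  have cC: "C \<in> carrier_mat m n" using C by (rule ghom_carrier)
  have c\<kappa>: "\<kappa> g \<in> carrier_mat m m" if "g \<in> carrier G" for g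
    using \<kappa> that by (auto simp: coset_lattice_def)
  have "glattice G n \<rho>"
    unfolding glattice_def
  proof (intro conjI ballI)
    show "\<rho> g \<in> carrier_mat n n" if "g \<in> carrier G" for g
      using \<rho>[OF that] glattice_carrier[OF \<iota>, of "inv\<^bsub>G\<^esub> g"] that by simp
    show "\<rho> \<one>\<^bsub>G\<^esub> = 1\<^sub>m n" using \<rho>[OF one_closed] \<iota> by (simp add: glattice_def)
    fix g h assume gh: "g \<in> carrier G" "h \<in> carrier G"
    then have "\<iota> (inv\<^bsub>G\<^esub> (g \<otimes>\<^bsub>G\<^esub> h)) = \<iota> (inv\<^bsub>G\<^esub> h) * \<iota> (inv\<^bsub>G\<^esub> g)"
      using \<iota> by (simp add: glattice_def inv_mult_group)
    moreover have "transpose_mat (\<iota> (inv\<^bsub>G\<^esub> h) * \<iota> (inv\<^bsub>G\<^esub> g)) = \<rho> g * \<rho> h"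
      using gh \<rho> glattice_carrier[OF \<iota>, of "inv\<^bsub>G\<^esub> g"] glattice_carrier[OF \<iota>, of "inv\<^bsub>G\<^esub> h"]
      by (simp add: transpose_mult[of _ n n _ n])
    ultimately show "\<rho> (g \<otimes>\<^bsub>G\<^esub> h) = \<rho> g * \<rho> h"
      using \<rho>[of "g \<otimes>\<^bsub>G\<^esub> h"] gh by simp
  qed
  moreover have "ghom G m \<kappa> n \<rho> (transpose_mat C)"
    unfolding ghom_def
  proof (intro conjI ballI)
    show "transpose_mat C \<in> carrier_mat n m" using cC by simp
    fix g assume g: "g \<in> carrier G"
    then have g': "inv\<^bsub>G\<^esub> g \<in> carrier G" by simp
    have "transpose_mat C * \<kappa> g = transpose_mat (\<kappa> (inv\<^bsub>G\<^esub> g) * C)"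
      using tr[OF \<kappa> g] transpose_mult[OF c\<kappa>[OF g'] cC] by simp
    also have "\<dots> = transpose_mat (C * \<iota> (inv\<^bsub>G\<^esub> g))"
      using C g' by (simp add: ghom_def)
    also have "\<dots> = \<rho> g * transpose_mat C"
      using \<rho>[OF g] transpose_mult[OF cC glattice_carrier[OF \<iota> g']] by simp
    finally show "transpose_mat C * \<kappa> g = \<rho> g * transpose_mat C" .
  qed
  moreover have "\<exists>U\<in>carrier_mat m n. transpose_mat C * U = 1\<^sub>m n \<and>
      U * transpose_mat C = mat m m (\<lambda>(i, j). (if i = j then 1 else 0) - (if j = i0 then 1 else 0))"
    if i0: "i0 < m" for i0
  proof -
    have "\<exists>v\<in>carrier_vec n. C *\<^sub>v v = unit_vec m i - unit_vec m i0" if i: "i < m" for i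
    proof -
      have "(\<Sum>l<m. (unit_vec m i - unit_vec m i0 :: int vec) $ l) = 0"
        using i i0 by (simp add: unit_vec_def sum_subtractf)
      then have "unit_vec m i - unit_vec m i0 \<in> (\<lambda>v. C *\<^sub>v v) ` carrier_vec n" unfolding im by simp
      then show ?thesis by force
    qed
    then obtain u where u: "\<And>i. i < m \<Longrightarrow> u i \<in> carrier_vec n"
      "\<And>i. i < m \<Longrightarrow> C *\<^sub>v u i = unit_vec m i - unit_vec m i0" by metis
    define V where "V = mat n m (\<lambda>(r, i). u i $ r)"
    have cV: "V \<in> carrier_mat n m" by (simp add: V_def)
    have colV: "col V i = u i" if "i < m" for i
      using u(1)[OF that] that by (auto simp: V_def)
    have CV: "(C * V) $$ (j, i) = (if i = j then 1 else 0) - (if j = i0 then 1 else 0)" if "i < m" "j < m" for i j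
    proof -
      have "(C * V) $$ (j, i) = (C *\<^sub>v u i) $ j" using cC cV that by (simp add: colV)
      also have "\<dots> = (if i = j then 1 else 0) - (if j = i0 then 1 else 0)"
        using that i0 by (simp add: u(2) del: index_mult_mat_vec)
      finally show ?thesis .
    qed
    \<comment> \<open>If the coordinates of w sum to zero, the terms in e_i0 cancel, so C V is the
      identity on the image of \<open>C\<close>. Injectivity of \<open>C\<close> then turns this
      into V C = 1.\<close>
    have CVw: "C *\<^sub>v (V *\<^sub>v w) = w" if w: "w \<in> carrier_vec m" and s: "(\<Sum>i<m. w $ i) = 0" for w
    proof -
      have "((C * V) *\<^sub>v w) $ j = w $ j" if j: "j < m" for j
      proof -
        have "((C * V) *\<^sub>v w) $ j = (\<Sum>i<m. (C * V) $$ (j, i) * w $ i)"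
          using cC cV w j by (intro index_mult_mat_vec_sum) auto
        also have "\<dots> = (\<Sum>i<m. (if i = j then w $ i else 0) - (if j = i0 then w $ i else 0))"
          using j by (intro sum.cong) (auto simp: CV simp del: index_mult_mat)
        also have "\<dots> = w $ j" using j s by (cases "j = i0") (simp_all add: sum_subtractf)
        finally show ?thesis .
      qed
      then have "(C * V) *\<^sub>v w = w" using cC cV w by (intro eq_vecI) (auto simp del: index_mult_mat_vec)
      then show ?thesis using assoc_mult_mat_vec[OF cC cV w] by simp
    qed
    have "V * C = 1\<^sub>m n"
    proof (rule mat_col_eqI)
      fix j assume "j < dim_col (1\<^sub>m n :: int mat)"
      then have j: "j < n" by simp
      define w where "w = C *\<^sub>v unit_vec n j"
      have w: "w \<in> carrier_vec m" "(\<Sum>i<m. w $ i) = 0"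
        using imageI[OF unit_vec_carrier, of "\<lambda>v. C *\<^sub>v v" n j] unfolding im w_def by blast+
      have "C *\<^sub>v (V *\<^sub>v w - unit_vec n j) = C *\<^sub>v (V *\<^sub>v w) - C *\<^sub>v unit_vec n j"
        using cC cV w by (intro mult_minus_distrib_mat_vec) auto
      also have "\<dots> = 0\<^sub>v m" using w by (simp add: CVw) (simp add: w_def)
      finally have z: "V *\<^sub>v w - unit_vec n j = 0\<^sub>v n" using cV w by (intro inj[rule_format]) auto
      have "(V *\<^sub>v w) $ i = unit_vec n j $ i" if "i < n" for i
        using arg_cong[OF z, of "\<lambda>v. v $ i"] that cV w by (simp del: index_mult_mat_vec)
      then have "V *\<^sub>v w = unit_vec n j"
        using cV w by (intro eq_vecI) (auto simp del: index_mult_mat_vec)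
      moreover have "col C j = w"
        using cC j by (auto simp: w_def intro!: eq_vecI)
      then have "col (V * C) j = V *\<^sub>v w"
        using cC cV j by (simp add: col_mult2[of _ n m _ n])
      ultimately show "col (V * C) j = col (1\<^sub>m n) j" using j by simp
    qed (use cC cV in auto)
    then have "transpose_mat C * transpose_mat V = 1\<^sub>m n"
      using transpose_mult[OF cV cC] by simp
    moreover have "transpose_mat V * transpose_mat C =
        mat m m (\<lambda>(i, j). (if i = j then 1 else 0) - (if j = i0 then 1 else 0))"
      using transpose_mult[OF cC cV, symmetric] CV cC cV
      by (auto intro!: eq_matI simp del: index_mult_mat(1))
    ultimately show ?thesis using cV by (intro bexI[of _ "transpose_mat V"]) auto
  qed
  ultimately show thesis using that \<kappa> by blast
qed

section \<open>Tables for the alternating group on five points\<close>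

text \<open>Each word is an even permutation with first letter 1 in one-line notation, and at the
  same time the directed pentagon that visits its letters in order. Rotating five positions is an
  even permutation, so the five rotations of these 12 words are all 60 even ones.\<close>

definition pentagons :: "nat list list" where
  "pentagons = [[1,2,3,4,5],[1,2,4,5,3],[1,2,5,3,4],[1,3,2,5,4],[1,3,4,2,5],[1,3,5,4,2],
     [1,4,2,3,5],[1,4,3,5,2],[1,4,5,2,3],[1,5,2,4,3],[1,5,3,2,4],[1,5,4,3,2]]"

definition even_words :: "nat list list" where
  "even_words = concat (map (\<lambda>l. map (\<lambda>k. rotate k l) [0..<5]) pentagons)"

definition word_perm :: "nat list \<Rightarrow> nat \<Rightarrow> nat" where
  "word_perm w x = (if x \<in> {1..5} then w ! (x - 1) else x)"

definition cyc3 :: "nat \<Rightarrow> nat \<Rightarrow> nat \<Rightarrow> nat \<Rightarrow> nat" where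
  "cyc3 a b c x = (if x = a then b else if x = b then c else if x = c then a else x)"

lemma length_pentagons: "\<forall>l\<in>set pentagons. length l = 5"
  by (simp add: pentagons_def)

lemma rotate_pentagon_even:
  assumes "l \<in> set pentagons"
  shows "rotate k l \<in> set even_words"
proof -
  have "rotate k l = rotate (k mod 5) l" using assms length_pentagons rotate_conv_mod[of k l] by simp
  then show ?thesis using assms unfolding even_words_def by fastforce
qed

text \<open>The word is rotated so that it starts with 1.\<close>

lemma cyc3_pentagons:
  "\<forall>a\<in>set [1..<6]. \<forall>b\<in>set [1..<6]. \<forall>c\<in>set [1..<6]. a = b \<or> b = c \<or> a = c \<or>
    (\<forall>l\<in>set pentagons. let w = map (cyc3 a b c) l
      in dropWhile (\<lambda>x. x \<noteq> 1) w @ takeWhile (\<lambda>x. x \<noteq> 1) w \<in> set pentagons)"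
  unfolding pentagons_def by code_simp

text \<open>The 16 pairs not ending in 5 come first: they index the basis of \<open>F\<close>.\<close>

definition pairs :: "(nat \<times> nat) list" where
  "pairs = [(1,2),(1,3),(1,4),(2,1),(2,3),(2,4),(3,1),(3,2),(3,4),(4,1),(4,2),(4,3),
     (5,1),(5,2),(5,3),(5,4),(1,5),(2,5),(3,5),(4,5)]"

text \<open>Double transitivity of the alternating group: the first two letters of a word are the
  images of 1 and 2.\<close>

lemma pairs_even_words: "set (map (\<lambda>w. (w ! 0, w ! 1)) even_words) = set pairs"
  unfolding even_words_def pentagons_def pairs_def by code_simp

definition word_arcs :: "nat list \<Rightarrow> (nat \<times> nat) list" where
  "word_arcs w = zip w (rotate1 w)"

definition arcs12 :: "(nat \<times> nat) list list" where
  "arcs12 = map word_arcs pentagons"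

text \<open>Reversing a word while keeping its first letter is a double transposition of positions,
  so both orientations of a pentagon occur in \<open>pentagons\<close>. The filter keeps the one
  whose second letter is smaller than the last.\<close>

definition arcs6 :: "(nat \<times> nat) list list" where
  "arcs6 = map (\<lambda>l. word_arcs l @ map prod.swap (word_arcs l)) (filter (\<lambda>l. l ! 1 < l ! 4) pentagons)"

definition arcs10 :: "(nat \<times> nat) list list" where
  "arcs10 = map (\<lambda>(i, j). [(i, j), (j, i)]) (filter (\<lambda>(i, j). i < j) pairs)"

lemma distinct_arcs12: "distinct (map set arcs12)" by code_simp
lemma distinct_arcs6: "distinct (map set arcs6)" by code_simp
lemma distinct_arcs10: "distinct (map set arcs10)" by code_simp
lemma arcs6_eq: "set (map (\<lambda>a. set (a @ map prod.swap a)) arcs12) = set (map set arcs6)" by code_simp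

text \<open>The 24 five-cycles form two conjugacy classes of 12, interchanged by squaring, and the
  graphs of one class are the directed pentagons of \<open>arcs12\<close>. Four further applications
  of w to the word w produce the word of its fifth power, so the second alternative excludes the
  elements whose fifth power is not trivial.\<close>

lemma five_cycle_words:
  "\<forall>w\<in>set even_words. w = [1,2,3,4,5] \<or> (let f = map (\<lambda>x. w ! (x - 1)) in f (f (f (f w))) \<noteq> [1,2,3,4,5]) \<or>
     set (zip [1,2,3,4,5] w) \<in> set (map set arcs12) \<or>
     set (zip [1,2,3,4,5] (map (\<lambda>x. w ! (x - 1)) w)) \<in> set (map set arcs12)"
  unfolding even_words_def by code_simp


text \<open>The entries 2 and 1 come from 1 + [c \<subseteq> x]. Replace the constant 1 by t: only
  the trivial isotypic component changes. There the sum of the 6 undirected pentagons goes to 1 + 6t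
  times the sum of the directed ones plus 3 times the sum of the unordered pairs, and the class of
  the sum of the 20 pairs goes to 5 and 2 times these sums. The determinant of this component is 2(1
  + 6t) - 15 = 12t - 13, which is -1 for t = 1; for t = 0 the whole matrix would have determinant 13
  up to sign.\<close>

definition iso_rows :: "int list list" where
  "iso_rows =
     map (\<lambda>c. map (\<lambda>x. if set c \<subseteq> set x then 2 else 1) arcs6 @
       map (\<lambda>q. if q \<in> set c then 1 else 0) (take 16 pairs)) arcs12 @
     map (\<lambda>s. map (\<lambda>x. if set s \<subseteq> set x then 1 else 0) arcs6 @
       map (\<lambda>q. if q \<in> set s then 1 else 0) (take 16 pairs)) arcs10"

text \<open>The columns of the inverse of the matrix with rows \<^const>\<open>iso_rows\<close>, found by computer algebra.\<close>

definition iso_inverse_cols :: "int list list" where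
  "iso_inverse_cols =
    [[-1,0,0,0,0,0,0,0,0,1,1,1,0,0,1,0,-1,0,1,0,0,1],
     [0,-1,0,0,0,0,1,1,1,0,0,1,0,0,0,-1,0,0,0,0,1,1],
     [0,0,-1,0,0,0,1,0,0,0,0,-1,0,0,0,1,1,1,0,1,1,0],
     [0,0,0,-1,0,0,1,1,1,-1,0,0,0,1,0,0,0,0,0,1,0,1],
     [0,0,0,0,-1,0,0,0,0,0,-1,0,1,1,1,0,1,0,1,1,0,0],
     [0,-1,0,0,0,0,0,1,0,1,1,1,0,-1,0,0,0,0,0,0,1,1],
     [0,0,0,0,0,-1,0,0,0,0,1,0,0,0,-1,1,1,1,1,0,1,0],
     [0,0,-1,0,0,0,1,1,1,0,0,0,-1,0,0,0,0,1,0,1,1,0],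
     [0,0,0,-1,0,0,0,0,1,0,0,0,1,1,1,0,0,-1,0,1,0,1],
     [0,0,0,0,-1,0,0,0,-1,0,0,0,1,0,0,1,1,1,1,1,0,0],
     [0,0,0,0,0,-1,-1,0,0,1,1,1,0,0,0,1,0,0,1,0,1,0],
     [-1,0,0,0,0,0,0,-1,0,1,0,0,1,1,1,0,0,0,1,0,0,1],
     [1,1,1,0,0,0,-1,-1,-1,-1,-1,-1,0,0,-1,0,0,-1,-1,-1,-2,-2],
     [0,1,0,1,1,0,-1,-1,-1,0,0,-1,-1,-1,-1,0,-1,0,-1,-2,-1,-2],
     [0,0,1,1,0,1,-1,-1,-1,0,-1,0,0,-1,0,-1,-1,-1,-1,-2,-2,-1],
     [1,0,0,1,0,1,0,0,-1,-1,-1,-1,-1,-1,-1,-1,0,0,-2,-1,-1,-2],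
     [0,1,0,0,1,1,0,-1,0,-1,-1,-1,-1,0,0,-1,-1,-1,-2,-1,-2,-1],
     [1,0,1,0,1,0,-1,0,0,-1,0,0,-1,-1,-1,-1,-1,-1,-2,-2,-1,-1],
     [1,0,0,0,1,1,0,0,0,-1,-1,-1,-1,-1,-1,-1,-1,-1,-2,-1,-1,-1],
     [0,0,1,1,1,0,-1,-1,-1,0,0,0,-1,-1,-1,-1,-1,-1,-1,-2,-1,-1],
     [0,1,1,0,0,1,-1,-1,-1,-1,-1,-1,0,0,0,-1,-1,-1,-1,-1,-2,-1],
     [1,1,0,1,0,0,-1,-1,-1,-1,-1,-1,-1,-1,-1,0,0,0,-1,-1,-1,-2]]"

lemma iso_rows_inverse:
  "map (\<lambda>r. map (\<lambda>c. sum_list (map2 (*) r c)) iso_inverse_cols) iso_rows =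
   map (\<lambda>i. map (\<lambda>j. if i = j then 1 else 0) [0..<22]) [0..<22]"
  by code_simp

lemma lengths:
  "length pentagons = 12" "length pairs = 20" "length arcs12 = 12" "length arcs6 = 6" "length arcs10 = 10"
  "length even_words = 60" "length iso_rows = 22" "length iso_inverse_cols = 22"
  "\<forall>r\<in>set iso_inverse_cols. length r = 22" "\<forall>r\<in>set iso_rows. length r = 22"
  by code_simp+

section \<open>The alternating group acting on relations\<close>

definition rel_act :: "('a \<Rightarrow> 'a) \<Rightarrow> ('a \<times> 'a) set \<Rightarrow> ('a \<times> 'a) set" where
  "rel_act g r = map_prod g g ` r"

lemma rel_act_comp: "rel_act (g \<circ> h) r = rel_act g (rel_act h r)"
  unfolding rel_act_def image_image by (rule image_cong) auto

lemma rel_act_converse: "rel_act g (r\<inverse>) = (rel_act g r)\<inverse>"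
  unfolding rel_act_def by force

lemma rel_act_Un: "rel_act g (r \<union> s) = rel_act g r \<union> rel_act g s"
  unfolding rel_act_def by (rule image_Un)

lemma group_action_rel_act:
  fixes G :: "('a \<Rightarrow> 'a) monoid"
  assumes G: "group G" and mult: "monoid.mult G = (\<circ>)" and bij: "\<And>g. g \<in> carrier G \<Longrightarrow> bij g"
  shows "group_action G UNIV rel_act"
proof (intro group_action.intro group_hom.intro group_hom_axioms.intro G group_BijGroup homI)
  have B: "rel_act g \<in> Bij UNIV" if "g \<in> carrier G" for g
  proof -
    have "bij_betw g UNIV UNIV" using bij[OF that] by simp
    then have "bij (map_prod g g)"
      unfolding bij_def bij_betw_def by (simp add: prod.inj_map map_prod_surj)
    then have "bij (image (map_prod g g))"
      by (metis bij_betw_Pow Pow_UNIV)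
    then show ?thesis by (simp add: Bij_def rel_act_def[abs_def] extensional_def)
  qed
  then show "rel_act g \<in> carrier (BijGroup UNIV)" if "g \<in> carrier G" for g
    using that by (simp add: BijGroup_def)
  fix g h assume gh: "g \<in> carrier G" "h \<in> carrier G"
  show "rel_act (g \<otimes>\<^bsub>G\<^esub> h) = rel_act g \<otimes>\<^bsub>BijGroup UNIV\<^esub> rel_act h"
    using B[OF gh(1)] B[OF gh(2)] by (auto simp: BijGroup_def mult rel_act_comp compose_def fun_eq_iff)
qed

abbreviation (input) A5 :: "(nat \<Rightarrow> nat) monoid" where
  "A5 \<equiv> alt_group 5"

lemma A5_bij: "g \<in> carrier A5 \<Longrightarrow> bij g"
  by (auto simp: alt_group_carrier permutes_bij)

lemma rel_act_subgroup:
  assumes "subgroup K A5"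
  shows "group_action (A5\<lparr>carrier := K\<rparr>) UNIV rel_act"
  using assms A5_bij group.subgroup_imp_group[OF alt_group_is_group assms] subgroup.subset[OF assms]
  by (intro group_action_rel_act) (auto simp: alt_group_mult)

interpretation A5: group_action A5 UNIV rel_act
  using A5_bij by (intro group_action_rel_act alt_group_is_group alt_group_mult)

interpretation A5: group A5
  by (rule alt_group_is_group)

lemma card_A5: "card (carrier A5) = 60"
  using alt_group_card_carrier[of 5] by (simp add: fact_numeral)

lemma finite_A5: "finite (carrier A5)"
  by (rule card_ge_0_finite) (simp add: card_A5)

lemma cyc3_eq:
  assumes "a \<noteq> b" "b \<noteq> c" "a \<noteq> c"
  shows "cycle_of_list [a, b, c] = cyc3 a b c"
  using assms by (auto simp: cyc3_def fun_eq_iff transpose_def)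

lemma cyc3_even_words:
  assumes "a \<in> {1..5}" "b \<in> {1..5}" "c \<in> {1..5}" "a \<noteq> b" "b \<noteq> c" "a \<noteq> c" and w: "w \<in> set even_words"
  shows "map (cyc3 a b c) w \<in> set even_words"
proof -
  obtain k l where l: "l \<in> set pentagons" and k: "w = rotate k l"
    using w by (auto simp: even_words_def)
  have "{1..5} = set [1..<6::nat]" by auto
  then have abc: "a \<in> set [1..<6]" "b \<in> set [1..<6]" "c \<in> set [1..<6]" using assms(1-3) by auto
  let ?u = "map (cyc3 a b c) l"
  let ?d = "dropWhile (\<lambda>x. x \<noteq> 1) ?u" and ?t = "takeWhile (\<lambda>x. x \<noteq> 1) ?u"
  have "?d @ ?t \<in> set pentagons"
    using cyc3_pentagons[rule_format, OF abc] assms(4-6) l by (auto simp: Let_def)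
  moreover have "?u = rotate (length ?d) (?d @ ?t)" by (simp add: rotate_append)
  then have "map (cyc3 a b c) w = rotate (k + length ?d) (?d @ ?t)"
    by (simp add: k rotate_map flip: rotate_rotate)
  ultimately show ?thesis by (metis rotate_pentagon_even)
qed

lemma three_cycle_cases:
  assumes "p \<in> three_cycles 5"
  obtains a b c where "p = cyc3 a b c" "a \<in> {1..5}" "b \<in> {1..5}" "c \<in> {1..5}" "a \<noteq> b" "b \<noteq> c" "a \<noteq> c"
proof -
  obtain cs where cs: "p = cycle_of_list cs" "distinct cs" "length cs = 3" "set cs \<subseteq> {1..5}"
    using assms by auto
  obtain a b c where "cs = [a, b, c]" using stupid_lemma[OF cs(3)] by metis
  with cs that cyc3_eq[of a b c] show thesis by auto
qed

text \<open>The 3-cycles generate the group, so stability of the list under 3-cycles, a finite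
  check, is enough.\<close>

lemma A5_even_words:
  assumes "p \<in> carrier A5" "w \<in> set even_words"
  shows "map p w \<in> set even_words"
proof -
  have "p \<in> generate A5 (three_cycles 5)"
    using assms(1) alt_group_carrier_as_three_cycles by blast
  then show ?thesis using assms(2)
  proof (induction arbitrary: w rule: generate.induct)
    case one
    then show ?case by (simp add: alt_group_one)
  next
    case (incl p)
    from incl(1) obtain a b c where "p = cyc3 a b c" "a \<in> {1..5}" "b \<in> {1..5}" "c \<in> {1..5}"
      "a \<noteq> b" "b \<noteq> c" "a \<noteq> c" by (rule three_cycle_cases)
    with incl(2) show ?case using cyc3_even_words by blast
  next
    case (inv p)
    then obtain a b c where p: "p = cyc3 a b c" "a \<in> {1..5}" "b \<in> {1..5}" "c \<in> {1..5}"
      "a \<noteq> b" "b \<noteq> c" "a \<noteq> c" by (elim three_cycle_cases)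
    have "p \<in> carrier A5" using inv(1) three_cycles_incl by blast
    moreover have "cyc3 c b a \<in> three_cycles 5"
      using p cyc3_eq[of c b a] by (intro CollectI exI[of _ "[c, b, a]"]) auto
    then have "cyc3 c b a \<in> carrier A5" using three_cycles_incl by blast
    moreover have "cyc3 c b a \<circ> p = id" using p(5-7) unfolding p(1) by (auto simp: cyc3_def fun_eq_iff)
    ultimately have "inv\<^bsub>A5\<^esub> p = cyc3 c b a"
      by (intro A5.inv_equality) (simp_all only: alt_group_mult alt_group_one)
    then show ?case using cyc3_even_words[of c b a w] p inv(2) by simp
  next
    case (eng p q)
    then have "map p (map q w) \<in> set even_words" by blast
    then show ?case by (simp add: alt_group_mult comp_def)
  qed
qed

text \<open>Applying an element to the word 1,2,3,4,5 gives one inclusion. The other is counting, at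
  most 60 words against 60 elements, so the parity of a word is never computed.\<close>

lemma A5_eq_word_perm: "carrier A5 = word_perm ` set even_words"
proof (rule sym, rule card_seteq[symmetric])
  show "carrier A5 \<subseteq> word_perm ` set even_words"
  proof
    fix p assume p: "p \<in> carrier A5"
    have "[1,2,3,4,5] \<in> set pentagons" by (simp add: pentagons_def)
    from rotate_pentagon_even[OF this, of 0] have "[1,2,3,4,5] \<in> set even_words"
      by (simp only: rotate0 id_apply)
    then have "map p [1,2,3,4,5] \<in> set even_words" by (rule A5_even_words[OF p])
    moreover have "p = word_perm (map p [1,2,3,4,5])"
    proof
      fix x
      have "p permutes {1..5}" using p by (simp add: alt_group_carrier)
      then have "p x = x" if "x \<notin> {1..5}" using that by (simp add: permutes_def)
      moreover have "x \<in> {1..5} \<longleftrightarrow> x = 1 \<or> x = 2 \<or> x = 3 \<or> x = 4 \<or> x = 5" by auto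
      ultimately show "p x = word_perm (map p [1,2,3,4,5]) x"
        unfolding word_perm_def by (auto simp: numeral_eq_Suc)
    qed
    ultimately show "p \<in> word_perm ` set even_words" by (rule rev_image_eqI)
  qed
  have "card (word_perm ` set even_words) \<le> card (set even_words)" by (rule card_image_le) simp
  also have "\<dots> \<le> 60" using card_length[of even_words] lengths(6) by simp
  finally show "card (word_perm ` set even_words) \<le> card (carrier A5)" using card_A5 by simp
qed simp

lemma A5_words:
  shows "(\<lambda>p. map p [1,2,3,4,5]) ` carrier A5 = set even_words"
proof -
  have "map (word_perm w) [1,2,3,4,5] = w" if w: "w \<in> set even_words" for w
  proof -
    have "length w = 5" using w length_pentagons by (auto simp: even_words_def)
    then obtain a b c d e where "w = [a, b, c, d, e]"
      by (auto simp: length_Suc_conv eval_nat_numeral)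
    then show ?thesis by (simp add: word_perm_def)
  qed
  then show ?thesis unfolding A5_eq_word_perm image_image by simp
qed

text \<open>Turns an orbit into an image of the explicit list of words, where it can be compared
  with a table by evaluation.\<close>

lemma orbit_A5:
  assumes "\<And>p. p \<in> carrier A5 \<Longrightarrow> rel_act p r = F (map p [1,2,3,4,5])"
  shows "orbit A5 rel_act r = F ` set even_words"
proof -
  have "orbit A5 rel_act r = (\<lambda>p. rel_act p r) ` carrier A5" by (auto simp: orbit_def)
  also have "\<dots> = (\<lambda>p. F (map p [1,2,3,4,5])) ` carrier A5" using assms by (rule image_cong[OF refl])
  also have "\<dots> = F ` set even_words" unfolding A5_words[symmetric] image_image ..
  finally show ?thesis .
qed

lemma orbit_pair: 
  assumes "\<And>p. rel_act p r = f (p 1, p 2)"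
  shows "orbit A5 rel_act r = f ` set pairs"
proof -
  have "orbit A5 rel_act r = (\<lambda>w. f (w ! 0, w ! 1)) ` set even_words"
    by (rule orbit_A5) (simp add: assms)
  also have "\<dots> = f ` set (map (\<lambda>w. (w ! 0, w ! 1)) even_words)" by (simp add: image_image)
  also have "\<dots> = f ` set pairs" by (simp only: pairs_even_words)
  finally show ?thesis .
qed

lemma word_arcs_rotate1: "length w = 5 \<Longrightarrow> set (word_arcs (rotate1 w)) = set (word_arcs w)"
  by (auto simp: word_arcs_def length_Suc_conv eval_nat_numeral)

lemma word_arcs_rotate:
  assumes "length w = 5" shows "set (word_arcs (rotate k w)) = set (word_arcs w)"
  by (induction k) (simp_all add: assms word_arcs_rotate1)

lemma word_arcs_even_words: "(\<lambda>w. set (word_arcs w)) ` set even_words = set (map set arcs12)"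
proof -
  have "(\<lambda>w. set (word_arcs w)) ` set even_words \<subseteq> set (map set arcs12)"
    using word_arcs_rotate length_pentagons by (auto simp: even_words_def arcs12_def)
  moreover have "set (word_arcs l) \<in> (\<lambda>w. set (word_arcs w)) ` set even_words" if "l \<in> set pentagons" for l
    using rotate_pentagon_even[OF that, of 0] by auto
  ultimately show ?thesis by (auto simp: arcs12_def)
qed

text \<open>A point i is encoded as the loop {(i, i)}, so that points too are relations and one
  action serves all five orbits.\<close>

definition X5 where "X5 = (\<lambda>i. {(i, i)}) ` {1..5::nat}"
definition X20 where "X20 = (\<lambda>q. {q}) ` set pairs"
definition X10 where "X10 = set (map set arcs10)"
definition X12 where "X12 = set (map set arcs12)"
definition X6 where "X6 = set (map set arcs6)"

abbreviation "pentagon \<equiv> set (word_arcs [1,2,3,4,5])"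

lemma rel_act_pentagon: "rel_act p pentagon = set (word_arcs (map p [1,2,3,4,5]))"
  by (simp add: rel_act_def word_arcs_def)

lemma orbit_X5: "orbit A5 rel_act {(1, 1)} = X5"
proof -
  have "orbit A5 rel_act {(1, 1)} = (\<lambda>q. {(fst q, fst q)}) ` set pairs"
    by (rule orbit_pair) (simp add: rel_act_def)
  also have "\<dots> = (\<lambda>i. {(i, i)}) ` set (map fst pairs)" by (simp add: image_image)
  also have "set (map fst pairs) = {1..5}" by (auto simp: pairs_def)
  finally show ?thesis by (simp add: X5_def)
qed

lemma orbit_X20: "orbit A5 rel_act {(1, 2)} = X20"
  unfolding X20_def by (rule orbit_pair) (simp add: rel_act_def)

lemma arcs10_eq: "set (map (\<lambda>q. set [q, prod.swap q]) pairs) = set (map set arcs10)"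
  by code_simp

lemma orbit_X10: "orbit A5 rel_act {(1, 2), (2, 1)} = X10"
proof -
  have "orbit A5 rel_act {(1, 2), (2, 1)} = (\<lambda>q. {q, prod.swap q}) ` set pairs"
    by (rule orbit_pair) (simp add: rel_act_def)
  also have "\<dots> = set (map (\<lambda>q. set [q, prod.swap q]) pairs)" by simp
  also have "\<dots> = X10" unfolding X10_def by (rule arcs10_eq)
  finally show ?thesis .
qed

lemma orbit_X12: "orbit A5 rel_act pentagon = X12"
  unfolding X12_def word_arcs_even_words[symmetric] by (rule orbit_A5) (rule rel_act_pentagon)

lemma orbit_X6: "orbit A5 rel_act (pentagon \<union> pentagon\<inverse>) = X6"
proof -
  have "orbit A5 rel_act (pentagon \<union> pentagon\<inverse>) = (\<lambda>w. set (word_arcs w) \<union> (set (word_arcs w))\<inverse>) ` set even_words"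
    by (rule orbit_A5) (simp only: rel_act_Un rel_act_converse rel_act_pentagon)
  also have "\<dots> = (\<lambda>r. r \<union> r\<inverse>) ` (\<lambda>w. set (word_arcs w)) ` set even_words" by (simp add: image_image)
  also have "\<dots> = set (map (\<lambda>a. set (a @ map prod.swap a)) arcs12)"
  proof -
    have "r\<inverse> = prod.swap ` r" for r :: "(nat \<times> nat) set" by auto
    then show ?thesis unfolding word_arcs_even_words by (simp add: image_image)
  qed
  also have "\<dots> = X6" unfolding X6_def arcs6_eq ..
  finally show ?thesis .
qed

section \<open>Fixed points of the subgroups\<close>

lemma card_X:
  "card X5 = 5" "card X20 = 20" "card X10 = 10" "card X12 = 12" "card X6 = 6"
proof -
  show "card X5 = 5" unfolding X5_def by (subst card_image) (auto simp: inj_on_def)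
  have "distinct pairs" by (simp add: pairs_def)
  then show "card X20 = 20"
    unfolding X20_def using lengths(2) by (subst card_image) (auto simp: inj_on_def distinct_card)
  show "card X10 = 10" "card X12 = 12" "card X6 = 6"
    unfolding X10_def X12_def X6_def
    using distinct_card[OF distinct_arcs10] distinct_card[OF distinct_arcs12]
      distinct_card[OF distinct_arcs6] lengths by simp_all
qed

lemma bij_betw_card_lessThan: "bij_betw e {..<n} A \<Longrightarrow> card A = n"
  using bij_betw_same_card by fastforce

text \<open>By counting, \<open>S\<close> is the whole stabilizer of \<open>r\<close>, so conjugacy of such subgroups never has to be
  discussed.\<close>

lemma coset_lattice_A5:
  assumes orb: "orbit A5 rel_act r0 = Y" and r: "r \<in> Y" and S: "subgroup S A5"
    and fixed: "\<And>g. g \<in> S \<Longrightarrow> rel_act g r = r" and card: "card S * card Y = 60"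
    and \<rho>: "coset_lattice A5 S n \<rho>"
  obtains e where "bij_betw e {..<n} Y" "\<And>g. g \<in> carrier A5 \<Longrightarrow> \<rho> g = perm_rep rel_act e n g"
proof -
  have Y: "orbit A5 rel_act r = Y"
  proof -
    have "r \<in> orbit A5 rel_act r0" using orb r by simp
    moreover have "r0 \<in> orbit A5 rel_act r"
      using A5.orbit_sym[of r0 r] r orb by simp
    ultimately have "orbit A5 rel_act r \<subseteq> orbit A5 rel_act r0" "orbit A5 rel_act r0 \<subseteq> orbit A5 rel_act r"
      using A5.orbit_trans[of r0 r] A5.orbit_trans[of r r0] by auto
    then show ?thesis using orb by simp
  qed
  have "S = stabilizer A5 rel_act r"
  proof (rule A5.stabilizer_eqI)
    show "S \<subseteq> stabilizer A5 rel_act r"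
      using fixed subgroup.subset[OF S] by (auto simp: stabilizer_def)
    show "card S * card (orbit A5 rel_act r) = Coset.order A5"
      using card card_A5 by (simp add: Y Coset.order_def)
  qed (use finite_A5 in auto)
  from A5.coset_lattice_imp_perm_rep[OF UNIV_I \<rho> this] Y that show thesis by metis
qed

text \<open>The divisibility is the orbit-stabilizer theorem for \<open>K\<close> acting on the
  loops {(i, i)}.\<close>

lemma point_orbit:
  assumes K: "subgroup K A5" and i: "i \<in> {1..5}"
  shows "card ((\<lambda>g. g i) ` K) dvd card K" and "(\<lambda>g. g i) ` K \<subseteq> {1..5}" and "i \<in> (\<lambda>g. g i) ` K"
    and "g \<in> K \<Longrightarrow> g ` (\<lambda>g. g i) ` K = (\<lambda>g. g i) ` K"
proof -
  let ?G = "A5\<lparr>carrier := K\<rparr>" and ?O = "(\<lambda>g. g i) ` K"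
  interpret K: group_action ?G UNIV rel_act by (rule rel_act_subgroup[OF K])
  have perm: "g permutes {1..5}" if "g \<in> K" for g
    using subgroup.subset[OF K] that by (auto simp: alt_group_carrier)
  have "orbit ?G rel_act {(i, i)} = (\<lambda>j. {(j, j)}) ` ?O"
    by (auto simp: orbit_def rel_act_def)
  then have "card (orbit ?G rel_act {(i, i)}) = card ?O"
    by (simp add: card_image inj_on_def)
  then show "card ?O dvd card K"
    using K.orbit_stabilizer_theorem[of "{(i, i)}"]
    by (intro dvdI[of _ _ "card (stabilizer ?G rel_act {(i, i)})"]) (simp add: Coset.order_def)
  show sub: "?O \<subseteq> {1..5}" using perm i permutes_in_image by fastforce
  show "i \<in> ?O"
    using imageI[OF subgroup.one_closed[OF K], of "\<lambda>g. g i"] by (simp add: alt_group_one)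
  show "g ` ?O = ?O" if g: "g \<in> K"
  proof (rule card_subset_eq)
    show "finite ?O" using sub finite_subset by blast
    show "g ` ?O \<subseteq> ?O"
    proof
      fix j assume "j \<in> g ` ?O"
      then obtain h where h: "h \<in> K" "j = g (h i)" by auto
      then have "g \<circ> h \<in> K" using subgroup.m_closed[OF K g h(1)] by (simp add: alt_group_mult)
      then show "j \<in> ?O" using h(2) by (auto intro!: image_eqI[of _ _ "g \<circ> h"])
    qed
    show "card (g ` ?O) = card ?O"
      using permutes_inj[OF perm[OF g]] by (simp add: card_image inj_on_subset)
  qed
qed

lemma set_pairs: "set pairs = {(a, b). a \<in> {1..5} \<and> b \<in> {1..5} \<and> a \<noteq> b}"
proof -
  have "set pairs = set (filter (\<lambda>(a, b). a \<noteq> b) (List.product [1..<6] [1..<6]))"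
    by code_simp
  also have "\<dots> = {(a, b). a \<in> {1..5} \<and> b \<in> {1..5} \<and> a \<noteq> b}"
    unfolding set_filter set_product set_upt by auto
  finally show ?thesis .
qed

lemma invariant_pair:
  assumes P: "P \<subseteq> {1..5}" "card P = 2" and inv: "\<forall>g\<in>K. g ` P = P"
  shows "\<exists>r\<in>X10. \<forall>g\<in>K. rel_act g r = r"
proof -
  obtain a b where ab: "P = {a, b}" "a \<noteq> b" using P(2) by (auto simp: card_2_iff)
  have "(a, b) \<in> set pairs"
    unfolding set_pairs using P(1) ab by auto
  then have "set [(a, b), prod.swap (a, b)] \<in> set (map (\<lambda>q. set [q, prod.swap q]) pairs)"
    unfolding set_map by (rule imageI)
  then have "{(a, b), (b, a)} \<in> X10" unfolding arcs10_eq X10_def by simp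
  moreover have "rel_act g {(a, b), (b, a)} = {(a, b), (b, a)}" if "g \<in> K" for g
  proof -
    have "{g a, g b} = {a, b}" using bspec[OF inv that] ab by simp
    then have "(g a = a \<and> g b = b) \<or> (g a = b \<and> g b = a)" by (auto simp: doubleton_eq_iff)
    then show ?thesis by (auto simp: rel_act_def)
  qed
  ultimately show ?thesis by blast
qed

text \<open>A point orbit of size 5 would make 5 divide the order. An orbit of size 2 is an
  invariant pair, the complement of one of size 3 is such a pair, and the complement of one of size
  4 is a fixed point.\<close>

lemma orbit_dichotomy:
  assumes K: "subgroup K A5" and i: "i \<in> {1..5}" and card: "\<not> 5 dvd card K"
  shows "card ((\<lambda>g. g i) ` K) = 1 \<or> (card ((\<lambda>g. g i) ` K) = 4 \<and> (\<exists>j\<in>{1..5}. \<forall>g\<in>K. g j = j)) \<or>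
    (\<exists>r\<in>X10. \<forall>g\<in>K. rel_act g r = r)"
proof -
  let ?O = "(\<lambda>g. g i) ` K"
  note O = point_orbit[OF K i]
  have perm: "g permutes {1..5}" if "g \<in> K" for g
    using subgroup.subset[OF K] that by (auto simp: alt_group_carrier)
  have fin: "finite ?O" using O(2) finite_subset by blast
  have "card ?O \<noteq> 0" using O(3) fin by auto
  moreover have "card ?O \<le> 5" using card_mono[OF _ O(2)] by simp
  moreover have "card ?O \<noteq> 5" using O(1) card by auto
  ultimately consider "card ?O = 1" | "card ?O = 2" | "card ?O = 3" | "card ?O = 4" by linarith
  then show ?thesis
  proof cases
    case 2
    have "\<forall>g\<in>K. g ` ?O = ?O" using O(4) by (rule ballI)
    from invariant_pair[OF O(2) 2 this] show ?thesis by (intro disjI2)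
  next
    case 3
    have c: "card ({1..5} - ?O) = 2" using 3 card_Diff_subset[OF fin O(2)] by simp
    have "g ` ({1..5} - ?O) = {1..5} - ?O" if "g \<in> K" for g
      using O(4)[OF that] permutes_image[OF perm[OF that]] permutes_inj[OF perm[OF that]]
      by (simp add: image_set_diff)
    then have "\<forall>g\<in>K. g ` ({1..5} - ?O) = {1..5} - ?O" by (rule ballI)
    from invariant_pair[OF Diff_subset c this] show ?thesis by (intro disjI2)
  next
    case 4
    have "card ({1..5} - ?O) = 1" using 4 card_Diff_subset[OF fin O(2)] by simp
    then obtain j where j: "{1..5} - ?O = {j}" by (auto simp: card_1_singleton_iff)
    have "g ` ({1..5} - ?O) = {1..5} - ?O" if "g \<in> K" for g
      using O(4)[OF that] permutes_image[OF perm[OF that]] permutes_inj[OF perm[OF that]]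
      by (simp add: image_set_diff)
    then have "\<forall>g\<in>K. g j = j" unfolding j by simp
    moreover have "j \<in> {1..5}" using j by blast
    ultimately show ?thesis using 4 by blast
  qed simp
qed

lemma singleton_orbit_fixed:
  assumes K: "subgroup K A5" and i: "i \<in> {1..5}" and card: "card ((\<lambda>g. g i) ` K) = 1"
  shows "\<forall>g\<in>K. g i = i"
proof
  obtain y where y: "(\<lambda>g. g i) ` K = {y}" using card by (auto simp: card_1_singleton_iff)
  fix g assume "g \<in> K"
  then have "g i \<in> (\<lambda>g. g i) ` K" by (rule imageI)
  then show "g i = i" using point_orbit(3)[OF K i] unfolding y by simp
qed

text \<open>An orbit of size 4 is excluded because 4 does not divide 6. So without an invariant pair
  all points would be fixed, and then {1, 2} is invariant after all.\<close>

lemma order6_fixes_pair: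
  assumes K: "subgroup K A5" and card: "card K = 6"
  obtains r where "r \<in> X10" "\<And>g. g \<in> K \<Longrightarrow> rel_act g r = r"
proof (cases "\<exists>r\<in>X10. \<forall>g\<in>K. rel_act g r = r")
  case True
  then show thesis using that by blast
next
  case False
  have "card ((\<lambda>g. g i) ` K) = 1" if i: "i \<in> {1..5}" for i
  proof -
    have "card ((\<lambda>g. g i) ` K) \<noteq> 4" using point_orbit(1)[OF K i] card by auto
    then show ?thesis using orbit_dichotomy[OF K i] card False by auto
  qed
  then have fixed: "g i = i" if "i \<in> {1..5}" "g \<in> K" for g i
    using singleton_orbit_fixed[OF K that(1)] that by blast
  have "rel_act g {(1, 2), (2, 1)} = {(1, 2), (2, 1)}" if "g \<in> K" for g
    using fixed[OF _ that, of 1] fixed[OF _ that, of 2] by (simp add: rel_act_def)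
  moreover have "{(1, 2), (2, 1)} \<in> X10"
    unfolding orbit_X10[symmetric] by (rule A5.orbit_refl) simp
  ultimately show thesis using that by blast
qed

text \<open>An invariant pair would have an orbit of at least 10 elements and a stabilizer of order
  at least 12, too much for a group of order 60. So the orbit of 1 has size 1 or 4, and either case
  yields a fixed point.\<close>

lemma order12_fixes_point:
  assumes K: "subgroup K A5" and card: "card K = 12"
  obtains r where "r \<in> X5" "\<And>g. g \<in> K \<Longrightarrow> rel_act g r = r"
proof -
  have no_pair: False if r: "r \<in> X10" "\<forall>g\<in>K. rel_act g r = r" for r
  proof -
    interpret K: subgroup K A5 by (rule K)
    have sub: "K \<subseteq> stabilizer A5 rel_act r" using r K.subset by (auto simp: stabilizer_def)
    have "r \<in> orbit A5 rel_act {(1, 2), (2, 1)}" using r orbit_X10 by simp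
    then have p0: "{(1, 2), (2, 1)} \<in> orbit A5 rel_act r" by (rule A5.orbit_sym[OF UNIV_I UNIV_I])
    have "X10 \<subseteq> orbit A5 rel_act r"
      unfolding orbit_X10[symmetric] using A5.orbit_trans[OF UNIV_I UNIV_I UNIV_I p0] by (rule subsetI)
    moreover have "finite (orbit A5 rel_act r)"
      using finite_A5 by (simp add: orbit_def setcompr_eq_image)
    ultimately have "10 \<le> card (orbit A5 rel_act r)" using card_mono card_X(3) by metis
    moreover have "12 \<le> card (stabilizer A5 rel_act r)"
      using card_mono[OF _ sub] finite_A5 card by (auto simp: stabilizer_def)
    ultimately have "10 * 12 \<le> card (orbit A5 rel_act r) * card (stabilizer A5 rel_act r)"
      by (rule mult_le_mono)
    then show False using A5.orbit_stabilizer_theorem[of r] card_A5 by (simp add: Coset.order_def)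
  qed
  have "\<exists>j\<in>{1..5}. \<forall>g\<in>K. g j = j"
  proof (cases "card ((\<lambda>g. g 1) ` K) = 1")
    case True
    then have "\<forall>g\<in>K. g 1 = 1" using singleton_orbit_fixed[OF K, of 1] by simp
    then show ?thesis by (intro bexI[of _ 1]) auto
  next
    case False
    then show ?thesis using orbit_dichotomy[OF K, of 1] card no_pair by auto
  qed
  then obtain j where "j \<in> {1..5}" "\<forall>g\<in>K. g j = j" by blast
  then show thesis by (intro that[of "{(j, j)}"]) (auto simp: X5_def rel_act_def)
qed

section \<open>Five-cycles as directed pentagons, and the subgroups of order 5 and 10\<close>

definition graph5 :: "(nat \<Rightarrow> nat) \<Rightarrow> (nat \<times> nat) set" where
  "graph5 c = (\<lambda>x. (x, c x)) ` {1..5}"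

lemma five_cycle_graph:
  assumes c: "c \<in> carrier A5" "c \<noteq> id" and c5: "c \<circ> c \<circ> c \<circ> c \<circ> c = id"
  shows "graph5 c \<in> X12 \<or> graph5 (c \<circ> c) \<in> X12"
proof -
  obtain w where w: "w \<in> set even_words" and cw: "c = word_perm w"
    using c(1) A5_eq_word_perm by auto
  have "length w = 5" using w length_pentagons by (auto simp: even_words_def)
  then obtain x1 x2 x3 x4 x5 where wx: "w = [x1, x2, x3, x4, x5]"
    by (auto simp: length_Suc_conv eval_nat_numeral)
  have perm: "c permutes {1..5}" using c(1) by (simp add: alt_group_carrier)
  have set5: "{1..5} = set [1,2,3,4,5::nat]" by auto
  have mc: "map c [1,2,3,4,5] = w" by (simp add: cw wx word_perm_def)
  have map_c: "map c u = map (\<lambda>x. w ! (x - 1)) u" if "set u \<subseteq> {1..5}" for u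
    using that by (auto simp: cw word_perm_def)
  have sub: "set (map c u) \<subseteq> {1..5}" if "set u \<subseteq> {1..5}" for u
    using that permutes_in_image[OF perm] by auto
  have g1: "graph5 c = set (zip [1,2,3,4,5] w)"
    unfolding graph5_def set5 mc[symmetric] by simp
  have w1: "set w \<subseteq> {1..5}" using sub[of "[1,2,3,4,5]"] unfolding mc by simp
  have g2: "graph5 (c \<circ> c) = set (zip [1,2,3,4,5] (map (\<lambda>x. w ! (x - 1)) w))"
    unfolding graph5_def set5 map_c[OF w1, symmetric] unfolding mc[symmetric] by simp
  have "w \<noteq> [1,2,3,4,5]"
  proof
    assume *: "w = [1,2,3,4,5]"
    have "c x = x" for x
    proof (cases "x \<in> {1..5}")
      case True
      then have "x \<in> {1,2,3,4,5}" by auto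
      then show ?thesis by (auto simp: cw word_perm_def *)
    next
      case False
      then show ?thesis using perm by (simp add: permutes_def)
    qed
    then show False using c(2) by auto
  qed
  moreover have "(let f = map (\<lambda>x. w ! (x - 1)) in f (f (f (f w)))) = [1,2,3,4,5]"
  proof -
    have "map (c \<circ> c \<circ> c \<circ> c \<circ> c) [1,2,3,4,5] = [1,2,3,4,5]" unfolding c5 by simp
    then have "map c (map c (map c (map c (map c [1,2,3,4,5])))) = [1,2,3,4,5]" by simp
    then have "map c (map c (map c (map c w))) = [1,2,3,4,5]" unfolding mc .
    then show ?thesis
      unfolding Let_def by (simp only: map_c[OF w1, symmetric] map_c[OF sub[OF w1], symmetric]
        map_c[OF sub[OF sub[OF w1]], symmetric] map_c[OF sub[OF sub[OF sub[OF w1]]], symmetric])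
  qed
  ultimately show ?thesis
    using bspec[OF five_cycle_words w] unfolding g1 g2 X12_def Let_def by argo
qed

text \<open>Acting on the graph of a permutation is conjugating the permutation; the hypothesis is d
  c = c' d, which avoids inverses.\<close>

lemma rel_act_graph5:
  assumes "d permutes {1..5}" "\<And>x. x \<in> {1..5} \<Longrightarrow> d (c x) = c' (d x)"
  shows "rel_act d (graph5 c) = graph5 c'"
proof -
  have "rel_act d (graph5 c) = (\<lambda>x. (d x, c' (d x))) ` {1..5}"
    using assms(2) by (simp add: rel_act_def graph5_def image_image cong: image_cong_simp)
  also have "\<dots> = graph5 c'"
    unfolding graph5_def using permutes_image[OF assms(1)] by (metis (no_types, lifting) image_cong image_image)
  finally show ?thesis .
qed

text \<open>An abelian group fixes the graphs of its own elements under conjugation, and a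
  nontrivial element or its square has its graph in \<open>X12\<close>.\<close>

lemma cyclic5_fixes_pentagon:
  assumes C: "subgroup C A5" and iso: "A5\<lparr>carrier := C\<rparr> \<cong> integer_mod_group 5"
  obtains r where "r \<in> X12" "\<And>g. g \<in> C \<Longrightarrow> rel_act g r = r" "card C = 5"
proof -
  interpret C: group "A5\<lparr>carrier := C\<rparr>" by (rule A5.subgroup_imp_group[OF C])
  obtain h where h: "h \<in> iso (A5\<lparr>carrier := C\<rparr>) (integer_mod_group 5)"
    using iso by (auto simp: is_iso_def)
  have card: "card C = 5"
    using iso_same_card[OF iso] by (simp add: carrier_integer_mod_group)
  have hom: "h (a \<circ> b) = (h a + h b) mod 5" if "a \<in> C" "b \<in> C" for a b
    using h that by (simp add: iso_def hom_def alt_group_mult)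
  have inj: "inj_on h C" using h by (simp add: iso_def bij_betw_def)
  have m_closed: "a \<circ> b \<in> C" if "a \<in> C" "b \<in> C" for a b
    using subgroup.m_closed[OF C that] by (simp add: alt_group_mult)
  have comm: "a \<circ> b = b \<circ> a" if "a \<in> C" "b \<in> C" for a b
    using inj_onD[OF inj, of "a \<circ> b" "b \<circ> a"] that m_closed hom by (simp add: add.commute)
  have "\<exists>c\<in>C. c \<noteq> id"
  proof (rule ccontr)
    assume "\<not> ?thesis"
    then have "C \<subseteq> {id}" by blast
    then have "card C \<le> 1" using card_mono[of "{id}" C] by simp
    then show False using card by simp
  qed
  then obtain c where c: "c \<in> C" "c \<noteq> id" by blast
  have cA: "c \<in> carrier A5" using c subgroup.subset[OF C] by blast
  have "c [^]\<^bsub>A5\<lparr>carrier := C\<rparr>\<^esub> (5::nat) = \<one>\<^bsub>A5\<lparr>carrier := C\<rparr>\<^esub>"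
    using C.pow_order_eq_1[of c] c card by (simp add: Coset.order_def)
  then have "c \<circ> c \<circ> c \<circ> c \<circ> c = id"
    by (simp add: eval_nat_numeral alt_group_mult alt_group_one)
  from five_cycle_graph[OF cA c(2) this]
  obtain c' where c': "graph5 c' \<in> X12" "c' \<in> C" using c m_closed by blast
  have "rel_act g (graph5 c') = graph5 c'" if g: "g \<in> C" for g
  proof (rule rel_act_graph5)
    show "g permutes {1..5}" using g subgroup.subset[OF C] by (auto simp: alt_group_carrier)
    show "g (c' x) = c' (g x)" for x using comm[OF g c'(2)] by (metis comp_apply)
  qed
  with c'(1) card that show thesis by blast
qed

text \<open>The relations are phrased by products alone: the sixth power of \<open>\<rho>\<close> is
  \<open>\<rho>\<close> in place of order 5, and \<rho> \<delta> \<rho> = \<delta> in place of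
  conjugation to the inverse. In this form they pull back along an injective multiplicative map
  without mention of identities or inverses.\<close>

lemma dihedral_perms_5:
  defines "\<rho> \<equiv> \<lambda>x. if x < 5 then (1 + x) mod 5 else x"
  shows "\<rho> \<in> dihedral_perms 5" and "\<rho> \<circ> \<rho> \<noteq> \<rho>" and "\<rho> \<circ> \<rho> \<circ> \<rho> \<circ> \<rho> \<circ> \<rho> \<circ> \<rho> = \<rho>"
    and "\<delta> \<in> dihedral_perms 5 \<Longrightarrow> \<delta> \<circ> \<rho> = \<rho> \<circ> \<delta> \<or> \<rho> \<circ> \<delta> \<circ> \<rho> = \<delta>"
    and "card (dihedral_perms 5) = 10"
proof -
  let ?f = "\<lambda>b x. if x < 5 then (b + x) mod 5 else x :: nat"
  let ?g = "\<lambda>b x. if x < 5 then (b + (5 - x)) mod 5 else x :: nat"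
  have eq: "dihedral_perms 5 = ?f ` {..<5} \<union> ?g ` {..<5}"
    unfolding dihedral_perms_def by blast
  have less5: "x = 0 \<or> x = 1 \<or> x = 2 \<or> x = 3 \<or> x = 4" if "x < 5" for x :: nat using that by arith
  show "\<rho> \<in> dihedral_perms 5" unfolding eq \<rho>_def by (intro UnI1 image_eqI[of _ _ 1]) auto
  have "(\<rho> \<circ> \<rho>) 0 \<noteq> \<rho> 0" by (simp add: \<rho>_def)
  then show "\<rho> \<circ> \<rho> \<noteq> \<rho>" by metis
  show "\<rho> \<circ> \<rho> \<circ> \<rho> \<circ> \<rho> \<circ> \<rho> \<circ> \<rho> = \<rho>"
  proof
    fix x show "(\<rho> \<circ> \<rho> \<circ> \<rho> \<circ> \<rho> \<circ> \<rho> \<circ> \<rho>) x = \<rho> x"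
    proof (cases "x < 5")
      case True
      from less5[OF this] show ?thesis by (elim disjE) (simp_all add: \<rho>_def)
    qed (simp add: \<rho>_def)
  qed
  show "\<delta> \<circ> \<rho> = \<rho> \<circ> \<delta> \<or> \<rho> \<circ> \<delta> \<circ> \<rho> = \<delta>" if "\<delta> \<in> dihedral_perms 5"
  proof -
    from that consider b where "b < 5" "\<delta> = ?f b" | b where "b < 5" "\<delta> = ?g b" unfolding eq by blast
    then show ?thesis
    proof cases
      case 1
      have "(\<delta> \<circ> \<rho>) x = (\<rho> \<circ> \<delta>) x" for x
      proof (cases "x < 5")
        case True
        from less5[OF this] less5[OF 1(1)] show ?thesis unfolding 1(2) by (elim disjE) (simp_all add: \<rho>_def)
      qed (simp add: 1(2) \<rho>_def)
      then show ?thesis by blast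
    next
      case 2
      have "(\<rho> \<circ> \<delta> \<circ> \<rho>) x = \<delta> x" for x
      proof (cases "x < 5")
        case True
        from less5[OF this] less5[OF 2(1)] show ?thesis unfolding 2(2) by (elim disjE) (simp_all add: \<rho>_def)
      qed (simp add: 2(2) \<rho>_def)
      then show ?thesis by blast
    qed
  qed
  have f0: "?f b 0 = b" "?g b 0 = b" if "b < 5" for b using that by simp_all
  have "inj_on ?f {..<5}" "inj_on ?g {..<5}"
    by (rule inj_on_inverseI[where g = "\<lambda>f. f 0"], simp)+
  then have "card (?f ` {..<5}) = 5" "card (?g ` {..<5}) = 5"
    by (subst card_image; simp)+
  moreover have "?f ` {..<5} \<inter> ?g ` {..<5} = {}"
  proof -
    have False if "b < 5" "c < 5" "?f b = ?g c" for b c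
    proof -
      have "b = c" using f0[OF that(1)] f0[OF that(2)] that(3) by metis
      moreover have "?f b 1 = ?g c 1" using that(3) by metis
      ultimately show False using less5[OF that(2)] by auto
    qed
    then show ?thesis by blast
  qed
  ultimately show "card (dihedral_perms 5) = 10"
    unfolding eq by (subst card_Un_disjoint) auto
qed

lemma X12_symmetrize:
  assumes "r \<in> X12"
  shows "r \<union> r\<inverse> \<in> X6"
proof -
  obtain g where g: "g \<in> carrier A5" "r = rel_act g pentagon"
    using assms unfolding orbit_X12[symmetric] orbit_def by blast
  then have "r \<union> r\<inverse> = rel_act g (pentagon \<union> pentagon\<inverse>)" by (simp only: rel_act_Un rel_act_converse)
  then show ?thesis unfolding orbit_X6[symmetric] orbit_def using g(1) by blast
qed

text \<open>An element commuting with the five-cycle fixes its graph; the others invert the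
  five-cycle and so exchange its graph with the converse. The union of both, the undirected
  pentagon, is fixed in either case.\<close>

lemma dihedral5_fixes_pentagon:
  assumes D: "subgroup D A5" and iso: "A5\<lparr>carrier := D\<rparr> \<cong> dihedral_group 5"
  obtains r where "r \<in> X6" "\<And>g. g \<in> D \<Longrightarrow> rel_act g r = r" "card D = 10"
proof -
  let ?\<rho> = "\<lambda>x::nat. if x < 5 then (1 + x) mod 5 else x"
  obtain h where h: "h \<in> iso (A5\<lparr>carrier := D\<rparr>) (dihedral_group 5)"
    using iso by (auto simp: is_iso_def)
  have bij: "bij_betw h D (dihedral_perms 5)" using h by (simp add: iso_def dihedral_group_def)
  have card: "card D = 10" using bij_betw_same_card[OF bij] dihedral_perms_5(5) by simp
  have hom: "h (a \<circ> b) = h a \<circ> h b" if "a \<in> D" "b \<in> D" for a b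
    using h that by (simp add: iso_def hom_def alt_group_mult dihedral_group_def sym_group_mult)
  have inj: "inj_on h D" using bij by (simp add: bij_betw_def)
  have m_closed: "a \<circ> b \<in> D" if "a \<in> D" "b \<in> D" for a b
    using subgroup.m_closed[OF D that] by (simp add: alt_group_mult)
  have "?\<rho> \<in> h ` D" unfolding bij_betw_imp_surj_on[OF bij] by (rule dihedral_perms_5(1))
  then obtain c where c: "c \<in> D" "h c = ?\<rho>" by (elim imageE) (rule that, assumption, rule sym)
  have cA: "c \<in> carrier A5" using c subgroup.subset[OF D] by blast
  note m2 = m_closed[OF c(1) c(1)]
  note m3 = m_closed[OF m2 c(1)]
  note m4 = m_closed[OF m3 c(1)]
  note m5 = m_closed[OF m4 c(1)]
  note m6 = m_closed[OF m5 c(1)]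
  have "h (c \<circ> c \<circ> c \<circ> c \<circ> c \<circ> c) = h c"
    by (simp only: hom[OF m5 c(1)] hom[OF m4 c(1)] hom[OF m3 c(1)] hom[OF m2 c(1)] hom[OF c(1) c(1)]
        c(2) dihedral_perms_5(3))
  then have c6: "c \<circ> c \<circ> c \<circ> c \<circ> c \<circ> c = c"
    by (rule inj_onD[OF inj _ m6 c(1)])
  have "c \<circ> c \<circ> c \<circ> c \<circ> c = id"
  proof
    fix x
    have "c ((c \<circ> c \<circ> c \<circ> c \<circ> c) x) = c x" using fun_cong[OF c6, of x] by simp
    then show "(c \<circ> c \<circ> c \<circ> c \<circ> c) x = id x" using A5_bij[OF cA] by (simp add: bij_def inj_eq)
  qed
  moreover have "c \<noteq> id"
  proof
    assume "c = id"
    then have "h c \<circ> h c = h c" using hom[OF c(1) c(1)] by simp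
    then show False unfolding c(2) by (rule dihedral_perms_5(2)[THEN notE])
  qed
  ultimately have graph: "graph5 c \<in> X12 \<or> graph5 (c \<circ> c) \<in> X12" using five_cycle_graph[OF cA] by blast
  have dich: "d \<circ> c = c \<circ> d \<or> c \<circ> d \<circ> c = d" if d: "d \<in> D" for d
  proof -
    have "h d \<in> dihedral_perms 5" using bij d by (auto simp: bij_betw_def)
    from dihedral_perms_5(4)[OF this] show ?thesis
    proof
      assume "h d \<circ> ?\<rho> = ?\<rho> \<circ> h d"
      then have "h (d \<circ> c) = h (c \<circ> d)" unfolding hom[OF d c(1)] hom[OF c(1) d] c(2) .
      then have "d \<circ> c = c \<circ> d" by (rule inj_onD[OF inj _ m_closed[OF d c(1)] m_closed[OF c(1) d]])
      then show ?thesis ..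
    next
      assume "?\<rho> \<circ> h d \<circ> ?\<rho> = h d"
      then have "h (c \<circ> d \<circ> c) = h d" unfolding hom[OF m_closed[OF c(1) d] c(1)] hom[OF c(1) d] c(2) .
      then have "c \<circ> d \<circ> c = d" by (rule inj_onD[OF inj _ m_closed[OF m_closed[OF c(1) d] c(1)] d])
      then show ?thesis ..
    qed
  qed
  \<comment> \<open>Both relations pass to the square of c, which takes over when its graph, and not
    that of c, lies in \<open>X12\<close>.\<close>
  have dich2: "d \<circ> (c \<circ> c) = (c \<circ> c) \<circ> d \<or> (c \<circ> c) \<circ> d \<circ> (c \<circ> c) = d" if d: "d \<in> D" for d
  proof -
    from dich[OF d] show ?thesis
    proof
      assume "d \<circ> c = c \<circ> d" then show ?thesis by (metis comp_assoc)
    next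
      assume "c \<circ> d \<circ> c = d" then show ?thesis by (metis comp_assoc)
    qed
  qed
  have "\<exists>c'\<in>D. graph5 c' \<in> X12 \<and> (\<forall>d\<in>D. d \<circ> c' = c' \<circ> d \<or> c' \<circ> d \<circ> c' = d)"
    using graph dich dich2 c(1) m_closed[OF c(1) c(1)] by blast
  then obtain c' where c': "c' \<in> D" "graph5 c' \<in> X12"
    "\<And>d. d \<in> D \<Longrightarrow> d \<circ> c' = c' \<circ> d \<or> c' \<circ> d \<circ> c' = d" by blast
  have "rel_act d (graph5 c' \<union> (graph5 c')\<inverse>) = graph5 c' \<union> (graph5 c')\<inverse>" if d: "d \<in> D" for d
  proof -
    have perm: "d permutes {1..5}" and permc: "c' permutes {1..5}"
      using d c'(1) subgroup.subset[OF D] by (auto simp: alt_group_carrier)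
    from c'(3)[OF d] show ?thesis
    proof
      assume "d \<circ> c' = c' \<circ> d"
      then have "rel_act d (graph5 c') = graph5 c'"
        by (intro rel_act_graph5[OF perm]) (metis comp_apply)
      then show ?thesis by (simp only: rel_act_Un rel_act_converse)
    next
      assume a: "c' \<circ> d \<circ> c' = d"
      have "rel_act d (graph5 c') = (\<lambda>y. (c' y, y)) ` d ` c' ` {1..5}"
        unfolding rel_act_def graph5_def image_image
      proof (rule image_cong[OF refl])
        fix x show "map_prod d d (x, c' x) = (c' (d (c' x)), d (c' x))" using fun_cong[OF a, of x] by simp
      qed
      also have "\<dots> = (graph5 c')\<inverse>"
        unfolding permutes_image[OF permc] permutes_image[OF perm] graph5_def by auto
      finally have "rel_act d (graph5 c') = (graph5 c')\<inverse>" .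
      then show ?thesis by (simp only: rel_act_Un rel_act_converse converse_converse) (rule Un_commute)
    qed
  qed
  with X12_symmetrize[OF c'(2)] card that show thesis by blast
qed

section \<open>The resolution and the isomorphism\<close>

lemma invariant_X:
  "invariant_subset A5 UNIV rel_act X5" "invariant_subset A5 UNIV rel_act X20"
  "invariant_subset A5 UNIV rel_act X10" "invariant_subset A5 UNIV rel_act X12"
  "invariant_subset A5 UNIV rel_act X6"
proof -
  have "finite (orbit A5 rel_act r)" for r using finite_A5 by (simp add: orbit_def setcompr_eq_image)
  then have "invariant_subset A5 UNIV rel_act (orbit A5 rel_act r)" for r
    by (intro A5.invariant_subset_orbit) simp_all
  then show "invariant_subset A5 UNIV rel_act X5" "invariant_subset A5 UNIV rel_act X20"
    "invariant_subset A5 UNIV rel_act X10" "invariant_subset A5 UNIV rel_act X12"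
    "invariant_subset A5 UNIV rel_act X6"
    unfolding orbit_X5[symmetric] orbit_X20[symmetric] orbit_X10[symmetric] orbit_X12[symmetric]
      orbit_X6[symmetric] by blast+
qed

interpretation X5: invariant_subset A5 UNIV rel_act X5 by (rule invariant_X)
interpretation X20: invariant_subset A5 UNIV rel_act X20 by (rule invariant_X)
interpretation X10: invariant_subset A5 UNIV rel_act X10 by (rule invariant_X)
interpretation X12: invariant_subset A5 UNIV rel_act X12 by (rule invariant_X)
interpretation X6: invariant_subset A5 UNIV rel_act X6 by (rule invariant_X)

definition enum20 :: "nat \<Rightarrow> (nat \<times> nat) set" where "enum20 i = {pairs ! i}"
definition enum12 :: "nat \<Rightarrow> (nat \<times> nat) set" where "enum12 i = set (arcs12 ! i)"
definition enum10 :: "nat \<Rightarrow> (nat \<times> nat) set" where "enum10 i = set (arcs10 ! i)"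
definition enum6 :: "nat \<Rightarrow> (nat \<times> nat) set" where "enum6 i = set (arcs6 ! i)"

definition Q16 where "Q16 = (\<lambda>q. {q}) ` set (take 16 pairs)"

lemma distinct_pairs: "distinct pairs" by (simp add: pairs_def)

lemma bij_enum:
  "bij_betw enum20 {..<20} X20" "bij_betw enum12 {..<12} X12" "bij_betw enum10 {..<10} X10" "bij_betw enum6 {..<6} X6"
  "bij_betw enum20 {..<16} Q16"
proof -
  have "distinct (map (\<lambda>q. {q}) pairs)" using distinct_pairs by (simp add: distinct_map inj_on_def)
  from bij_betw_nth[OF this, of "{..<20}" X20]
  have "bij_betw ((!) (map (\<lambda>q. {q}) pairs)) {..<20} X20" by (simp add: lengths X20_def)
  then show "bij_betw enum20 {..<20} X20" by (rule bij_betw_cong[THEN iffD1, rotated]) (simp add: enum20_def lengths)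
  have "distinct (map (\<lambda>q. {q}) (take 16 pairs))"
    using distinct_pairs by (simp add: distinct_map inj_on_def)
  from bij_betw_nth[OF this, of "{..<16}" Q16]
  have "bij_betw ((!) (map (\<lambda>q. {q}) (take 16 pairs))) {..<16} Q16" by (simp add: lengths Q16_def)
  then show "bij_betw enum20 {..<16} Q16" by (rule bij_betw_cong[THEN iffD1, rotated]) (simp add: enum20_def lengths)
  from bij_betw_nth[OF distinct_arcs12, of "{..<12}" X12]
  have "bij_betw ((!) (map set arcs12)) {..<12} X12" by (simp add: lengths X12_def)
  then show "bij_betw enum12 {..<12} X12" by (rule bij_betw_cong[THEN iffD1, rotated]) (simp add: enum12_def lengths)
  from bij_betw_nth[OF distinct_arcs10, of "{..<10}" X10]
  have "bij_betw ((!) (map set arcs10)) {..<10} X10" by (simp add: lengths X10_def)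
  then show "bij_betw enum10 {..<10} X10" by (rule bij_betw_cong[THEN iffD1, rotated]) (simp add: enum10_def lengths)
  from bij_betw_nth[OF distinct_arcs6, of "{..<6}" X6]
  have "bij_betw ((!) (map set arcs6)) {..<6} X6" by (simp add: lengths X6_def)
  then show "bij_betw enum6 {..<6} X6" by (rule bij_betw_cong[THEN iffD1, rotated]) (simp add: enum6_def lengths)
qed

text \<open>The incidence matrix of the complete directed graph: for a pair p, the entry is 1 at its
  tail and -1 at its head. Comparing images under \<open>fst\<close> and \<open>snd\<close> makes
  invariance immediate.\<close>

definition boundary :: "(nat \<times> nat) set \<Rightarrow> (nat \<times> nat) set \<Rightarrow> int" where
  "boundary p x = (if fst ` x = fst ` p then 1 else 0) - (if fst ` x = snd ` p then 1 else 0)"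

text \<open>The pairs (i, 5) form a spanning star. The image of a combination of the points 1 to 4
  has at (i, 5) exactly the coefficient of i, so reading off these coefficients splits the embedding
  over the integers.\<close>

definition at5 :: "(nat \<times> nat) set \<Rightarrow> (nat \<times> nat) set \<Rightarrow> int" where
  "at5 x p = (if snd ` p = {5} \<and> fst ` x = fst ` p then 1 else 0)"

definition boundary_at5 :: "(nat \<times> nat) set \<Rightarrow> (nat \<times> nat) set \<Rightarrow> int" where
  "boundary_at5 p p' = (\<Sum>x\<in>X5. boundary p x * at5 x p')"

lemma sum_X20: "(\<Sum>p\<in>X20. f p) = sum_list (map (\<lambda>q. f {q}) pairs)"
proof -
  have "(\<Sum>p\<in>X20. f p) = (\<Sum>q\<in>set pairs. f {q})"
    unfolding X20_def by (subst sum.reindex) (auto simp: inj_on_def)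
  then show ?thesis using distinct_pairs by (simp add: sum.distinct_set_conv_list)
qed

lemma sum_X5: "(\<Sum>x\<in>X5. f x) = sum_list (map (\<lambda>i. f {(i, i)}) [1..<6])"
proof -
  have "(\<Sum>x\<in>X5. f x) = (\<Sum>i\<in>{1..5}. f {(i, i)})"
    unfolding X5_def by (subst sum.reindex) (auto simp: inj_on_def)
  also have "{1..5} = set [1..<6::nat]" by auto
  finally show ?thesis by (simp only: sum.distinct_set_conv_list distinct_upt)
qed

lemma X5_cases: "x \<in> X5 \<Longrightarrow> (\<And>i. i \<in> set [1..<6] \<Longrightarrow> x = {(i, i)} \<Longrightarrow> P) \<Longrightarrow> P"
  by (auto simp: X5_def simp del: upt_conv_Cons_Cons) 

lemma boundary_pair: "boundary {q} {(i, i)} = (if i = fst q then 1 else 0) - (if i = snd q then 1 else 0)"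
  by (simp add: boundary_def)

lemma at5_pair: "at5 {(i, i)} {q} = (if snd q = 5 \<and> i = fst q then 1 else 0)"
  by (simp add: at5_def)

text \<open>The right-hand side is the projection onto the span of the points 1 to 4 along the sum
  of all points: the point 5 goes to minus the sum of the other four.\<close>

lemma at5_boundary:
  assumes "x \<in> X5" "x' \<in> X5"
  shows "(\<Sum>p\<in>X20. at5 x p * boundary p x') = (if x = x' then 1 else 0) - (if x' = {(5, 5)} then 1 else 0)"
proof -
  have "\<forall>i\<in>set [1..<6]. \<forall>k\<in>set [1..<6].
    sum_list (map (\<lambda>q. (if snd q = 5 \<and> i = fst q then 1 else 0) *
      ((if k = fst q then 1 else 0) - (if k = snd q then 1 else 0))) pairs) =
    (if i = k then 1 else 0) - (if k = 5 then 1 else 0 :: int)" by code_simp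
  moreover have "{(i, i)} = {(k, k)} \<longleftrightarrow> i = k" for i k :: nat by auto
  ultimately show ?thesis using assms
    by (elim X5_cases) (simp only: sum_X20 boundary_pair at5_pair)
qed

text \<open>Each pair has one tail and one head. This lets the map on points descend to the quotient
  by the sum of all points.\<close>

lemma sum_boundary:
  assumes "p \<in> X20" shows "(\<Sum>x\<in>X5. boundary p x) = 0"
proof -
  have "\<forall>q\<in>set pairs. sum_list (map (\<lambda>k. (if k = fst q then 1 else 0) - (if k = snd q then 1 else 0)) [1..<6])
    = (0 :: int)" by code_simp
  then show ?thesis using assms unfolding X20_def sum_X5 by (auto simp only: boundary_pair)
qed

text \<open>At every point, a directed pentagon and a pair of opposite arcs have as many outgoing as
  incoming arcs. Hence these kernels vanish on the embedded Chevalley module.\<close>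

lemma balanced_boundary:
  assumes "y \<in> X12 \<union> X10" "x \<in> X5"
  shows "(\<Sum>p\<in>X20. (if p \<subseteq> y then 1 else 0) * boundary p x) = 0"
proof -
  have "\<forall>a\<in>set (arcs12 @ arcs10). \<forall>k\<in>set [1..<6].
    sum_list (map (\<lambda>q. (if q \<in> set a then 1 else 0) *
      ((if k = fst q then 1 else 0) - (if k = snd q then 1 else 0))) pairs) = (0 :: int)" by code_simp
  moreover obtain a where "a \<in> set (arcs12 @ arcs10)" "y = set a"
    using assms(1) by (auto simp: X12_def X10_def)
  ultimately show ?thesis using assms(2)
    by (elim X5_cases) (simp only: sum_X20 boundary_pair insert_subset empty_subsetI simp_thms)
qed

lemma boundary_at5_pair: "boundary_at5 {q} {q'} = sum_list (map (\<lambda>k. ((if k = fst q then 1 else 0) - (if k = snd q then 1 else 0)) *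
    (if snd q' = 5 \<and> k = fst q' then 1 else 0)) [1..<6])"
  unfolding boundary_at5_def sum_X5 boundary_pair at5_pair ..

lemma boundary_at5_Q16:
  assumes "p \<in> Q16" "p' \<in> Q16" shows "boundary_at5 p p' = 0"
proof -
  have "\<forall>q\<in>set (take 16 pairs). \<forall>q'\<in>set (take 16 pairs).
    sum_list (map (\<lambda>k. ((if k = fst q then 1 else 0) - (if k = snd q then 1 else 0)) *
      (if snd q' = 5 \<and> k = fst q' then 1 else 0)) [1..<6]) = (0 :: int)" by code_simp
  then show ?thesis using assms unfolding Q16_def by (auto simp only: boundary_at5_pair)
qed

lemma boundary_at5_not_Q16:
  assumes "p \<in> X20 - Q16" "p' \<in> X20" shows "boundary_at5 p p' = (if p = p' then 1 else 0)"
proof -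
  have "\<forall>q\<in>set (drop 16 pairs). \<forall>q'\<in>set pairs.
    sum_list (map (\<lambda>k. ((if k = fst q then 1 else 0) - (if k = snd q then 1 else 0)) *
      (if snd q' = 5 \<and> k = fst q' then 1 else 0)) [1..<6]) = (if q = q' then 1 else 0 :: int)" by code_simp
  moreover have "set pairs = set (take 16 pairs) \<union> set (drop 16 pairs)"
    by (metis append_take_drop_id set_append)
  then obtain q where "q \<in> set (drop 16 pairs)" "p = {q}" using assms(1) by (auto simp: X20_def Q16_def)
  moreover obtain q' where "q' \<in> set pairs" "p' = {q'}" using assms(2) by (auto simp: X20_def)
  moreover have "{q} = {q'} \<longleftrightarrow> q = q'" by auto
  ultimately show ?thesis by (simp only: boundary_at5_pair)
qed

text \<open>The rows of the idempotent 1 - A T that belong to the 16 basis pairs of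
  \<open>F\<close>, where A T is given by \<open>boundary_at5\<close>.\<close>

definition quot_mat :: "int mat" where
  "quot_mat = kernel_mat (\<lambda>p p'. (if p = p' then 1 else 0) - boundary_at5 p p') enum20 16 enum20 20"

definition sect_mat :: "int mat" where
  "sect_mat = kernel_mat (\<lambda>p p'. if p = p' then 1 else 0) enum20 20 enum20 16"

lemma Q16_subset: "Q16 \<subseteq> X20"
  unfolding Q16_def X20_def using set_take_subset by (rule image_mono)

lemma finite_X20: "finite X20" by (simp add: X20_def)

lemma kernel_mat_sect_mat:
  "kernel_mat k f n enum20 20 * sect_mat = kernel_mat k f n enum20 16"
  unfolding sect_mat_def kernel_mat_mult[OF bij_enum(1)]
proof (rule eq_matI)
  fix i j assume "i < dim_row (kernel_mat k f n enum20 16)" "j < dim_col (kernel_mat k f n enum20 16)"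
  then have ij: "i < n" "j < 16" by (simp_all add: kernel_mat_def)
  then have "enum20 j \<in> X20" using bij_enum(1) by (auto simp: bij_betw_def)
  moreover have "(\<Sum>y\<in>X20. k (f i) y * (if y = enum20 j then 1 else 0)) = (\<Sum>y\<in>X20. if y = enum20 j then k (f i) y else 0)"
    by (intro sum.cong) auto
  ultimately show "kernel_mat (\<lambda>z x. \<Sum>y\<in>X20. k z y * (if y = x then 1 else 0)) f n enum20 16 $$ (i, j)
      = kernel_mat k f n enum20 16 $$ (i, j)"
    using ij finite_X20 by (simp add: kernel_mat_def)
qed (simp_all add: kernel_mat_def)

lemma quot_mat_sect_mat: "quot_mat * sect_mat = 1\<^sub>m 16"
  unfolding quot_mat_def kernel_mat_sect_mat kernel_mat_one[OF bij_enum(5), symmetric]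
  by (rule kernel_mat_cong[OF bij_enum(5) bij_enum(5)]) (simp add: boundary_at5_Q16)

text \<open>In the rows of pairs ending in 5 the first summand is already the identity and the
  second is zero; in the other rows \<open>quot_mat\<close> is the complement by definition.\<close>

lemma boundary_sect_mat_quot_mat: "kernel_mat boundary_at5 enum20 20 enum20 20 + sect_mat * quot_mat = 1\<^sub>m 20"
proof (rule eq_matI)
  fix i j assume "i < dim_row (1\<^sub>m 20 :: int mat)" "j < dim_col (1\<^sub>m 20 :: int mat)"
  then have ij: "i < 20" "j < 20" by simp_all
  then have X: "enum20 i \<in> X20" "enum20 j \<in> X20" using bij_enum(1) by (auto simp: bij_betw_def)
  have inj: "enum20 i = enum20 j \<longleftrightarrow> i = j" using bij_enum(1) ij by (auto simp: bij_betw_def inj_on_def)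
  let ?b = "\<lambda>p p'. (if p = p' then 1 else 0) - boundary_at5 p p'"
  have "sect_mat * quot_mat = kernel_mat (\<lambda>z x. \<Sum>y\<in>Q16. (if z = y then 1 else 0) * ?b y x) enum20 20 enum20 20"
    unfolding sect_mat_def quot_mat_def by (rule kernel_mat_mult[OF bij_enum(5)])
  moreover have "(\<Sum>y\<in>Q16. (if enum20 i = y then 1 else 0) * ?b y (enum20 j)) =
      (\<Sum>y\<in>Q16. if enum20 i = y then ?b y (enum20 j) else 0)" by (intro sum.cong) auto
  moreover have "finite Q16" using Q16_subset finite_X20 by (rule finite_subset)
  ultimately have "(sect_mat * quot_mat) $$ (i, j) = (if enum20 i \<in> Q16 then ?b (enum20 i) (enum20 j) else 0)"
    using ij by (simp add: kernel_mat_def)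
  moreover have "(kernel_mat boundary_at5 enum20 20 enum20 20 + sect_mat * quot_mat) $$ (i, j) =
      kernel_mat boundary_at5 enum20 20 enum20 20 $$ (i, j) + (sect_mat * quot_mat) $$ (i, j)"
    using ij by (intro index_add_mat) (simp_all add: sect_mat_def quot_mat_def kernel_mat_def)
  ultimately show "(kernel_mat boundary_at5 enum20 20 enum20 20 + sect_mat * quot_mat) $$ (i, j) = 1\<^sub>m 20 $$ (i, j)"
    using ij X boundary_at5_not_Q16[of "enum20 i" "enum20 j"] inj by (cases "i = j") (simp_all add: kernel_mat_def)
qed (simp_all add: kernel_mat_def sect_mat_def quot_mat_def)

lemma quot_mat_carrier: "quot_mat \<in> carrier_mat 16 20" and sect_mat_carrier: "sect_mat \<in> carrier_mat 20 16"
  by (simp_all add: quot_mat_def sect_mat_def)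

lemma rel_act_inj:
  assumes g: "g \<in> carrier A5"
  shows "rel_act g r \<subseteq> rel_act g s \<longleftrightarrow> r \<subseteq> s"
  and "fst ` rel_act g r = fst ` rel_act g s \<longleftrightarrow> fst ` r = fst ` s"
  and "fst ` rel_act g r = snd ` rel_act g s \<longleftrightarrow> fst ` r = snd ` s"
proof -
  have inj: "inj g" using A5_bij[OF g] by (simp add: bij_def)
  then show "rel_act g r \<subseteq> rel_act g s \<longleftrightarrow> r \<subseteq> s"
    unfolding rel_act_def by (intro inj_image_subset_iff prod.inj_map)
  have "fst ` rel_act g t = g ` fst ` t" "snd ` rel_act g t = g ` snd ` t" for t
    by (simp_all add: rel_act_def image_image)
  then show "fst ` rel_act g r = fst ` rel_act g s \<longleftrightarrow> fst ` r = fst ` s"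
    "fst ` rel_act g r = snd ` rel_act g s \<longleftrightarrow> fst ` r = snd ` s"
    by (simp_all add: inj_image_eq_iff[OF inj])
qed

lemma coset_lattice_point_stabilizer:
  assumes H: "subgroup H A5" and card: "card H = 12" and \<kappa>: "coset_lattice A5 H m \<kappa>"
  obtains e where "bij_betw e {..<m} X5" "\<And>g. g \<in> carrier A5 \<Longrightarrow> \<kappa> g = perm_rep rel_act e m g"
proof -
  obtain r where r: "r \<in> X5" "\<And>g. g \<in> H \<Longrightarrow> rel_act g r = r"
    by (rule order12_fixes_point[OF H card]) blast
  have "card H * card X5 = 60" by (simp add: card card_X)
  from coset_lattice_A5[OF orbit_X5 r(1) H r(2) this \<kappa>] that show thesis by blast
qed

text \<open>\<open>D\<close> is onto and A' = (A' U) D, so equivariance of \<open>A'\<close> and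
  \<open>D\<close> passes to the factor A' U, although the section \<open>U\<close> is not
  equivariant itself.\<close>

lemma ghom_factor_quotient:
  fixes A' D U :: "int mat"
  assumes \<kappa>: "glattice G m \<kappa>" and \<rho>: "glattice G n \<rho>" and \<pi>: "glattice G p \<pi>"
    and D: "ghom G m \<kappa> n \<rho> D" and A: "ghom G m \<kappa> p \<pi> A'" and U: "U \<in> carrier_mat m n"
    and DU: "D * U = 1\<^sub>m n" and AUD: "A' * (U * D) = A'"
  shows "ghom G n \<rho> p \<pi> (A' * U)"
  unfolding ghom_def
proof (intro conjI ballI)
  have cD: "D \<in> carrier_mat n m" and cA: "A' \<in> carrier_mat p m" using D A by (auto dest: ghom_carrier)
  show "A' * U \<in> carrier_mat p n" using cA U by simp
  fix g assume g: "g \<in> carrier G"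
  note c = glattice_carrier[OF \<kappa> g] glattice_carrier[OF \<rho> g] glattice_carrier[OF \<pi> g]
  have cAU: "A' * U \<in> carrier_mat p n" using cA U by simp
  have "A' * U * \<rho> g = A' * U * (\<rho> g * (D * U))" using c by (simp add: DU)
  also have "\<rho> g * (D * U) = (\<rho> g * D) * U" by (rule assoc_mult_mat[OF c(2) cD U, symmetric])
  also have "\<rho> g * D = D * \<kappa> g" using D g by (simp add: ghom_def)
  also have "D * \<kappa> g * U = D * (\<kappa> g * U)" by (rule assoc_mult_mat[OF cD c(1) U])
  also have "A' * U * (D * (\<kappa> g * U)) = (A' * U * D) * (\<kappa> g * U)"
    by (rule assoc_mult_mat[OF cAU cD mult_carrier_mat[OF c(1) U], symmetric])
  also have "A' * U * D = A'" unfolding assoc_mult_mat[OF cA U cD] by (rule AUD)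
  also have "A' * (\<kappa> g * U) = (A' * \<kappa> g) * U" by (rule assoc_mult_mat[OF cA c(1) U, symmetric])
  also have "A' * \<kappa> g = \<pi> g * A'" using A g by (simp add: ghom_def)
  also have "\<pi> g * A' * U = \<pi> g * (A' * U)" by (rule assoc_mult_mat[OF c(3) cA U])
  finally show "A' * U * \<rho> g = \<pi> g * (A' * U)" .
qed

text \<open>Let A' be the matrix of \<open>boundary\<close> and T' that of \<open>at5\<close>. Then
  A = A' U and T = D T' have the required properties because U D = T' A': T A becomes D U D U = 1,
  and A T becomes A' U D T' = A' T'. The last conclusion is the criterion by which a kernel on pairs
  factors through the cokernel.\<close>

lemma chevalley_embedding:
  assumes J: "chevalley_module A5 H n \<rho>" and H: "subgroup H A5" and card: "card H = 12"
  obtains A T where "glattice A5 n \<rho>" "ghom A5 n \<rho> 20 (perm_rep rel_act enum20 20) A"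
    "T \<in> carrier_mat n 20" "T * A = 1\<^sub>m n" "A * T = kernel_mat boundary_at5 enum20 20 enum20 20"
    "\<And>k f l (Y :: 'y set). bij_betw f {..<l} Y \<Longrightarrow> (\<And>y x. y \<in> Y \<Longrightarrow> x \<in> X5 \<Longrightarrow> (\<Sum>p\<in>X20. k y p * boundary p x) = 0) \<Longrightarrow>
      kernel_mat k f l enum20 20 * A = 0\<^sub>m l n"
proof -
  have tr: "transpose_mat (\<kappa> (inv\<^bsub>A5\<^esub> g)) = \<kappa> g"
    if \<kappa>: "coset_lattice A5 H m \<kappa>" and g: "g \<in> carrier A5" for m \<kappa> g
  proof -
    obtain e where e: "bij_betw e {..<m} X5" "\<And>g. g \<in> carrier A5 \<Longrightarrow> \<kappa> g = perm_rep rel_act e m g"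
      by (rule coset_lattice_point_stabilizer[OF H card \<kappa>]) blast
    show ?thesis using X5.transpose_perm_rep[OF e(1) g] e(2) g by simp
  qed
  obtain m \<kappa> D where \<kappa>: "coset_lattice A5 H m \<kappa>" and \<rho>: "glattice A5 n \<rho>" and D: "ghom A5 m \<kappa> n \<rho> D"
    and U_ex: "\<And>i0. i0 < m \<Longrightarrow> \<exists>U\<in>carrier_mat m n. D * U = 1\<^sub>m n \<and>
      U * D = mat m m (\<lambda>(i, j). (if i = j then 1 else 0) - (if j = i0 then 1 else 0))"
    by (rule chevalley_module_quotient[OF alt_group_is_group J]) (rule tr, assumption+, blast)
  obtain e where e: "bij_betw e {..<m} X5" "\<And>g. g \<in> carrier A5 \<Longrightarrow> \<kappa> g = perm_rep rel_act e m g"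
    by (rule coset_lattice_point_stabilizer[OF H card \<kappa>]) blast
  \<comment> \<open>The base point of the section is put at 5, which makes \<open>U * D\<close> the
    projection computed in \<open>at5_boundary\<close>.\<close>
  have "{(5, 5)} \<in> e ` {..<m}" unfolding bij_betw_imp_surj_on[OF e(1)] by (simp add: X5_def)
  then obtain i0 where i0: "i0 < m" "e i0 = {(5, 5)}" by (metis imageE lessThan_iff)
  obtain U where U: "U \<in> carrier_mat m n" "D * U = 1\<^sub>m n"
    and UD: "U * D = mat m m (\<lambda>(i, j). (if i = j then 1 else 0) - (if j = i0 then 1 else 0))"
    using U_ex[OF i0(1)] by blast
  let ?N = "kernel_mat (\<lambda>x x'. (if x = x' then 1 else 0) - (if x' = {(5, 5)} then 1 else 0)) e m e m"
  let ?A = "kernel_mat boundary enum20 20 e m" and ?T = "kernel_mat at5 e m enum20 20"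
  have "U * D = ?N"
    unfolding UD i0(2)[symmetric] using e(1) i0(1)
    by (auto simp: kernel_mat_def bij_betw_def inj_on_def intro!: eq_matI)
  moreover have TA: "?T * ?A = ?N"
    unfolding kernel_mat_mult[OF bij_enum(1)] by (rule kernel_mat_cong[OF e(1) e(1)]) (rule at5_boundary)
  moreover have AN: "?A * ?N = ?A"
    unfolding kernel_mat_mult[OF e(1)]
  proof (rule kernel_mat_cong[OF bij_enum(1) e(1)])
    fix p x' assume p: "p \<in> X20" and x': "x' \<in> X5"
    have "(\<Sum>x\<in>X5. boundary p x * ((if x = x' then 1 else 0) - (if x' = {(5, 5)} then 1 else 0)))
      = (\<Sum>x\<in>X5. (if x = x' then boundary p x else 0) - (if x' = {(5, 5)} then 1 else 0) * boundary p x)"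
      by (intro sum.cong) auto
    also have "\<dots> = boundary p x' - (if x' = {(5, 5)} then 1 else 0) * (\<Sum>x\<in>X5. boundary p x)"
      using x' X5.finite_set by (simp add: sum_subtractf sum_distrib_left)
    finally show "(\<Sum>x\<in>X5. boundary p x * ((if x = x' then 1 else 0) - (if x' = {(5, 5)} then 1 else 0))) = boundary p x'"
      using sum_boundary[OF p] by simp
  qed
  ultimately have UD_TA: "U * D = ?T * ?A" and AUD: "?A * (U * D) = ?A" by simp_all
  have cD: "D \<in> carrier_mat n m" using D by (rule ghom_carrier)
  have cA: "?A \<in> carrier_mat 20 m" and cT: "?T \<in> carrier_mat m 20" by simp_all
  have \<kappa>': "glattice A5 m (perm_rep rel_act e m)" by (rule X5.glattice_perm_rep[OF e(1)])
  have D': "ghom A5 m (perm_rep rel_act e m) n \<rho> D" using D e(2) by (simp add: ghom_def)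
  have "ghom A5 m (perm_rep rel_act e m) 20 (perm_rep rel_act enum20 20) ?A"
    by (rule X5.ghom_kernel_mat[OF invariant_X(2) e(1) bij_enum(1)]) (simp add: boundary_def rel_act_inj)
  from ghom_factor_quotient[OF \<kappa>' \<rho> X20.glattice_perm_rep[OF bij_enum(1)] D' this U AUD]
  have "ghom A5 n \<rho> 20 (perm_rep rel_act enum20 20) (?A * U)" .
  moreover have "D * ?T \<in> carrier_mat n 20" using cD by simp
  moreover have "(D * ?T) * (?A * U) = 1\<^sub>m n"
  proof -
    have "(D * ?T) * (?A * U) = D * (?T * (?A * U))"
      by (rule assoc_mult_mat[OF cD cT mult_carrier_mat[OF cA U(1)]])
    also have "?T * (?A * U) = U * D * U" unfolding UD_TA by (rule assoc_mult_mat[OF cT cA U(1), symmetric])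
    also have "U * D * U = U" using U(1) unfolding assoc_mult_mat[OF U(1) cD U(1)] U(2) by simp
    finally show ?thesis using U(2) by simp
  qed
  moreover have "(?A * U) * (D * ?T) = kernel_mat boundary_at5 enum20 20 enum20 20"
  proof -
    have "(?A * U) * (D * ?T) = ?A * (U * (D * ?T))"
      by (rule assoc_mult_mat[OF cA U(1) mult_carrier_mat[OF cD cT]])
    also have "U * (D * ?T) = U * D * ?T" by (rule assoc_mult_mat[OF U(1) cD cT, symmetric])
    also have "?A * (U * D * ?T) = ?A * (U * D) * ?T"
      by (rule assoc_mult_mat[OF cA mult_carrier_mat[OF U(1) cD] cT, symmetric])
    finally show ?thesis
      unfolding AUD kernel_mat_mult[OF e(1)] boundary_at5_def[abs_def] .
  qed
  moreover have "kernel_mat k f l enum20 20 * (?A * U) = 0\<^sub>m l n"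
    if f: "bij_betw f {..<l} Y" and k: "\<And>y x. y \<in> Y \<Longrightarrow> x \<in> X5 \<Longrightarrow> (\<Sum>p\<in>X20. k y p * boundary p x) = 0" for k f l Y
  proof -
    have "kernel_mat k f l enum20 20 * (?A * U) = kernel_mat k f l enum20 20 * ?A * U"
      by (rule assoc_mult_mat[OF kernel_mat_carrier cA U(1), symmetric])
    also have "kernel_mat k f l enum20 20 * ?A = kernel_mat (\<lambda>_ _. 0) f l e m"
      unfolding kernel_mat_mult[OF bij_enum(1)] by (rule kernel_mat_cong[OF f e(1)]) (rule k)
    also have "\<dots> = 0\<^sub>m l m" by (auto simp: kernel_mat_def)
    finally show ?thesis using U(1) by simp
  qed
  ultimately show thesis using that[OF \<rho>] by blast
qed

section \<open>The permutation lattices and the unimodular matrix\<close>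

abbreviation "perm20 \<equiv> perm_rep rel_act enum20 20"
abbreviation "perm12 \<equiv> perm_rep rel_act enum12 12"
abbreviation "perm10 \<equiv> perm_rep rel_act enum10 10"
abbreviation "perm6 \<equiv> perm_rep rel_act enum6 6"

lemma glattice_perm:
  "glattice A5 20 perm20" "glattice A5 12 perm12" "glattice A5 10 perm10" "glattice A5 6 perm6"
  by (intro X20.glattice_perm_rep X12.glattice_perm_rep X10.glattice_perm_rep X6.glattice_perm_rep bij_enum)+

text \<open>\<open>perm_sum\<close> always ends in the lattice of rank 0, which has to be
  absorbed.\<close>

lemma dsum_zero:
  assumes "\<rho> g \<in> carrier_mat n n"
  shows "dsum n \<rho> 0 (\<lambda>g. 1\<^sub>m 0) g = \<rho> g"
  using assms by (auto simp: dsum_def four_block_mat_def Let_def intro!: eq_matI)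

lemma permutation_lattice_coset_lattice:
  assumes "coset_lattice G H n \<rho>" "glattice G n \<rho>"
  shows "permutation_lattice G n \<rho>"
  unfolding permutation_lattice_def
proof (intro conjI exI)
  show "glattice G n \<rho>" by fact
  show "perm_sum G (n + 0) (dsum n \<rho> 0 (\<lambda>g. 1\<^sub>m 0))"
    by (rule perm_sum_step[OF assms(1) perm_sum_zero])
  have "giso G n \<rho> n \<rho>" by (rule giso_refl[OF assms(2)])
  then show "giso G n \<rho> (n + 0) (dsum n \<rho> 0 (\<lambda>g. 1\<^sub>m 0))"
    using assms(2) by (subst giso_cong[of G \<rho> \<rho> _ \<rho>]) (auto simp: dsum_zero dest: glattice_carrier)
qed

lemma permutation_lattice_dsum:
  assumes "group G" and \<rho>: "coset_lattice G H m \<rho>" "glattice G m \<rho>" and \<sigma>: "coset_lattice G K n \<sigma>" "glattice G n \<sigma>"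
  shows "permutation_lattice G (m + n) (dsum m \<rho> n \<sigma>)"
  unfolding permutation_lattice_def
proof (intro conjI exI)
  have l: "glattice G (m + n) (dsum m \<rho> n \<sigma>)" using assms by (intro glattice_dsum)
  then show "glattice G (m + n) (dsum m \<rho> n \<sigma>)" .
  show "perm_sum G (m + (n + 0)) (dsum m \<rho> (n + 0) (dsum n \<sigma> 0 (\<lambda>g. 1\<^sub>m 0)))"
    by (rule perm_sum_step[OF \<rho>(1) perm_sum_step[OF \<sigma>(1) perm_sum_zero]])
  have "dsum m \<rho> (n + 0) (dsum n \<sigma> 0 (\<lambda>g. 1\<^sub>m 0)) g = dsum m \<rho> n \<sigma> g" if "g \<in> carrier G" for g
    using dsum_zero[of \<sigma> g n, OF glattice_carrier[OF \<sigma>(2) that]] unfolding dsum_def[of m \<rho>] by simp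
  then show "giso G (m + n) (dsum m \<rho> n \<sigma>) (m + (n + 0)) (dsum m \<rho> (n + 0) (dsum n \<sigma> 0 (\<lambda>g. 1\<^sub>m 0)))"
    using giso_refl[OF l] by (subst giso_cong[of G _ "dsum m \<rho> n \<sigma>" _ "dsum m \<rho> n \<sigma>"]) simp_all
qed

lemma coset_lattice_perm:
  "coset_lattice A5 (stabilizer A5 rel_act {(1, 2)}) 20 perm20"
  "coset_lattice A5 (stabilizer A5 rel_act pentagon) 12 perm12"
  "coset_lattice A5 (stabilizer A5 rel_act {(1, 2), (2, 1)}) 10 perm10"
  "coset_lattice A5 (stabilizer A5 rel_act (pentagon \<union> pentagon\<inverse>)) 6 perm6"
  using bij_enum unfolding orbit_X20[symmetric] orbit_X12[symmetric] orbit_X10[symmetric] orbit_X6[symmetric]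
  by (auto intro!: A5.coset_lattice_perm_rep)

definition iso_mat :: "int mat" where
  "iso_mat = mat 22 22 (\<lambda>(i, j). iso_rows ! i ! j)"

definition iso_inv :: "int mat" where
  "iso_inv = mat 22 22 (\<lambda>(i, j). iso_inverse_cols ! j ! i)"

lemma iso_mat_inv: "iso_mat * iso_inv = 1\<^sub>m 22"
proof (rule eq_matI)
  fix i j assume "i < dim_row (1\<^sub>m 22 :: int mat)" "j < dim_col (1\<^sub>m 22 :: int mat)"
  then have ij: "i < 22" "j < 22" by simp_all
  have len: "length (iso_rows ! i) = 22" "length (iso_inverse_cols ! j) = 22"
    using ij lengths(7-10) nth_mem[of i iso_rows] nth_mem[of j iso_inverse_cols] by auto
  have "(iso_mat * iso_inv) $$ (i, j) = (\<Sum>k = 0..<22. iso_rows ! i ! k * iso_inverse_cols ! j ! k)"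
    using ij by (simp add: iso_mat_def iso_inv_def scalar_prod_def)
  also have "\<dots> = sum_list (map2 (*) (iso_rows ! i) (iso_inverse_cols ! j))"
    using len by (simp add: sum_list_sum_nth)
  also have "\<dots> = map (\<lambda>r. map (\<lambda>c. sum_list (map2 (*) r c)) iso_inverse_cols) iso_rows ! i ! j"
    using ij by (simp add: lengths)
  also have "\<dots> = 1\<^sub>m 22 $$ (i, j)" unfolding iso_rows_inverse using ij by simp
  finally show "(iso_mat * iso_inv) $$ (i, j) = 1\<^sub>m 22 $$ (i, j)" .
qed (simp_all add: iso_mat_def iso_inv_def)

text \<open>Over the rationals a one-sided inverse of a square matrix is two-sided, and the
  embedding of the integers is injective; so evaluating one product is enough.\<close>

lemma int_mat_left_inverse:
  fixes A B :: "int mat"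
  assumes A: "A \<in> carrier_mat n n" and B: "B \<in> carrier_mat n n" and AB: "A * B = 1\<^sub>m n"
  shows "B * A = 1\<^sub>m n"
proof -
  let ?r = "map_mat (of_int :: int \<Rightarrow> rat)"
  have "?r A * ?r B = 1\<^sub>m n"
    using of_int_hom.mat_hom_mult[OF A B] AB of_int_hom.mat_hom_one by metis
  then have "?r B * ?r A = 1\<^sub>m n"
    using A B by (intro mat_mult_left_right_inverse[of "?r A" n "?r B"]) simp_all
  then have "?r (B * A) = ?r (1\<^sub>m n)"
    using of_int_hom.mat_hom_mult[OF B A] of_int_hom.mat_hom_one by metis
  then show ?thesis by (rule of_int_hom.mat_hom_inj)
qed

lemma iso_inv_mat: "iso_inv * iso_mat = 1\<^sub>m 22"
  by (rule int_mat_left_inverse[OF _ _ iso_mat_inv]) (simp_all add: iso_mat_def iso_inv_def)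

text \<open>The inverse is verified on the table of numbers, equivariance on the kernels; this
  identification joins the two.\<close>

lemma iso_mat_blocks:
  "iso_mat = four_block_mat
     (kernel_mat (\<lambda>c x. if c \<subseteq> x then 2 else 1) enum12 12 enum6 6)
     (kernel_mat (\<lambda>y p. if p \<subseteq> y then 1 else 0) enum12 12 enum20 16)
     (kernel_mat (\<lambda>s x. if s \<subseteq> x then 1 else 0) enum10 10 enum6 6)
     (kernel_mat (\<lambda>y p. if p \<subseteq> y then 1 else 0) enum10 10 enum20 16)" (is "_ = ?B")
proof (rule eq_matI)
  fix i j assume "i < dim_row ?B" "j < dim_col ?B"
  then have ij: "i < 22" "j < 22" by (simp_all add: kernel_mat_def)
  then show "iso_mat $$ (i, j) = ?B $$ (i, j)"
    by (auto simp: iso_mat_def kernel_mat_def iso_rows_def nth_append lengths enum20_def enum12_def enum10_def enum6_def)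
qed (simp_all add: iso_mat_def kernel_mat_def)

theorem theorem1p3:
  fixes H :: "(nat \<Rightarrow> nat) set"
  assumes "subgroup H (alt_group 5)"
      and "(alt_group 5)\<lparr>carrier := H\<rparr> \<cong> alt_group 4"
  shows "\<forall>nJ \<rho>J. chevalley_module (alt_group 5) H nJ \<rho>J \<longrightarrow>
     (\<exists>nP \<rho>P \<rho>F A B.
        flabby_resolution (alt_group 5) nJ \<rho>J nP \<rho>P 16 \<rho>F A B \<and>
        (\<forall>C S D nC \<rho>C nS \<rho>S nD \<rho>D.
           subgroup C (alt_group 5) \<and> (alt_group 5)\<lparr>carrier := C\<rparr> \<cong> integer_mod_group 5 \<and>
           subgroup S (alt_group 5) \<and> (alt_group 5)\<lparr>carrier := S\<rparr> \<cong> sym_group 3 \<and>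
           subgroup D (alt_group 5) \<and> (alt_group 5)\<lparr>carrier := D\<rparr> \<cong> dihedral_group 5 \<and>
           coset_lattice (alt_group 5) C nC \<rho>C \<and> coset_lattice (alt_group 5) S nS \<rho>S \<and>
           coset_lattice (alt_group 5) D nD \<rho>D \<longrightarrow>
           nC + nS = 22 \<and> nD + 16 = 22 \<and>
           giso (alt_group 5) (nC + nS) (dsum nC \<rho>C nS \<rho>S) (nD + 16) (dsum nD \<rho>D 16 \<rho>F)) \<and>
        stably_permutation (alt_group 5) 16 \<rho>F)"
proof (intro allI impI)
  fix nJ \<rho>J assume J: "chevalley_module A5 H nJ \<rho>J"
  have "2 * card H = 24"
    using iso_same_card[OF assms(2)] alt_group_card_carrier[of 4] by (simp add: fact_numeral)
  then have cardH: "card H = 12" by simp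
  obtain A T where \<rho>J: "glattice A5 nJ \<rho>J" and A: "ghom A5 nJ \<rho>J 20 perm20 A"
    and T: "T \<in> carrier_mat nJ 20" "T * A = 1\<^sub>m nJ" and AT: "A * T = kernel_mat boundary_at5 enum20 20 enum20 20"
    and kill: "\<And>k f l (Y :: (nat \<times> nat) set set). bij_betw f {..<l} Y \<Longrightarrow>
      (\<And>y x. y \<in> Y \<Longrightarrow> x \<in> X5 \<Longrightarrow> (\<Sum>p\<in>X20. k y p * boundary p x) = 0) \<Longrightarrow>
      kernel_mat k f l enum20 20 * A = 0\<^sub>m l nJ"
    by (rule chevalley_embedding[OF J assms(1) cardH]) blast
  have cA: "A \<in> carrier_mat 20 nJ" using A by (rule ghom_carrier)
  have id: "A * T + sect_mat * quot_mat = 1\<^sub>m 20" unfolding AT by (rule boundary_sect_mat_quot_mat)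
  define \<rho>F where "\<rho>F = (\<lambda>g. quot_mat * perm20 g * sect_mat)"
  note quot = split_quotient_lattice[OF alt_group_is_group \<rho>J glattice_perm(1) A T(1) quot_mat_carrier sect_mat_carrier
      T(2) quot_mat_sect_mat id, folded \<rho>F_def]
  note F = quot(1)
  \<comment> \<open>Keeping the first 16 columns of a kernel is composing it with
    \<open>sect_mat\<close>, so the universal property of the cokernel applies.\<close>
  have inc: "ghom A5 16 \<rho>F 12 perm12 (kernel_mat (\<lambda>y p. if p \<subseteq> y then 1 else 0) enum12 12 enum20 16)"
    "ghom A5 16 \<rho>F 10 perm10 (kernel_mat (\<lambda>y p. if p \<subseteq> y then 1 else 0) enum10 10 enum20 16)"
    unfolding kernel_mat_sect_mat[symmetric]
    by (intro quot(3) glattice_perm X20.ghom_kernel_mat[OF invariant_X(4) bij_enum(1) bij_enum(2)]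
          kill[OF bij_enum(2)] balanced_boundary; simp add: rel_act_inj)
       (intro quot(3) glattice_perm X20.ghom_kernel_mat[OF invariant_X(3) bij_enum(1) bij_enum(3)]
          kill[OF bij_enum(3)] balanced_boundary; simp add: rel_act_inj)
  have M: "ghom A5 (6 + 16) (dsum 6 perm6 16 \<rho>F) (12 + 10) (dsum 12 perm12 10 perm10) iso_mat"
    unfolding iso_mat_blocks
    by (intro ghom_four_block glattice_perm F inc X6.ghom_kernel_mat[OF invariant_X(4) bij_enum(4) bij_enum(2)]
        X6.ghom_kernel_mat[OF invariant_X(3) bij_enum(4) bij_enum(3)]) (simp_all add: rel_act_inj)
  have cM: "iso_mat \<in> carrier_mat (12 + 10) (6 + 16)" "iso_inv \<in> carrier_mat (6 + 16) (12 + 10)"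
    by (simp_all add: iso_mat_def iso_inv_def)
  have MW: "iso_inv * iso_mat = 1\<^sub>m (6 + 16)" "iso_mat * iso_inv = 1\<^sub>m (12 + 10)"
    by (simp_all add: iso_mat_inv iso_inv_mat)
  note l1 = glattice_dsum[OF glattice_perm(4) F alt_group_is_group]
  note l2 = glattice_dsum[OF glattice_perm(2,3) alt_group_is_group]
  note W = ghom_inverse[OF l1 l2 M cM(2) MW]
  have iso: "giso A5 (6 + 16) (dsum 6 perm6 16 \<rho>F) (12 + 10) (dsum 12 perm12 10 perm10)"
    unfolding giso_def using M cM(2) MW by blast
  have "tate_minus1_vanishes A5 K 16 \<rho>F" if K: "subgroup K A5" for K
  proof -
    have KG: "K \<subseteq> carrier A5" by (rule subgroup.subset[OF K])
    have "tate_minus1_vanishes A5 K 12 perm12" "tate_minus1_vanishes A5 K 10 perm10"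
      using X12.flabby_perm_rep[OF bij_enum(2) finite_A5] X10.flabby_perm_rep[OF bij_enum(3) finite_A5] K
      by (simp_all add: flabby_def)
    then have "tate_minus1_vanishes A5 K (12 + 10) (dsum 12 perm12 10 perm10)"
      by (rule tate_minus1_vanishes_dsum[OF glattice_perm(2,3) KG])
    then have "tate_minus1_vanishes A5 K (6 + 16) (dsum 6 perm6 16 \<rho>F)"
      by (rule tate_minus1_vanishes_retract[OF l1 l2 KG M W MW(1)])
    then show ?thesis by (rule tate_minus1_vanishes_dsumD[OF glattice_perm(4) F KG])
  qed
  then have "flabby A5 16 \<rho>F" using F by (simp add: flabby_def)
  then have res: "flabby_resolution A5 nJ \<rho>J 20 perm20 16 \<rho>F A quot_mat"
    unfolding flabby_resolution_def
    using \<rho>J quot(2) permutation_lattice_coset_lattice[OF coset_lattice_perm(1) glattice_perm(1)] by blast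
  have stab: "stably_permutation A5 16 \<rho>F"
    unfolding stably_permutation_def
  proof (intro conjI F exI)
    show "permutation_lattice A5 6 perm6"
      by (rule permutation_lattice_coset_lattice[OF coset_lattice_perm(4) glattice_perm(4)])
    show "permutation_lattice A5 (12 + 10) (dsum 12 perm12 10 perm10)"
      by (rule permutation_lattice_dsum[OF alt_group_is_group coset_lattice_perm(2) glattice_perm(2)
            coset_lattice_perm(3) glattice_perm(3)])
    show "giso A5 (16 + 6) (dsum 16 \<rho>F 6 perm6) (12 + 10) (dsum 12 perm12 10 perm10)"
      by (rule giso_trans[OF glattice_dsum[OF F glattice_perm(4) alt_group_is_group] l1 l2
            giso_dsum_swap[OF F glattice_perm(4)] iso])
  qed
  have cosets: "nC + nS = 22 \<and> nD + 16 = 22 \<and>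
      giso A5 (nC + nS) (dsum nC \<rho>C nS \<rho>S) (nD + 16) (dsum nD \<rho>D 16 \<rho>F)"
    if C: "subgroup C A5" "A5\<lparr>carrier := C\<rparr> \<cong> integer_mod_group 5"
      and S: "subgroup S A5" "A5\<lparr>carrier := S\<rparr> \<cong> sym_group 3"
      and D: "subgroup D A5" "A5\<lparr>carrier := D\<rparr> \<cong> dihedral_group 5"
      and \<rho>C: "coset_lattice A5 C nC \<rho>C" and \<rho>S: "coset_lattice A5 S nS \<rho>S" and \<rho>D: "coset_lattice A5 D nD \<rho>D"
    for C S D nC \<rho>C nS \<rho>S nD \<rho>D
  proof -
    obtain rC where rC: "rC \<in> X12" "\<And>g. g \<in> C \<Longrightarrow> rel_act g rC = rC" "card C = 5"
      by (rule cyclic5_fixes_pentagon[OF C]) blast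
    have "card C * card X12 = 60" by (simp add: rC(3) card_X)
    then obtain eC where eC: "bij_betw eC {..<nC} X12"
      "\<And>g. g \<in> carrier A5 \<Longrightarrow> \<rho>C g = perm_rep rel_act eC nC g"
      using coset_lattice_A5[OF orbit_X12 rC(1) C(1) rC(2) _ \<rho>C] by blast
    have "card S = 6"
      using iso_same_card[OF S(2)] sym_group_card_carrier[of 3] by (simp add: fact_numeral)
    then obtain rS where rS: "rS \<in> X10" "\<And>g. g \<in> S \<Longrightarrow> rel_act g rS = rS"
      by (rule order6_fixes_pair[OF S(1)]) blast
    have "card S * card X10 = 60" by (simp add: \<open>card S = 6\<close> card_X)
    then obtain eS where eS: "bij_betw eS {..<nS} X10"
      "\<And>g. g \<in> carrier A5 \<Longrightarrow> \<rho>S g = perm_rep rel_act eS nS g"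
      using coset_lattice_A5[OF orbit_X10 rS(1) S(1) rS(2) _ \<rho>S] by blast
    obtain rD where rD: "rD \<in> X6" "\<And>g. g \<in> D \<Longrightarrow> rel_act g rD = rD" "card D = 10"
      by (rule dihedral5_fixes_pentagon[OF D]) blast
    have "card D * card X6 = 60" by (simp add: rD(3) card_X)
    then obtain eD where eD: "bij_betw eD {..<nD} X6"
      "\<And>g. g \<in> carrier A5 \<Longrightarrow> \<rho>D g = perm_rep rel_act eD nD g"
      using coset_lattice_A5[OF orbit_X6 rD(1) D(1) rD(2) _ \<rho>D] by blast
    let ?C = "perm_rep rel_act eC nC" and ?S = "perm_rep rel_act eS nS" and ?D = "perm_rep rel_act eD nD"
    have n: "nC = 12" "nS = 10" "nD = 6"
      using bij_betw_card_lessThan[OF eC(1)] bij_betw_card_lessThan[OF eS(1)]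
        bij_betw_card_lessThan[OF eD(1)] by (simp_all add: card_X)
    have gC: "glattice A5 nC ?C" and gS: "glattice A5 nS ?S" and gD: "glattice A5 nD ?D"
      using X12.glattice_perm_rep[OF eC(1)] X10.glattice_perm_rep[OF eS(1)] X6.glattice_perm_rep[OF eD(1)] .
    note l3 = glattice_dsum[OF gC gS alt_group_is_group] and l4 = glattice_dsum[OF gD F alt_group_is_group]
    \<comment> \<open>The given realisations are exchanged for the enumerated ones on both sides,
      with the fixed isomorphism, inverted, in between.\<close>
    have "giso A5 (nC + nS) (dsum nC ?C nS ?S) (12 + 10) (dsum 12 perm12 10 perm10)"
      by (intro giso_dsum gC gS glattice_perm X12.giso_perm_rep[OF eC(1) bij_enum(2)]
          X10.giso_perm_rep[OF eS(1) bij_enum(3)])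
    from giso_trans[OF l3 l2 l1 this giso_sym[OF l1 l2 iso]]
    have "giso A5 (nC + nS) (dsum nC ?C nS ?S) (6 + 16) (dsum 6 perm6 16 \<rho>F)" .
    moreover have "giso A5 (6 + 16) (dsum 6 perm6 16 \<rho>F) (nD + 16) (dsum nD ?D 16 \<rho>F)"
      by (intro giso_dsum gD F glattice_perm X6.giso_perm_rep[OF bij_enum(4) eD(1)] giso_refl[OF F])
    ultimately have "giso A5 (nC + nS) (dsum nC ?C nS ?S) (nD + 16) (dsum nD ?D 16 \<rho>F)"
      by (rule giso_trans[OF l3 l1 l4])
    moreover have "giso A5 (nC + nS) (dsum nC \<rho>C nS \<rho>S) (nD + 16) (dsum nD \<rho>D 16 \<rho>F) \<longleftrightarrow>
        giso A5 (nC + nS) (dsum nC ?C nS ?S) (nD + 16) (dsum nD ?D 16 \<rho>F)"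
      by (rule giso_cong) (simp_all add: dsum_def eC eS eD)
    ultimately show ?thesis using n by simp
  qed
  have "\<forall>C S D nC \<rho>C nS \<rho>S nD \<rho>D.
           subgroup C A5 \<and> A5\<lparr>carrier := C\<rparr> \<cong> integer_mod_group 5 \<and>
           subgroup S A5 \<and> A5\<lparr>carrier := S\<rparr> \<cong> sym_group 3 \<and>
           subgroup D A5 \<and> A5\<lparr>carrier := D\<rparr> \<cong> dihedral_group 5 \<and>
           coset_lattice A5 C nC \<rho>C \<and> coset_lattice A5 S nS \<rho>S \<and> coset_lattice A5 D nD \<rho>D \<longrightarrow>
           nC + nS = 22 \<and> nD + 16 = 22 \<and>
           giso A5 (nC + nS) (dsum nC \<rho>C nS \<rho>S) (nD + 16) (dsum nD \<rho>D 16 \<rho>F)"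
    by (intro allI impI, elim conjE) (rule cosets)
  with res stab show "\<exists>nP \<rho>P \<rho>F A B.
        flabby_resolution A5 nJ \<rho>J nP \<rho>P 16 \<rho>F A B \<and>
        (\<forall>C S D nC \<rho>C nS \<rho>S nD \<rho>D.
           subgroup C A5 \<and> A5\<lparr>carrier := C\<rparr> \<cong> integer_mod_group 5 \<and>
           subgroup S A5 \<and> A5\<lparr>carrier := S\<rparr> \<cong> sym_group 3 \<and>
           subgroup D A5 \<and> A5\<lparr>carrier := D\<rparr> \<cong> dihedral_group 5 \<and>
           coset_lattice A5 C nC \<rho>C \<and> coset_lattice A5 S nS \<rho>S \<and> coset_lattice A5 D nD \<rho>D \<longrightarrow>
           nC + nS = 22 \<and> nD + 16 = 22 \<and>
           giso A5 (nC + nS) (dsum nC \<rho>C nS \<rho>S) (nD + 16) (dsum nD \<rho>D 16 \<rho>F)) \<and>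
        stably_permutation A5 16 \<rho>F"
    by (intro exI conjI)
qed

end
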